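(* Let $S$ be a non-empty set. For any commutator identity $w_1\cdots w_m\equiv 1$ in the free group on $S$, there exist an $S$-colored oriented doodle diagram $D$ in $S^2$ and a noose system ${\cal N}$ for $D$ such that $I(D,{\cal N})$ is the given commutator identity.
   Context: We identify $S^2$ with $\mathbb{R}^2\cup\{\infty\}$. A doodle diagram is a finite collection of oriented immersed circles in $S^2$ whose multiple points are transverse double points (crossings). It is $S$-colored if each component is labelled by an element of $S$. ${\rm Word}(S\cup S^{-1})$ is the free monoid on $S$ and formal inverses $S^{-1}$. A commutator identity on $S$ is an expression $w_1\cdots w_m\equiv 1$ with each $w_i\in{\rm Word}(S\cup S^{-1})$ representing an element of the commutator subgroup of the free group on $S$ and $w_1\cdots w_m$ representing the identity. A noose is the image $N$ of an embedding into $S^2$ of $X=D^2\cup I'$, $D^2$ the closed unit disk, $I'=[1,2]\times\{0\}$; head = image of $D^2$, loop = image of $\partial D^2$ (oriented counterclockwise), rope = image of $I'$, neck = image of $(1,0)$, root = image of $(2,0)$. A noose for $D$: root misses $D$, loop and rope transverse to $D$ and missing crossings. A noose system for $D$: a sequence $(N_1,\dots,N_m)$ of nooses for $D$, pairwise disjoint except for a common root (base point), ropes appearing counterclockwise in this order around the base point, every crossing of $D$ lying in some head. For a path $\alpha$ transverse to $D$, the intersection letter at $x\in\alpha\cap D$ is $a^{\epsilon}$, $a$ the label of the component through $x$, $\epsilon=+1$ if $\alpha$ crosses it from its right-hand side to its left-hand side (with respect to its orientation), $-1$ otherwise; the intersection word along $\alpha$ is the product of letters in order. The intersection word of a noose is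 that along the path from the root along the rope, once counterclockwise around the loop, back to the root. $I(D,{\cal N})$ is the expression $w_1\cdots w_m\equiv1$ with $w_i$ the intersection word of $N_i$. *)

theory Defs
  imports "HOL-Analysis.Analysis" "HOL-Analysis.Cross3"
begin

text \<open>A letter a^(+1) is (a, True), a^(-1) is (a, False).\<close>
type_synonym 's letter = "'s \<times> bool"

definition letter_inv :: "'s letter \<Rightarrow> 's letter" where
  "letter_inv x = (fst x, \<not> snd x)"

definition word_inv :: "'s letter list \<Rightarrow> 's letter list" where
  "word_inv w = rev (map letter_inv w)"

definition word_comm :: "'s letter list \<Rightarrow> 's letter list \<Rightarrow> 's letter list" where
  "word_comm u v = u @ v @ word_inv u @ word_inv v"

definition cancel_step :: "('s letter list \<times> 's letter list) set" where
  "cancel_step = {(xs @ [x, letter_inv x] @ ys, xs @ ys) | xs x ys. True}"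

definition free_eq :: "'s letter list \<Rightarrow> 's letter list \<Rightarrow> bool" where
  "free_eq u v \<longleftrightarrow> (u, v) \<in> (cancel_step \<union> cancel_step\<inverse>)\<^sup>*"

definition is_word :: "'s set \<Rightarrow> 's letter list \<Rightarrow> bool" where
  "is_word S w \<longleftrightarrow> (\<forall>x\<in>set w. fst x \<in> S)"

definition in_commutator_subgroup :: "'s set \<Rightarrow> 's letter list \<Rightarrow> bool" where
  "in_commutator_subgroup S w \<longleftrightarrow>
     (\<exists>cs :: ('s letter list \<times> 's letter list \<times> bool) list.
        (\<forall>(u, v, e) \<in> set cs. is_word S u \<and> is_word S v) \<and>
        free_eq w (concat (map (\<lambda>(u, v, e). if e then word_comm u v else word_inv (word_comm u v)) cs)))"

definition commutator_identity :: "'s set \<Rightarrow> 's letter list list \<Rightarrow> bool" where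
  "commutator_identity S ws \<longleftrightarrow>
     (\<forall>w\<in>set ws. is_word S w \<and> in_commutator_subgroup S w) \<and> free_eq (concat ws) []"

text \<open>S^2 is the unit sphere in R^3, oriented by the outward normal: a tangent frame
  (a,b) at p is positive iff (a \<times> b) \<bullet> p > 0.  The left-hand side of a tangent
  vector T at p is the direction p \<times> T.\<close>
definition S2 :: "(real^3) set" where "S2 = sphere 0 1"

text \<open>A component of a diagram: a label and a 1-periodic C^1 immersion R \<rightarrow> S^2
  (i.e. an oriented immersed circle, parametrised by R/Z).\<close>
type_synonym 's diagram = "('s \<times> (real \<Rightarrow> real^3)) list"

definition immersed_circle :: "(real \<Rightarrow> real^3) \<Rightarrow> bool" where
  "immersed_circle c \<longleftrightarrow>
     (\<forall>t. c (t + 1) = c t) \<and> (\<forall>t. c t \<in> S2) \<and>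
     c C1_differentiable_on UNIV \<and> (\<forall>t. vector_derivative c (at t) \<noteq> 0)"

definition tangent :: "'s diagram \<Rightarrow> nat \<Rightarrow> real \<Rightarrow> real^3" where
  "tangent D i t = vector_derivative (snd (D ! i)) (at t)"

definition preim :: "'s diagram \<Rightarrow> real^3 \<Rightarrow> (nat \<times> real) set" where
  "preim D p = {(i, t). i < length D \<and> 0 \<le> t \<and> t < 1 \<and> snd (D ! i) t = p}"

definition support :: "'s diagram \<Rightarrow> (real^3) set" where
  "support D = {p. preim D p \<noteq> {}}"

definition crossing :: "'s diagram \<Rightarrow> real^3 \<Rightarrow> bool" where
  "crossing D p \<longleftrightarrow> card (preim D p) = 2"

definition doodle :: "'s diagram \<Rightarrow> bool" where
  "doodle D \<longleftrightarrow>
     (\<forall>i < length D. immersed_circle (snd (D ! i))) \<and>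
     (\<forall>p. finite (preim D p) \<and> card (preim D p) \<le> 2) \<and>
     (\<forall>p i t j u. (i, t) \<in> preim D p \<and> (j, u) \<in> preim D p \<and> (i, t) \<noteq> (j, u) \<longrightarrow>
        cross3 (tangent D i t) (tangent D j u) \<noteq> 0)"

definition colored :: "'s set \<Rightarrow> 's diagram \<Rightarrow> bool" where
  "colored S D \<longleftrightarrow> (\<forall>i < length D. fst (D ! i) \<in> S)"

definition path_deriv :: "(real \<Rightarrow> real^3) \<Rightarrow> real \<Rightarrow> real^3" where
  "path_deriv \<alpha> s = vector_derivative \<alpha> (at s within {0..1})"

definition hit_params :: "'s diagram \<Rightarrow> (real \<Rightarrow> real^3) \<Rightarrow> real set" where
  "hit_params D \<alpha> = {s \<in> {0..1}. \<alpha> s \<in> support D}"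

definition transverse_path :: "'s diagram \<Rightarrow> (real \<Rightarrow> real^3) \<Rightarrow> bool" where
  "transverse_path D \<alpha> \<longleftrightarrow>
     finite (hit_params D \<alpha>) \<and>
     (\<forall>s \<in> hit_params D \<alpha>. \<not> crossing D (\<alpha> s) \<and>
        \<alpha> differentiable (at s within {0..1}) \<and>
        (\<forall>(i, t) \<in> preim D (\<alpha> s). cross3 (path_deriv \<alpha> s) (tangent D i t) \<noteq> 0))"

text \<open>Intersection letter: a^{+1} iff alpha crosses from the right-hand side to the
  left-hand side of the component, i.e. its velocity has positive component along
  the left normal  p \<times> T.\<close>
definition int_letter :: "'s diagram \<Rightarrow> (real \<Rightarrow> real^3) \<Rightarrow> real \<Rightarrow> 's letter" where
  "int_letter D \<alpha> s =
     (let (i, t) = (THE it. it \<in> preim D (\<alpha> s)) in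
       (fst (D ! i), cross3 (\<alpha> s) (tangent D i t) \<bullet> path_deriv \<alpha> s > 0))"

definition int_word :: "'s diagram \<Rightarrow> (real \<Rightarrow> real^3) \<Rightarrow> 's letter list" where
  "int_word D \<alpha> = map (int_letter D \<alpha>) (sorted_list_of_set (hit_params D \<alpha>))"

definition noose_X :: "complex set" where
  "noose_X = cball 0 1 \<union> closed_segment 1 2"

definition head :: "(complex \<Rightarrow> real^3) \<Rightarrow> (real^3) set" where
  "head \<phi> = \<phi> ` cball 0 1"
definition neck :: "(complex \<Rightarrow> real^3) \<Rightarrow> real^3" where "neck \<phi> = \<phi> 1"
definition root :: "(complex \<Rightarrow> real^3) \<Rightarrow> real^3" where "root \<phi> = \<phi> 2"

definition loop_param :: "(complex \<Rightarrow> real^3) \<Rightarrow> real \<Rightarrow> real^3" where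
  "loop_param \<phi> t = \<phi> (cis (2 * pi * t))"
definition rope_in :: "(complex \<Rightarrow> real^3) \<Rightarrow> real \<Rightarrow> real^3" where
  "rope_in \<phi> s = \<phi> (of_real (2 - s))"
definition rope_out :: "(complex \<Rightarrow> real^3) \<Rightarrow> real \<Rightarrow> real^3" where
  "rope_out \<phi> s = \<phi> (of_real (1 + s))"

text \<open>The head lies on the left of the parametrised loop (tested at the neck: points
  on the great circle leaving the neck in the left normal direction enter the head).\<close>
definition head_on_left :: "(complex \<Rightarrow> real^3) \<Rightarrow> bool" where
  "head_on_left \<phi> \<longleftrightarrow>
     (let p = loop_param \<phi> 0; L = cross3 p (vector_derivative (loop_param \<phi>) (at 0)) in
       \<exists>\<delta>>0. \<forall>\<epsilon>. 0 < \<epsilon> \<and> \<epsilon> < \<delta> \<longrightarrow> cos \<epsilon> *\<^sub>R p + (sin \<epsilon> / norm L) *\<^sub>R L \<in> head \<phi>)"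

definition loop_ccw :: "(complex \<Rightarrow> real^3) \<Rightarrow> real \<Rightarrow> real^3" where
  "loop_ccw \<phi> t = (if head_on_left \<phi> then loop_param \<phi> t else loop_param \<phi> (1 - t))"

definition noose :: "(complex \<Rightarrow> real^3) \<Rightarrow> bool" where
  "noose \<phi> \<longleftrightarrow>
     continuous_on noose_X \<phi> \<and> inj_on \<phi> noose_X \<and> \<phi> ` noose_X \<subseteq> S2 \<and>
     loop_param \<phi> C1_differentiable_on UNIV \<and>
     (\<forall>t. vector_derivative (loop_param \<phi>) (at t) \<noteq> 0) \<and>
     (\<exists>V. continuous_on {0..1} V \<and>
        (\<forall>s\<in>{0..1}. (rope_in \<phi> has_vector_derivative V s) (at s within {0..1}) \<and> V s \<noteq> 0))"

definition noose_for :: "'s diagram \<Rightarrow> (complex \<Rightarrow> real^3) \<Rightarrow> bool" where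
  "noose_for D \<phi> \<longleftrightarrow>
     noose \<phi> \<and> root \<phi> \<notin> support D \<and> neck \<phi> \<notin> support D \<and>
     transverse_path D (loop_ccw \<phi>) \<and> transverse_path D (rope_in \<phi>) \<and>
     transverse_path D (rope_out \<phi>)"

definition noose_word :: "'s diagram \<Rightarrow> (complex \<Rightarrow> real^3) \<Rightarrow> 's letter list" where
  "noose_word D \<phi> = int_word D (rope_in \<phi>) @ int_word D (loop_ccw \<phi>) @ int_word D (rope_out \<phi>)"

definition ccw_angle :: "real^3 \<Rightarrow> real^3 \<Rightarrow> real^3 \<Rightarrow> real" where
  "ccw_angle b u v =
     (let e1 = u /\<^sub>R norm u; e2 = cross3 b e1; a = Arg (Complex (v \<bullet> e1) (v \<bullet> e2)) in
       if a < 0 then a + 2 * pi else a)"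

definition rope_dir :: "(complex \<Rightarrow> real^3) \<Rightarrow> real^3" where
  "rope_dir \<phi> = path_deriv (rope_in \<phi>) 0"

definition noose_system :: "'s diagram \<Rightarrow> (complex \<Rightarrow> real^3) list \<Rightarrow> bool" where
  "noose_system D N \<longleftrightarrow>
     (\<forall>k < length N. noose_for D (N ! k)) \<and>
     (\<exists>b. (\<forall>k < length N. root (N ! k) = b) \<and>
          (\<forall>k < length N. \<forall>l < length N. k \<noteq> l \<longrightarrow>
              (N ! k) ` noose_X \<inter> (N ! l) ` noose_X = {b}) \<and>
          (\<forall>k l. k < l \<and> l < length N \<longrightarrow>
              ccw_angle b (rope_dir (N ! 0)) (rope_dir (N ! k))
                < ccw_angle b (rope_dir (N ! 0)) (rope_dir (N ! l)))) \<and>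
     (\<forall>p. crossing D p \<longrightarrow> (\<exists>k < length N. p \<in> head (N ! k)))"

end

theory Submission
  imports Defs
begin

text \<open>Put the letters of all words on a line in the plane, with the heads of the nooses below the line,
  each containing the letters of its word on its boundary, and with ropes leading further down to a
  common root. Since the product of the words is trivial, its letters can be matched with inverse
  letters without crossings, by disjoint semicircles above the line. Since each word has exponent
  sums zero, its letters can be matched with inverse letters inside the head, by semicircles below
  the line, which may cross. Both families meet the line vertically, so they close up to immersed
  circles. With the letters at the points \<open>-4^i\<close>, no three of the lower semicircles meet in a
  point. The plane is mapped to a hemisphere by central projection.\<close>

section \<open>Words, noncrossing matchings and permutation cycles\<close>

text \<open>The positions are negative because a counterclockwise loop around a head below the axis
  runs along the top of that head from right to left, and this is the direction in which a word is
  read. For the same reason successive heads proceed leftwards, which is the counterclockwise order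
  of straight ropes rising from a common root. The obstacle is the ban on triple points. An explicit
  lacunary choice of positions takes the place of a general position argument, and transversality
  comes for free: two semicircles centred on the axis are transverse at a common point off the axis
  as soon as their centres differ. Both matchings send a letter to its inverse, so following upper
  and lower semicircles alternately gives a permutation of the positions. Its cycles are the
  components of the diagram, and since the symbol of the letter is constant on a cycle it can serve
  as the color. The projection is central because it takes great circles to lines: the great-circle
  test for the side of the head becomes a test along a ray in the plane.\<close>

fun push :: "'s letter \<Rightarrow> 's letter list \<Rightarrow> 's letter list" where
  "push x [] = [x]"
| "push x (y # ys) = (if y = letter_inv x then ys else x # y # ys)"

definition reduce :: "'s letter list \<Rightarrow> 's letter list" where
  "reduce w = foldr push w []"

fun reduced :: "'s letter list \<Rightarrow> bool" where
  "reduced (x # y # ys) \<longleftrightarrow> y \<noteq> letter_inv x \<and> reduced (y # ys)"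
| "reduced _ \<longleftrightarrow> True"

lemma letter_inv_inv [simp]: "letter_inv (letter_inv x) = x"
  by (simp add: letter_inv_def)

lemma letter_inv_eq_iff: "letter_inv x = y \<longleftrightarrow> x = letter_inv y"
  by auto

lemma reduced_tl: "reduced (y # ys) \<Longrightarrow> reduced ys"
  by (cases ys) auto

lemma reduced_push: "reduced r \<Longrightarrow> reduced (push x r)"
  by (cases r) (auto dest: reduced_tl)

text \<open>If \<open>r\<close> starts with \<open>x\<close>, the inner \<open>push\<close> removes
  that letter, and reducedness keeps the outer one from cancelling again. Thus letters act on
  reduced words by mutually inverse maps, which makes \<open>reduce\<close> an invariant of
  \<open>free_eq\<close>.\<close>

lemma push_push_inv: "reduced r \<Longrightarrow> push x (push (letter_inv x) r) = r"
proof (cases r)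
  case (Cons y ys)
  then show "reduced r \<Longrightarrow> ?thesis"
    by (cases ys) (auto simp: letter_inv_eq_iff)
qed simp

lemma reduced_foldr: "reduced r \<Longrightarrow> reduced (foldr push w r)"
  by (induction w) (auto intro: reduced_push)

lemma reduce_cancel_step:
  assumes "(u, v) \<in> cancel_step" shows "reduce u = reduce v"
proof -
  obtain xs x ys where "u = xs @ [x, letter_inv x] @ ys" "v = xs @ ys"
    using assms by (auto simp: cancel_step_def)
  moreover have "reduced (foldr push ys [])"
    by (rule reduced_foldr) simp
  ultimately show ?thesis
    by (simp add: reduce_def push_push_inv)
qed

lemma reduce_free_eq: "free_eq u v \<Longrightarrow> reduce u = reduce v"
  unfolding free_eq_def
  by (induction rule: rtrancl_induct) (auto dest: reduce_cancel_step)

section \<open>Words that cancel by nested pairs\<close>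

inductive dyck :: "'s letter list \<Rightarrow> bool" where
  Nil: "dyck []"
| Cons: "dyck u \<Longrightarrow> dyck v \<Longrightarrow> dyck (x # u @ letter_inv x # v)"

text \<open>The first letter \<open>y\<close> of the normal form survives from some occurrence in
  \<open>w\<close>, and everything before that occurrence cancels by nested pairs. If the first
  letter \<open>x\<close> of \<open>w\<close> is not the survivor, it cancels against a
  \<open>letter_inv x\<close> that heads the normal form of the tail. The induction hypothesis is
  used twice: to locate this partner, and then to locate \<open>y\<close> behind it.\<close>

lemma reduce_eq_ConsD:
  "reduce w = y # r \<Longrightarrow> \<exists>u v. w = u @ y # v \<and> dyck u \<and> reduce v = r"
proof (induction "length w" arbitrary: w y r rule: less_induct)
  case less
  obtain x w' where w: "w = x # w'"
    using less.prems by (cases w) (auto simp: reduce_def)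
  have eq: "push x (reduce w') = y # r"
    using less.prems by (simp add: w reduce_def)
  show ?case
  proof (cases "x = y \<and> r = reduce w'")
    case True
    then show ?thesis using dyck.Nil w by fastforce
  next
    case False
    then have r': "reduce w' = letter_inv x # y # r"
      using eq by (cases "reduce w'") (auto split: if_splits)
    obtain u1 v1 where 1: "w' = u1 @ letter_inv x # v1" "dyck u1" "reduce v1 = y # r"
      using less.hyps[OF _ r'] w by auto
    obtain u2 v2 where 2: "v1 = u2 @ y # v2" "dyck u2" "reduce v2 = r"
      using less.hyps[OF _ 1(3)] w 1 by auto
    have "w = (x # u1 @ letter_inv x # u2) @ y # v2" using w 1 2 by simp
    then show ?thesis using dyck.Cons[OF 1(2) 2(2)] 2(3) by blast
  qed
qed

lemma dyck_if_reduce_Nil: "reduce w = [] \<Longrightarrow> dyck w"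
proof (induction "length w" arbitrary: w rule: less_induct)
  case less
  show ?case
  proof (cases w)
    case (Cons x w')
    have "push x (reduce w') = []" using less.prems by (simp add: Cons reduce_def)
    then have "reduce w' = [letter_inv x]"
      by (cases "reduce w'") (auto split: if_splits)
    then obtain u v where "w' = u @ letter_inv x # v" "dyck u" "reduce v = []"
      using reduce_eq_ConsD by metis
    then show ?thesis using less.hyps[of v] Cons by (auto intro: dyck.Cons)
  qed (simp add: dyck.Nil)
qed

lemma dyck_if_free_eq_Nil: "free_eq w [] \<Longrightarrow> dyck w"
  using dyck_if_reduce_Nil reduce_free_eq by (fastforce simp: reduce_def)

section \<open>Noncrossing matchings of positions on a line\<close>

definition noncrossing_matching :: "nat set \<Rightarrow> (nat \<Rightarrow> nat) \<Rightarrow> bool" where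
  "noncrossing_matching A \<sigma> \<longleftrightarrow>
     (\<forall>i\<in>A. \<sigma> i \<in> A \<and> \<sigma> (\<sigma> i) = i) \<and>
     (\<forall>i\<in>A. \<forall>j\<in>A. i < j \<and> j < \<sigma> i \<longrightarrow> i < \<sigma> j \<and> \<sigma> j < \<sigma> i)"

lemma noncrossing_matchingI:
  assumes "\<And>i. i \<in> A \<Longrightarrow> \<sigma> i \<in> A" "\<And>i. i \<in> A \<Longrightarrow> \<sigma> (\<sigma> i) = i"
    "\<And>i j. i \<in> A \<Longrightarrow> j \<in> A \<Longrightarrow> i < j \<Longrightarrow> j < \<sigma> i \<Longrightarrow> i < \<sigma> j \<and> \<sigma> j < \<sigma> i"
  shows "noncrossing_matching A \<sigma>"
  using assms by (auto simp: noncrossing_matching_def)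

lemma noncrossing_matchingD:
  assumes "noncrossing_matching A \<sigma>" "i \<in> A"
  shows "\<sigma> i \<in> A" "\<sigma> (\<sigma> i) = i"
    "j \<in> A \<Longrightarrow> i < j \<Longrightarrow> j < \<sigma> i \<Longrightarrow> i < \<sigma> j \<and> \<sigma> j < \<sigma> i"
  using assms by (auto simp: noncrossing_matching_def)

text \<open>This lemma and the next one mirror the \<open>Cons\<close> rule of \<open>dyck\<close>:
  an outer pair is put around a matching, and two matchings are placed side by side.\<close>

lemma noncrossing_matching_nest:
  assumes s: "noncrossing_matching A \<sigma>" and A: "\<And>i. i \<in> A \<Longrightarrow> a < i \<and> i < b" and ab: "a < b"
  shows "noncrossing_matching (insert a (insert b A)) (\<sigma>(a := b, b := a))"
    (is "noncrossing_matching ?B ?\<rho>")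
proof (rule noncrossing_matchingI)
  have \<rho>: "?\<rho> i = \<sigma> i \<and> ?\<rho> (\<sigma> i) = i \<and> \<sigma> i \<in> A \<and> a < \<sigma> i \<and> \<sigma> i < b" if "i \<in> A" for i
    using A[OF that] noncrossing_matchingD(1,2)[OF s that] A[of "\<sigma> i"] by auto
  show "?\<rho> i \<in> ?B" "?\<rho> (?\<rho> i) = i" if "i \<in> ?B" for i
    using that \<rho>[of i] ab by auto
  show "i < ?\<rho> j \<and> ?\<rho> j < ?\<rho> i" if ij: "i \<in> ?B" "j \<in> ?B" "i < j" "j < ?\<rho> i" for i j
  proof (cases "i \<in> A")
    case True
    then have "j \<in> A" using ij \<rho>[OF True] A[OF True] by auto
    then show ?thesis
      using noncrossing_matchingD(3)[OF s True] ij \<rho>[OF True] \<rho>[of j] by simp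
  next
    case False
    then have "i = a \<and> j \<in> A" using ij ab by auto
    then show ?thesis using \<rho>[of j] ab by simp
  qed
qed

lemma noncrossing_matching_Un:
  assumes s: "noncrossing_matching A \<sigma>" and t: "noncrossing_matching B \<tau>"
    and AB: "\<And>i j. i \<in> A \<Longrightarrow> j \<in> B \<Longrightarrow> i < j"
  shows "noncrossing_matching (A \<union> B) (\<lambda>i. if i \<in> A then \<sigma> i else \<tau> i)"
    (is "noncrossing_matching _ ?\<rho>")
proof (rule noncrossing_matchingI)
  have B: "i \<notin> A" if "i \<in> B" for i using AB[OF _ that] by blast
  show "?\<rho> i \<in> A \<union> B" "?\<rho> (?\<rho> i) = i" if "i \<in> A \<union> B" for i
    using that noncrossing_matchingD(1,2)[OF s] noncrossing_matchingD(1,2)[OF t] B by auto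
  show "i < ?\<rho> j \<and> ?\<rho> j < ?\<rho> i" if ij: "i \<in> A \<union> B" "j \<in> A \<union> B" "i < j" "j < ?\<rho> i" for i j
  proof (cases "i \<in> A")
    case True
    then have "j \<in> A" using ij AB[of "\<sigma> i" j] noncrossing_matchingD(1)[OF s True] by auto
    then show ?thesis using noncrossing_matchingD(3)[OF s True] ij True by simp
  next
    case False
    then have i: "i \<in> B" using ij by auto
    then have "j \<notin> A" using ij(3) AB[of j i] by auto
    then show ?thesis using noncrossing_matchingD(3)[OF t i] ij False by auto
  qed
qed
text \<open>Each letter of \<open>zs\<close> carries its position, so that the two sublists produced
  by the rule \<open>Cons\<close> keep their places on the common line; the positions may have
  gaps.\<close>

lemma dyck_noncrossing_matching:
  assumes "dyck (map snd zs)" "sorted_wrt (<) (map fst zs)"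
  shows "\<exists>\<sigma>. noncrossing_matching (fst ` set zs) \<sigma> \<and>
    (\<forall>(i, x) \<in> set zs. (\<sigma> i, letter_inv x) \<in> set zs)"
  using assms
proof (induction "map snd zs" arbitrary: zs rule: dyck.induct)
  case Nil
  then show ?case by (simp add: noncrossing_matching_def)
next
  case (Cons u v x)
  obtain a b us vs where zs: "zs = (a, x) # us @ (b, letter_inv x) # vs"
      and u: "u = map snd us" and v: "v = map snd vs"
    using Cons.hyps(5) by (auto simp: Cons_eq_map_conv append_eq_map_conv)
  have srt: "sorted_wrt (<) (map fst us)" "sorted_wrt (<) (map fst vs)"
    "\<And>i. i \<in> fst ` set us \<Longrightarrow> a < i \<and> i < b" "a < b"
    "\<And>j. j \<in> fst ` set vs \<Longrightarrow> a < j \<and> b < j"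
    "\<And>i j. i \<in> fst ` set us \<Longrightarrow> j \<in> fst ` set vs \<Longrightarrow> i < j"
    using Cons.prems by (auto simp: zs sorted_wrt_append)
  obtain \<sigma> where s: "noncrossing_matching (fst ` set us) \<sigma>"
      "\<forall>(i, x) \<in> set us. (\<sigma> i, letter_inv x) \<in> set us"
    using Cons.hyps(2)[OF u srt(1)] by blast
  obtain \<tau> where t: "noncrossing_matching (fst ` set vs) \<tau>"
      "\<forall>(i, x) \<in> set vs. (\<tau> i, letter_inv x) \<in> set vs"
    using Cons.hyps(4)[OF v srt(2)] by blast
  define A where "A = insert a (insert b (fst ` set us))"
  define \<rho> where "\<rho> = (\<lambda>i. if i \<in> A then (\<sigma>(a := b, b := a)) i else \<tau> i)"
  have "noncrossing_matching (A \<union> fst ` set vs) \<rho>"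
    unfolding \<rho>_def
  proof (rule noncrossing_matching_Un)
    show "noncrossing_matching A (\<sigma>(a := b, b := a))"
      unfolding A_def by (intro noncrossing_matching_nest s(1) srt)
    show "i < j" if "i \<in> A" "j \<in> fst ` set vs" for i j
      using that srt(4-6) by (auto simp: A_def)
  qed (rule t(1))
  moreover have "A \<union> fst ` set vs = fst ` set zs" by (auto simp: A_def zs)
  moreover have "(\<rho> i, letter_inv y) \<in> set zs" if iy: "(i, y) \<in> set zs" for i y
  proof -
    consider "i = a" "y = x" | "i = b" "y = letter_inv x" | "(i, y) \<in> set us" | "(i, y) \<in> set vs"
      using iy by (auto simp: zs)
    then show ?thesis
    proof cases
      case 3
      then have "a < i \<and> i < b" using srt(3)[of i] by force
      then have "\<rho> i = \<sigma> i" using 3 by (auto simp: \<rho>_def A_def image_iff)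
      then show ?thesis using s(2) 3 by (auto simp: zs)
    next
      case 4
      then have i: "i \<in> fst ` set vs" by force
      have "i \<notin> A" using srt(4,5) i srt(6)[OF _ i] unfolding A_def
        by (metis insert_iff order_less_asym order_less_irrefl)
      then have "\<rho> i = \<tau> i" by (simp add: \<rho>_def)
      then show ?thesis using t(2) 4 by (auto simp: zs)
    qed (use \<open>a < b\<close> in \<open>auto simp: \<rho>_def A_def zs\<close>)
  qed
  ultimately show ?case by (intro exI[of _ \<rho>]) force
qed

section \<open>Exponent sums and matchings inside one word\<close>

definition exponent_sum :: "'s \<Rightarrow> 's letter list \<Rightarrow> int" where
  "exponent_sum a w = (\<Sum>x\<leftarrow>w. if fst x = a then (if snd x then 1 else - 1) else 0)"

lemma exponent_sum_append [simp]:
  "exponent_sum a (u @ v) = exponent_sum a u + exponent_sum a v"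
  by (simp add: exponent_sum_def)

lemma exponent_sum_Nil [simp]: "exponent_sum a [] = 0"
  by (simp add: exponent_sum_def)

lemma exponent_sum_inv [simp]: "exponent_sum a (word_inv w) = - exponent_sum a w"
  by (induction w) (auto simp: exponent_sum_def word_inv_def letter_inv_def)

lemma exponent_sum_free_eq: "free_eq u v \<Longrightarrow> exponent_sum a u = exponent_sum a v"
  unfolding free_eq_def
proof (induction rule: rtrancl_induct)
  case (step v w)
  have "exponent_sum a v' = exponent_sum a w'" if "(v', w') \<in> cancel_step" for v' w'
    using that unfolding cancel_step_def by (auto simp: exponent_sum_def letter_inv_def)
  then show ?case using step by (metis UnE converseD)
qed simp

text \<open>An exponent sum is a homomorphism to the integers, so it vanishes on commutators and
  their inverses. This is what the construction takes from membership in the commutator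
  subgroup.\<close>

lemma exponent_sum_commutator_subgroup:
  assumes "in_commutator_subgroup S w" shows "exponent_sum a w = 0"
proof -
  obtain cs where "free_eq w (concat (map (\<lambda>(u, v, e). if e then word_comm u v
      else word_inv (word_comm u v)) cs))"
    using assms unfolding in_commutator_subgroup_def by (elim exE conjE)
  moreover have "exponent_sum a (concat (map (\<lambda>(u, v, e). if e then word_comm u v
      else word_inv (word_comm u v)) cs)) = 0"
    by (induction cs) (simp_all add: word_comm_def split: prod.split)
  ultimately show ?thesis by (simp add: exponent_sum_free_eq)
qed

lemma exponent_sum_card:
  "exponent_sum a w = int (card {j. j < length w \<and> w ! j = (a, True)})
     - int (card {j. j < length w \<and> w ! j = (a, False)})"
proof (induction w rule: rev_induct)
  case (snoc x w)
  have card: "card {j. j < length (w @ [x]) \<and> (w @ [x]) ! j = y} =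
      card {j. j < length w \<and> w ! j = y} + (if x = y then 1 else 0)" for y
  proof -
    have "{j. j < length (w @ [x]) \<and> (w @ [x]) ! j = y} =
        (if x = y then insert (length w) {j. j < length w \<and> w ! j = y}
         else {j. j < length w \<and> w ! j = y})"
      by (auto simp: nth_append less_Suc_eq split: if_splits)
    then show ?thesis by (simp only:) simp
  qed
  have "exponent_sum a [x] =
      (if x = (a, True) then 1 else 0) - (if x = (a, False) then 1 else 0)"
    by (cases x) (auto simp: exponent_sum_def)
  then show ?case unfolding card exponent_sum_append snoc.IH by (simp only: of_nat_add) simp
qed simp

text \<open>Bijections chosen fibre by fibre combine to one. A fibre will consist of the occurrences
  of one symbol with one sign in one word; vanishing exponent sums say that the fibres for the two
  signs are equally large.\<close>

lemma bij_betw_fibrewise: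
  assumes "finite A" "finite B"
    and "\<And>c. card {a \<in> A. f a = c} = card {b \<in> B. g b = c}"
  shows "\<exists>\<tau>. bij_betw \<tau> A B \<and> (\<forall>a\<in>A. g (\<tau> a) = f a)"
proof -
  have "\<exists>h. bij_betw h {a \<in> A. f a = c} {b \<in> B. g b = c}" for c
    by (rule finite_same_card_bij) (use assms in simp_all)
  then obtain h where h: "\<And>c. bij_betw (h c) {a \<in> A. f a = c} {b \<in> B. g b = c}"
    by metis
  define \<tau> where "\<tau> a = h (f a) a" for a
  have mem: "\<tau> a \<in> B \<and> g (\<tau> a) = f a" if "a \<in> A" for a
    using bij_betwE[OF h[of "f a"]] that unfolding \<tau>_def by blast
  have "inj_on \<tau> A"
  proof (rule inj_onI)
    fix a b assume ab: "a \<in> A" "b \<in> A" "\<tau> a = \<tau> b"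
    then have "f a = f b" using mem by metis
    then show "a = b"
      using inj_onD[OF bij_betw_imp_inj_on[OF h[of "f a"]], of a b] ab by (simp add: \<tau>_def)
  qed
  moreover have "b \<in> \<tau> ` A" if "b \<in> B" for b
  proof -
    have "b \<in> h (g b) ` {a \<in> A. f a = g b}"
      using bij_betw_imp_surj_on[OF h[of "g b"]] that by simp
    then obtain a where "a \<in> A" "f a = g b" "b = h (g b) a" by auto
    then show ?thesis unfolding \<tau>_def by (intro image_eqI[of _ _ a]) simp_all
  qed
  ultimately show ?thesis using mem unfolding bij_betw_def by blast
qed

text \<open>Induction on the cardinality: the orbit of some \<open>x\<close> is split off and
  \<open>f\<close> still permutes the rest. The least period \<open>p\<close> of \<open>x\<close>
  makes the listing of the orbit free of repetitions.\<close>

lemma permutation_cycles: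
  assumes "finite A" "bij_betw f A A"
  shows "\<exists>cs. distinct (concat cs) \<and> set (concat cs) = A \<and>
    (\<forall>c\<in>set cs. c \<noteq> [] \<and> (\<forall>i<length c. f (c ! i) = c ! (Suc i mod length c)))"
  using assms
proof (induction "card A" arbitrary: A rule: less_induct)
  case less
  show ?case
  proof (cases "A = {}")
    case True
    then show ?thesis by (intro exI[of _ "[]"]) simp
  next
    case False
    then obtain x where x: "x \<in> A" by blast
    have inj: "inj_on f A" and im: "f ` A = A" using less.prems by (auto simp: bij_betw_def)
    have mem: "(f ^^ n) x \<in> A" for n
      using x im by (induction n) auto
    \<comment> \<open>Injectivity on \<open>A\<close> cancels common powers of \<open>f\<close>, so
      every coincidence of two iterates yields a period.\<close>
    have shift: "(f ^^ (m - n)) x = x" if "(f ^^ m) x = (f ^^ n) x" "n \<le> m" for m n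
      using that
    proof (induction n arbitrary: m)
      case (Suc n)
      then obtain m' where m': "m = Suc m'" by (cases m) auto
      have "(f ^^ m') x = (f ^^ n) x"
        using Suc.prems mem inj by (auto simp: m' inj_on_def)
      then show ?case using Suc.IH[of m'] Suc.prems m' by simp
    qed simp
    have "\<not> inj (\<lambda>n. (f ^^ n) x)"
      using finite_subset[of "range (\<lambda>n. (f ^^ n) x)" A] less.prems(1) mem
        finite_imageD[of "\<lambda>n. (f ^^ n) x" UNIV] by auto
    then obtain m n where "(f ^^ m) x = (f ^^ n) x" "n < m"
      unfolding inj_def by (metis linorder_neq_iff)
    then have ex: "\<exists>p. 0 < p \<and> (f ^^ p) x = x"
      using shift[of m n] by (intro exI[of _ "m - n"]) auto
    define p where "p = (LEAST p. 0 < p \<and> (f ^^ p) x = x)"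
    have p: "0 < p" "(f ^^ p) x = x" using LeastI_ex[OF ex] by (auto simp: p_def)
    have pmin: "(f ^^ q) x \<noteq> x" if "0 < q" "q < p" for q
      using not_less_Least[of q "\<lambda>p. 0 < p \<and> (f ^^ p) x = x"] that by (auto simp: p_def)
    define c where "c = map (\<lambda>n. (f ^^ n) x) [0..<p]"
    have lc: "length c = p" by (simp add: c_def)
    have "inj_on (\<lambda>n. (f ^^ n) x) {0..<p}"
    proof (rule linorder_inj_onI)
      fix n m assume "n < m" "n \<in> {0..<p}" "m \<in> {0..<p}"
      then show "(f ^^ n) x \<noteq> (f ^^ m) x" using shift[of m n] pmin[of "m - n"] by auto
    qed auto
    then have dc: "distinct c" by (simp add: c_def distinct_map)
    have step: "f (c ! i) = c ! (Suc i mod length c)" if "i < length c" for i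
    proof (cases "Suc i = p")
      case True
      then have "f ((f ^^ i) x) = (f ^^ p) x" by auto
      then show ?thesis using that True p by (simp add: lc c_def)
    qed (use that in \<open>simp add: lc c_def\<close>)
    have setc: "set c \<subseteq> A" using mem by (auto simp: c_def)
    have "f ` set c = set c"
    proof
      show "f ` set c \<subseteq> set c"
      proof
        fix y assume "y \<in> f ` set c"
        then obtain i where "i < p" "y = f (c ! i)" using lc by (auto simp: in_set_conv_nth)
        then show "y \<in> set c" using step[of i] p(1) lc by (auto intro!: nth_mem)
      qed
      then show "set c \<subseteq> f ` set c"
        using card_subset_eq[of "set c" "f ` set c"] card_image[OF inj_on_subset[OF inj setc]] by simp
    qed
    then have "bij_betw f (A - set c) (A - set c)"
      using bij_betw_DiffI[OF less.prems(2) bij_betw_subset[OF less.prems(2) setc] setc setc] by simp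
    moreover have "card (A - set c) < card A"
      using less.prems(1) setc p(1) lc card_Diff_subset[of "set c" A] distinct_card[OF dc]
        card_mono[OF less.prems(1) setc] by simp
    ultimately obtain cs where cs: "distinct (concat cs)" "set (concat cs) = A - set c"
      "\<forall>c\<in>set cs. c \<noteq> [] \<and> (\<forall>i<length c. f (c ! i) = c ! (Suc i mod length c))"
      using less.hyps[of "A - set c"] less.prems(1) by (meson finite_Diff)
    have "distinct (concat (c # cs))" using dc cs by auto
    moreover have "set (concat (c # cs)) = A" using cs(2) setc by auto
    moreover have "c \<noteq> []" using p(1) lc by auto
    ultimately show ?thesis using cs(3) step by (metis set_ConsD)
  qed
qed

section \<open>The gnomonic chart of the sphere\<close>

definition hor :: "complex \<Rightarrow> real^3" where
  "hor v = vector [Re v, Im v, 0]"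

text \<open>The offset \<open>h\<close> places the planar point \<open>Complex 0 (- h)\<close> below
  the pole of the sphere. The root will be put there, so that the derivative of the chart at the
  root is just \<open>hor\<close> and angles between ropes are Euclidean angles.\<close>

definition lift :: "real \<Rightarrow> complex \<Rightarrow> real^3" where
  "lift h z = vector [Re z, Im z + h, 1]"

definition chart :: "real \<Rightarrow> complex \<Rightarrow> real^3" where
  "chart h z = lift h z /\<^sub>R norm (lift h z)"

text \<open>The derivative of \<open>chart h\<close> at \<open>z\<close> in direction
  \<open>v\<close>, from differentiating \<open>q / norm q\<close>. The second term is radial, hence
  invisible in triple products with \<open>chart h z\<close>.\<close>

definition dchart :: "real \<Rightarrow> complex \<Rightarrow> complex \<Rightarrow> real^3" where
  "dchart h z v = hor v /\<^sub>R norm (lift h z)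
     - ((lift h z \<bullet> hor v) / norm (lift h z) ^ 3) *\<^sub>R lift h z"

definition cdet :: "complex \<Rightarrow> complex \<Rightarrow> real" where
  "cdet u v = Re u * Im v - Im u * Re v"

lemma lift_nth [simp]: "lift h z $ 1 = Re z" "lift h z $ 2 = Im z + h" "lift h z $ 3 = 1"
  by (simp_all add: lift_def)

lemma hor_nth [simp]: "hor z $ 1 = Re z" "hor z $ 2 = Im z" "hor z $ 3 = 0"
  by (simp_all add: hor_def)

lemma norm_lift_pos [simp]: "norm (lift h z) > 0"
proof -
  have "lift h z \<noteq> 0" by (metis lift_nth(3) zero_index zero_neq_one)
  then show ?thesis by simp
qed

lemma lift_nonzero [simp]: "lift h z \<noteq> 0"
  using norm_lift_pos[of h z] by (metis norm_zero order_less_irrefl)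

lemma norm_chart [simp]: "norm (chart h z) = 1"
  by (simp add: chart_def)

lemma chart_in_S2 [simp]: "chart h z \<in> S2"
  by (simp add: S2_def)

lemma chart_eqI:
  assumes "norm v = 1" "v $ 3 > 0"
  shows "v = chart h (Complex (v $ 1 / v $ 3) (v $ 2 / v $ 3 - h))"
proof -
  have "lift h (Complex (v $ 1 / v $ 3) (v $ 2 / v $ 3 - h)) = v /\<^sub>R v $ 3"
    using assms by (simp add: vec_eq_iff forall_3 divide_inverse)
  then show ?thesis using assms by (simp add: chart_def)
qed

lemma inj_chart: "inj (chart h)"
proof (rule injI)
  fix z w assume eq: "chart h z = chart h w"
  have "chart h z $ 3 = inverse (norm (lift h z))" "chart h w $ 3 = inverse (norm (lift h w))"
    by (simp_all add: chart_def)
  then have n: "norm (lift h z) = norm (lift h w)" using eq by (simp add: inverse_eq_iff_eq)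
  then have "lift h z = lift h w"
    using eq norm_lift_pos[of h w] unfolding chart_def
    by (metis inverse_nonzero_iff_nonzero order_less_irrefl real_vector.scale_left_imp_eq)
  then have "lift h z $ i = lift h w $ i" for i by simp
  from this[of 1] this[of 2] show "z = w" by (simp add: complex_eq_iff)
qed

lemma chart_eq_iff [simp]: "chart h z = chart h w \<longleftrightarrow> z = w"
  using inj_chart by (auto simp: inj_def)

lemma bounded_linear_hor: "bounded_linear hor"
  by (rule linear_conv_bounded_linear[THEN iffD1], rule linearI)
     (simp_all add: vec_eq_iff forall_3)

lemma lift_eq_hor: "lift h z = hor z + lift h 0"
  by (simp add: vec_eq_iff forall_3)

lemma lift_has_vector_derivative:
  assumes "(\<gamma> has_vector_derivative v) (at t within T)"
  shows "((\<lambda>t. lift h (\<gamma> t)) has_vector_derivative hor v) (at t within T)"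
  using bounded_linear.has_vector_derivative[OF bounded_linear_hor assms]
  by (subst lift_eq_hor) (auto intro!: derivative_eq_intros)

lemma chart_has_vector_derivative:
  assumes "(\<gamma> has_vector_derivative v) (at t within T)"
  shows "((\<lambda>t. chart h (\<gamma> t)) has_vector_derivative dchart h (\<gamma> t) v) (at t within T)"
proof -
  let ?q = "\<lambda>t. lift h (\<gamma> t)"
  note q = lift_has_vector_derivative[OF assms, of h]
  have n: "((\<lambda>t. norm (?q t)) has_vector_derivative (?q t \<bullet> hor v) / norm (?q t)) (at t within T)"
  proof -
    have "(norm has_derivative (\<lambda>x. x \<bullet> sgn (?q t))) (at (?q t) within range ?q)"
      by (rule has_derivative_at_withinI) (rule has_derivative_norm, simp)
    then have "(norm has_derivative (\<lambda>x. x \<bullet> sgn (?q t))) (at (?q t) within ?q ` T)"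
      by (rule has_derivative_subset) auto
    from diff_chain_within[OF q[unfolded has_vector_derivative_def] this]
    show ?thesis
      by (simp add: has_vector_derivative_def comp_def sgn_div_norm inner_commute divide_inverse
          mult.assoc mult.left_commute) (simp add: mult.commute)
  qed
  have "((\<lambda>t. inverse (norm (?q t))) has_vector_derivative
      - ((?q t \<bullet> hor v) / norm (?q t) ^ 3)) (at t within T)"
    using DERIV_inverse'[OF n[unfolded has_real_derivative_iff_has_vector_derivative[symmetric]]]
    by (simp add: has_real_derivative_iff_has_vector_derivative[symmetric] power3_eq_cube field_simps)
  from has_vector_derivative_scaleR[OF this[folded has_real_derivative_iff_has_vector_derivative] q]
  show ?thesis
    unfolding chart_def dchart_def by (simp add: algebra_simps)
qed

lemma continuous_on_hor [continuous_intros]: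
  "continuous_on T f \<Longrightarrow> continuous_on T (\<lambda>t. hor (f t))"
  by (rule bounded_linear.continuous_on[OF bounded_linear_hor])

lemma continuous_on_lift [continuous_intros]:
  "continuous_on T f \<Longrightarrow> continuous_on T (\<lambda>t. lift h (f t))"
  by (subst lift_eq_hor) (intro continuous_intros)

lemma continuous_on_chart [continuous_intros]:
  "continuous_on T f \<Longrightarrow> continuous_on T (\<lambda>t. chart h (f t))"
  unfolding chart_def by (intro continuous_intros ballI) auto

lemma continuous_on_dchart [continuous_intros]:
  "continuous_on T f \<Longrightarrow> continuous_on T g \<Longrightarrow> continuous_on T (\<lambda>t. dchart h (f t) (g t))"
  unfolding dchart_def by (intro continuous_intros ballI) auto

text \<open>Radial parts drop out of the triple product, and each of the three vectors contributes
  one factor \<open>1 / norm (lift h z)\<close>. The chart therefore preserves orientation with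
  respect to the outward normal, so transversality and the signs of intersection letters can be
  decided by the planar determinant \<open>cdet\<close>.\<close>

lemma dchart_triple:
  "cross3 (chart h z) (dchart h z u) \<bullet> dchart h z v = cdet u v / norm (lift h z) ^ 3"
proof -
  have "cross3 (lift h z) (hor u) \<bullet> hor v = cdet u v"
    by (simp add: cross3_def inner_vec_def sum_3 cdet_def algebra_simps)
  moreover have "cross3 a (b - r *\<^sub>R a) \<bullet> (c - s *\<^sub>R a) = cross3 a b \<bullet> c" for a b c :: "real^3" and r s
    by (simp add: right_diff_distrib[where 'a="real"] cross3_simps)
  ultimately show ?thesis
    by (simp add: chart_def dchart_def cross_mult_left cross_mult_right power3_eq_cube field_simps)
qed

lemma cross3_dchart_nonzero: "cdet u v \<noteq> 0 \<Longrightarrow> cross3 (dchart h z u) (dchart h z v) \<noteq> 0"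
  using dchart_triple[of h z u v] cross_triple[of "chart h z" "dchart h z u" "dchart h z v"]
    norm_lift_pos[of h z] by auto

lemma dchart_nonzero:
  assumes "v \<noteq> 0" shows "dchart h z v \<noteq> 0"
proof
  assume "dchart h z v = 0"
  \<comment> \<open>The determinant is minus the squared modulus of \<open>v\<close>.\<close>
  moreover have "cdet (\<i> * v) v \<noteq> 0"
    using assms sum_squares_gt_zero_iff[of "Re v" "Im v"] by (auto simp: cdet_def complex_eq_iff)
  ultimately show False using dchart_triple[of h z "\<i> * v" v] norm_lift_pos[of h z] by auto
qed

lemma dchart_scaleR: "dchart h z (r *\<^sub>R v) = r *\<^sub>R dchart h z v"
  by (simp add: dchart_def linear_simps(5)[OF bounded_linear_hor] scaleR_diff_right)

lemma chart_root: "chart h (Complex 0 (- h)) = vector [0, 0, 1]"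
proof -
  have "lift h (Complex 0 (- h)) = vector [0, 0, 1]"
    by (simp add: vec_eq_iff forall_3)
  moreover have "norm (vector [0, 0, 1] :: real^3) = 1"
    by (simp add: norm_eq_1 inner_vec_def sum_3)
  ultimately show ?thesis by (simp add: chart_def)
qed

lemma dchart_root: "dchart h (Complex 0 (- h)) v = hor v"
proof -
  have l: "lift h (Complex 0 (- h)) = vector [0, 0, 1]"
    by (simp add: vec_eq_iff forall_3)
  moreover have "norm (vector [0, 0, 1] :: real^3) = 1"
    by (simp add: norm_eq_1 inner_vec_def sum_3)
  ultimately show ?thesis by (simp add: dchart_def inner_vec_def sum_3)
qed

section \<open>Semicircles with vertical unit velocity at their ends\<close>

text \<open>The cubic Hermite interpolation from 0 to \<pi> with slope \<open>s\<close> at both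
  ends. It will be used with \<open>s\<close> the reciprocal of the radius, so that angular speed
  times radius is 1 at the ends. Endpoints at distance at least 2 give
  \<open>s \<le> 1 < pi\<close>, which makes the angle strictly increasing.\<close>

definition hump_angle :: "real \<Rightarrow> real \<Rightarrow> real" where
  "hump_angle s t = s * t + (pi - s) * (3 * t\<^sup>2 - 2 * t ^ 3)"

definition hump_speed :: "real \<Rightarrow> real \<Rightarrow> real" where
  "hump_speed s t = s + 6 * (pi - s) * t * (1 - t)"

lemma hump_angle_ends [simp]: "hump_angle s 0 = 0" "hump_angle s 1 = pi"
  by (simp_all add: hump_angle_def)

lemma hump_speed_ends [simp]: "hump_speed s 0 = s" "hump_speed s 1 = s"
  by (simp_all add: hump_speed_def)

lemma DERIV_hump_angle: "(hump_angle s has_real_derivative hump_speed s t) (at t)"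
  unfolding hump_angle_def hump_speed_def
  by (auto intro!: derivative_eq_intros simp: algebra_simps power2_eq_square)

lemma hump_speed_pos:
  assumes "0 < s" "s \<le> 1" "0 \<le> t" "t \<le> 1" shows "hump_speed s t > 0"
proof -
  have "pi - s > 0" using assms pi_gt3 by linarith
  then show ?thesis using assms unfolding hump_speed_def
    by (intro add_pos_nonneg mult_nonneg_nonneg) auto
qed

lemma hump_angle_strict_mono:
  assumes "0 < s" "s \<le> 1" "0 \<le> t" "t < u" "u \<le> 1" shows "hump_angle s t < hump_angle s u"
proof (rule DERIV_pos_imp_increasing[OF \<open>t < u\<close>])
  fix x assume "t \<le> x" "x \<le> u"
  then show "\<exists>y. (hump_angle s has_real_derivative y) (at x) \<and> y > 0"
    using assms DERIV_hump_angle[of s x] hump_speed_pos[of s x] by auto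
qed

lemma hump_angle_bounds:
  assumes "0 < s" "s \<le> 1" "0 < t" "t < 1" shows "0 < hump_angle s t" "hump_angle s t < pi"
  using hump_angle_strict_mono[of s 0 t] hump_angle_strict_mono[of s t 1] assms by auto

text \<open>The semicircle from \<open>x\<close> to \<open>y\<close>, above the real axis for \<open>e = 1\<close> and below it for \<open>e = -1\<close>;
  the angle function makes its speed at both ends 1, whatever its radius, so that consecutive
  semicircles fit together to a differentiable curve.\<close>

definition hump :: "real \<Rightarrow> real \<Rightarrow> real \<Rightarrow> real \<Rightarrow> complex" where
  "hump e x y t = Complex ((x + y) / 2 + (x - y) / 2 * cos (hump_angle (2 / \<bar>x - y\<bar>) t))
     (e * (\<bar>x - y\<bar> / 2) * sin (hump_angle (2 / \<bar>x - y\<bar>) t))"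

definition dhump :: "real \<Rightarrow> real \<Rightarrow> real \<Rightarrow> real \<Rightarrow> complex" where
  "dhump e x y t = hump_speed (2 / \<bar>x - y\<bar>) t *\<^sub>R
     Complex (- (x - y) / 2 * sin (hump_angle (2 / \<bar>x - y\<bar>) t))
       (e * (\<bar>x - y\<bar> / 2) * cos (hump_angle (2 / \<bar>x - y\<bar>) t))"

lemma has_vector_derivative_Complex:
  assumes "(f has_real_derivative f') (at t within T)" "(g has_real_derivative g') (at t within T)"
  shows "((\<lambda>t. Complex (f t) (g t)) has_vector_derivative Complex f' g') (at t within T)"
  using has_vector_derivative_add[OF has_vector_derivative_of_real[OF assms(1)]
      has_vector_derivative_mult_right[OF has_vector_derivative_of_real[OF assms(2)], of \<i>]]
  by (simp add: Complex_eq)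

lemma hump_has_vector_derivative:
  "(hump e x y has_vector_derivative dhump e x y t) (at t)"
proof -
  have "dhump e x y t =
      Complex ((x - y) / 2 * (- sin (hump_angle (2 / \<bar>x - y\<bar>) t) * hump_speed (2 / \<bar>x - y\<bar>) t))
        (e * (\<bar>x - y\<bar> / 2) * (cos (hump_angle (2 / \<bar>x - y\<bar>) t) * hump_speed (2 / \<bar>x - y\<bar>) t))"
    by (simp add: dhump_def complex_eq_iff field_simps)
  moreover have "((\<lambda>t. hump_angle r t) has_real_derivative hump_speed r t) (at t)" for r
    by (rule DERIV_hump_angle)
  ultimately show ?thesis unfolding hump_def
    by (auto intro!: has_vector_derivative_Complex derivative_eq_intros)
qed

lemma continuous_on_dhump: "continuous_on T (dhump e x y)"
  unfolding dhump_def hump_angle_def hump_speed_def Complex_eq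
  by (intro continuous_intros)

lemma hump_ends [simp]: "hump e x y 0 = of_real x" "hump e x y 1 = of_real y"
  by (simp_all add: hump_def complex_eq_iff field_simps)

lemma dhump_ends:
  assumes "x \<noteq> y"
  shows "dhump e x y 0 = Complex 0 e" "dhump e x y 1 = Complex 0 (- e)"
  using assms by (simp_all add: dhump_def complex_eq_iff)

lemma Im_hump_pos:
  assumes "2 \<le> \<bar>x - y\<bar>" "0 < t" "t < 1" "e\<^sup>2 = 1" shows "Im (hump e x y t) * e > 0"
proof -
  have "sin (hump_angle (2 / \<bar>x - y\<bar>) t) > 0"
    using assms hump_angle_bounds[of "2 / \<bar>x - y\<bar>" t] by (intro sin_gt_zero) auto
  then have "(\<bar>x - y\<bar> / 2) * sin (hump_angle (2 / \<bar>x - y\<bar>) t) > 0" using assms by simp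
  moreover have "Im (hump e x y t) * e =
      e\<^sup>2 * ((\<bar>x - y\<bar> / 2) * sin (hump_angle (2 / \<bar>x - y\<bar>) t))"
    by (simp add: hump_def power2_eq_square)
  ultimately show ?thesis using assms(4) by simp
qed

text \<open>The equation of the circle whose diameter joins \<open>x\<close> and \<open>y\<close>,
  factored at the endpoints. In this form circles with different endpoints can be compared without
  radii or square roots.\<close>

lemma hump_circle:
  assumes "e\<^sup>2 = 1"
  shows "(Im (hump e x y t))\<^sup>2 = (Re (hump e x y t) - x) * (y - Re (hump e x y t))"
proof -
  define c s where "c = cos (hump_angle (2 / \<bar>x - y\<bar>) t)"
    and "s = sin (hump_angle (2 / \<bar>x - y\<bar>) t)"
  have "s\<^sup>2 = 1 - c\<^sup>2" unfolding c_def s_def by (rule sin_squared_eq)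
  then have "(e * (\<bar>x - y\<bar> / 2) * s)\<^sup>2 = ((x - y) / 2)\<^sup>2 * (1 - c\<^sup>2)"
    using assms by (simp add: power_mult_distrib power_divide)
  also have "\<dots> = ((x + y) / 2 + (x - y) / 2 * c - x) * (y - ((x + y) / 2 + (x - y) / 2 * c))"
    by (simp add: power2_eq_square field_simps)
  finally show ?thesis by (simp add: hump_def c_def s_def)
qed

lemma hump_inj:
  assumes "2 \<le> \<bar>x - y\<bar>" "t \<in> {0..1}" "u \<in> {0..1}" "hump e x y t = hump e x y u"
  shows "t = u"
proof -
  let ?a = "hump_angle (2 / \<bar>x - y\<bar>)"
  have s: "0 < 2 / \<bar>x - y\<bar>" "2 / \<bar>x - y\<bar> \<le> 1" using assms(1) by auto
  have m: "?a t' < ?a u'" if "0 \<le> t'" "t' < u'" "u' \<le> 1" for t' u'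
    using hump_angle_strict_mono[OF s] that by auto
  have b: "0 \<le> ?a t' \<and> ?a t' \<le> pi" if "t' \<in> {0..1}" for t'
    using m[of 0 t'] m[of t' 1] that by (cases "t' = 0"; cases "t' = 1") auto
  have "cos (?a t) = cos (?a u)" using assms(1,4) by (auto simp: hump_def)
  then have "?a t = ?a u" using b assms(2,3) cos_inj_pi by blast
  then show ?thesis using m[of t u] m[of u t] assms(2,3) by (cases t u rule: linorder_cases) auto
qed

lemma dhump_nonzero:
  assumes "2 \<le> \<bar>x - y\<bar>" "t \<in> {0..1}" "e \<noteq> 0" shows "dhump e x y t \<noteq> 0"
proof -
  have "hump_speed (2 / \<bar>x - y\<bar>) t > 0" using assms by (intro hump_speed_pos) auto
  moreover have "sin a = 0 \<Longrightarrow> cos a \<noteq> 0" for a :: real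
    using sin_cos_squared_add[of a] by auto
  ultimately show ?thesis using assms by (auto simp: dhump_def complex_eq_iff)
qed

text \<open>The tangent of a circle is orthogonal to its radius, and radii from two different
  centres on the axis to a common point off the axis are independent. Computed out, the determinant
  is, up to sign, the product of both angular speeds, the height of the point and the distance of
  the centres.\<close>

lemma dhump_independent:
  assumes "2 \<le> \<bar>x - y\<bar>" "2 \<le> \<bar>x' - y'\<bar>" "t \<in> {0..1}" "t' \<in> {0..1}" "e\<^sup>2 = 1"
    and eq: "hump e x y t = hump e x' y' t'" and "Im (hump e x y t) \<noteq> 0" "x + y \<noteq> x' + y'"
  shows "Re (dhump e x y t) * Im (dhump e x' y' t') - Im (dhump e x y t) * Re (dhump e x' y' t') \<noteq> 0"
proof -
  define v v' c c' s s' where "v = hump_speed (2 / \<bar>x - y\<bar>) t" and "v' = hump_speed (2 / \<bar>x' - y'\<bar>) t'"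
    and "c = cos (hump_angle (2 / \<bar>x - y\<bar>) t)" and "c' = cos (hump_angle (2 / \<bar>x' - y'\<bar>) t')"
    and "s = sin (hump_angle (2 / \<bar>x - y\<bar>) t)" and "s' = sin (hump_angle (2 / \<bar>x' - y'\<bar>) t')"
  have v: "v > 0" "v' > 0" unfolding v_def v'_def using assms(1-4) by (intro hump_speed_pos; auto)+
  \<comment> \<open>These signs replace the absolute values, so that all coordinates become
    polynomials and the common height \<open>Y\<close> can be substituted for both sine
    terms.\<close>
  define f f' where "f = sgn (x - y)" and "f' = sgn (x' - y')"
  have f: "f * f = 1" "f' * f' = 1" using assms(1,2) by (auto simp: f_def f'_def sgn_if)
  have ab: "\<bar>x - y\<bar> = f * (x - y)" "\<bar>x' - y'\<bar> = f' * (x' - y')"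
    by (auto simp: f_def f'_def sgn_if)
  define Y where "Y = Im (hump e x y t)"
  have e: "e * e = 1" using assms(5) by (simp add: power2_eq_square)
  have Y: "Y = e * f * ((x - y) / 2 * s)" "Y = e * f' * ((x' - y') / 2 * s')"
    using eq unfolding Y_def hump_def s_def s'_def by (simp_all add: ab)
  have 1: "(x - y) / 2 * s = e * f * Y" "(x' - y') / 2 * s' = e * f' * Y"
  proof -
    have "e * f * Y = (e * e) * (f * f) * ((x - y) / 2 * s)"
      unfolding Y(1) by (simp only: mult_ac)
    moreover have "e * f' * Y = (e * e) * (f' * f') * ((x' - y') / 2 * s')"
      unfolding Y(2) by (simp only: mult_ac)
    ultimately show "(x - y) / 2 * s = e * f * Y" "(x' - y') / 2 * s' = e * f' * Y"
      unfolding e f by simp_all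
  qed
  have 2: "(x + y) / 2 + (x - y) / 2 * c = (x' + y') / 2 + (x' - y') / 2 * c'"
    using eq unfolding hump_def c_def c'_def by simp
  have d: "Re (dhump e x y t) = v * (- (x - y) / 2 * s)" "Re (dhump e x' y' t') = v' * (- (x' - y') / 2 * s')"
    "Im (dhump e x y t) = v * (e * (\<bar>x - y\<bar> / 2) * c)" "Im (dhump e x' y' t') = v' * (e * (\<bar>x' - y'\<bar> / 2) * c')"
    by (simp_all add: dhump_def v_def v'_def c_def c'_def s_def s'_def)
  have "Re (dhump e x y t) * Im (dhump e x' y' t') - Im (dhump e x y t) * Re (dhump e x' y' t')
      = v * v' * (- ((x - y) / 2 * s) * (e * f' * ((x' - y') / 2 * c'))
          + (e * f * ((x - y) / 2 * c)) * ((x' - y') / 2 * s'))"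
    unfolding d ab by (simp add: field_simps)
  also have "\<dots> = (e * e) * (v * v' * (f * f' * Y) * ((x - y) / 2 * c - (x' - y') / 2 * c'))"
    unfolding minus_mult_left[symmetric] 1 by (simp only: ring_distribs mult.assoc mult.commute mult.left_commute minus_mult_left[symmetric] mult_minus_left mult_minus_right)
  also have "(x - y) / 2 * c - (x' - y') / 2 * c' = ((x' + y') - (x + y)) / 2"
    using 2 by (simp add: field_simps)
  finally show ?thesis using v f e assms(7,8) by (auto simp: Y_def)
qed

section \<open>Closed curves glued from arcs\<close>

lemma has_vector_derivative_within_Un:
  assumes "(f has_vector_derivative D) (at x within S)" "(f has_vector_derivative D) (at x within T)"
  shows "(f has_vector_derivative D) (at x within (S \<union> T))"
  using assms unfolding has_vector_derivative_def has_derivative_within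
  by (auto simp: at_within_union intro: filterlim_sup)

lemma continuous_within_Un:
  assumes "continuous (at x within S) f" "continuous (at x within T) f"
  shows "continuous (at x within (S \<union> T)) f"
  using assms unfolding continuous_within by (auto simp: at_within_union intro: filterlim_sup)

text \<open>The pieces are indexed by all integers, so a periodic curve has no first or last piece
  and every joint is treated alike.\<close>

definition glue :: "(int \<Rightarrow> real \<Rightarrow> 'a) \<Rightarrow> real \<Rightarrow> 'a" where
  "glue g x = g \<lfloor>x\<rfloor> (frac x)"

lemma glue_cell:
  assumes "\<And>n. g n 1 = g (n + 1) 0" "of_int n \<le> x" "x \<le> of_int n + 1"
  shows "glue g x = g n (x - of_int n)"
proof (cases "x = of_int n + 1")
  case True
  then have "x = of_int (n + 1)" by simp
  then show ?thesis using assms(1)[of n] unfolding glue_def by simp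
next
  case False
  then have "\<lfloor>x\<rfloor> = n" using assms by linarith
  then show ?thesis by (simp add: glue_def frac_def)
qed

text \<open>On the right of \<open>x\<close> the curve follows the piece number
  \<open>\<lfloor>x\<rfloor>\<close>, on the left the piece number \<open>m\<close>, which is the
  preceding one when \<open>x\<close> is an integer. Derivatives and continuity can then be checked
  on the two half-lines and put together.\<close>

lemma glue_local:
  assumes "\<And>n. g n 1 = g (n + 1) 0"
  obtains m where "m = \<lfloor>x\<rfloor> \<or> (m = \<lfloor>x\<rfloor> - 1 \<and> x = of_int \<lfloor>x\<rfloor>)"
    "\<forall>\<^sub>F y in at x within {..x}. glue g y = g m (y - of_int m)"
    "\<forall>\<^sub>F y in at x within {x..}. glue g y = g \<lfloor>x\<rfloor> (y - of_int \<lfloor>x\<rfloor>)"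
    "glue g x = g m (x - of_int m)"
proof -
  define m where "m = (if x = of_int \<lfloor>x\<rfloor> then \<lfloor>x\<rfloor> - 1 else \<lfloor>x\<rfloor>)"
  have m: "of_int m < x" "x \<le> of_int m + 1"
    unfolding m_def by (auto simp: order_less_le)
  have "\<forall>\<^sub>F y in at x within {..x}. glue g y = g m (y - of_int m)"
    unfolding eventually_at using m
    by (intro exI[of _ "x - of_int m"]) (auto simp: dist_real_def intro!: glue_cell assms)
  moreover have "\<forall>\<^sub>F y in at x within {x..}. glue g y = g \<lfloor>x\<rfloor> (y - of_int \<lfloor>x\<rfloor>)"
    unfolding eventually_at
    by (intro exI[of _ "of_int \<lfloor>x\<rfloor> + 1 - x"])
       (auto simp: dist_real_def intro!: glue_cell assms intro: order_trans[OF of_int_floor_le])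
  moreover have "glue g x = g m (x - of_int m)" using m by (intro glue_cell assms) auto
  ultimately show thesis using that[of m] m_def by (auto split: if_splits)
qed

lemma glue_has_vector_derivative:
  fixes g :: "int \<Rightarrow> real \<Rightarrow> 'a::real_normed_vector"
  assumes D: "\<And>n u. (g n has_vector_derivative g' n u) (at u)"
    and g: "\<And>n. g n 1 = g (n + 1) 0" and g': "\<And>n. g' n 1 = g' (n + 1) 0"
  shows "(glue g has_vector_derivative glue g' x) (at x)"
proof -
  obtain m where m: "m = \<lfloor>x\<rfloor> \<or> (m = \<lfloor>x\<rfloor> - 1 \<and> x = of_int \<lfloor>x\<rfloor>)"
    "\<forall>\<^sub>F y in at x within {..x}. glue g y = g m (y - of_int m)"
    "\<forall>\<^sub>F y in at x within {x..}. glue g y = g \<lfloor>x\<rfloor> (y - of_int \<lfloor>x\<rfloor>)"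
    "glue g x = g m (x - of_int m)"
    using glue_local[where g = g and x = x, OF g] by blast
  have shift: "((\<lambda>y. g n (y - of_int n)) has_vector_derivative g' n (x - of_int n)) (at x within T)" for n T
  proof -
    have "((\<lambda>y. y - of_int n) has_vector_derivative 1) (at x within T)"
      by (auto intro!: derivative_eq_intros)
    from vector_diff_chain_within[OF this has_vector_derivative_at_within[OF D]]
    show ?thesis by (simp add: comp_def)
  qed
  have tr: "(glue g has_vector_derivative g' n (x - of_int n)) (at x within T)"
    if "\<forall>\<^sub>F y in at x within T. glue g y = g n (y - of_int n)" "glue g x = g n (x - of_int n)" "x \<in> T" for n T
    using has_derivative_transform_eventually[OF shift[unfolded has_vector_derivative_def, of n T], of "glue g"]
      that by (auto simp: has_vector_derivative_def eq_commute elim: eventually_mono)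
  have "glue g' x = g' m (x - of_int m)"
    using m(1) g'[of m] unfolding glue_def frac_def by auto
  then have "(glue g has_vector_derivative glue g' x) (at x within {..x})"
    using tr[OF m(2,4)] by simp
  moreover have "(glue g has_vector_derivative glue g' x) (at x within {x..})"
    using tr[OF m(3)] by (simp add: glue_def frac_def)
  moreover have "{..x} \<union> {x..} = (UNIV :: real set)" by auto
  ultimately show ?thesis using has_vector_derivative_within_Un by metis
qed

lemma continuous_glue:
  fixes g :: "int \<Rightarrow> real \<Rightarrow> 'a::topological_space"
  assumes C: "\<And>n. continuous_on UNIV (g n)" and g: "\<And>n. g n 1 = g (n + 1) 0"
  shows "continuous_on UNIV (glue g)"
proof -
  have "isCont (glue g) x" for x
  proof -
    obtain m where m: "m = \<lfloor>x\<rfloor> \<or> (m = \<lfloor>x\<rfloor> - 1 \<and> x = of_int \<lfloor>x\<rfloor>)"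
      "\<forall>\<^sub>F y in at x within {..x}. glue g y = g m (y - of_int m)"
      "\<forall>\<^sub>F y in at x within {x..}. glue g y = g \<lfloor>x\<rfloor> (y - of_int \<lfloor>x\<rfloor>)"
      "glue g x = g m (x - of_int m)"
      using glue_local[where g = g and x = x, OF g] by blast
    have "continuous (at x within T) (\<lambda>y. g n (y - of_int n))" for n T
      by (rule continuous_on_imp_continuous_within[of UNIV])
         (auto intro!: continuous_on_compose2[OF C] continuous_intros)
    then have tr: "continuous (at x within T) (glue g)"
      if "\<forall>\<^sub>F y in at x within T. glue g y = g n (y - of_int n)" "glue g x = g n (x - of_int n)" for n T
      using that unfolding continuous_within by (simp add: tendsto_cong)
    have "continuous (at x within {..x}) (glue g)" by (rule tr[OF m(2,4)])
    moreover have "continuous (at x within {x..}) (glue g)"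
      by (rule tr[OF m(3)]) (simp add: glue_def frac_def)
    moreover have "{..x} \<union> {x..} = (UNIV :: real set)" by auto
    ultimately show ?thesis using continuous_within_Un by metis
  qed
  then show ?thesis by (simp add: continuous_at_imp_continuous_on)
qed

text \<open>Indices are taken modulo the length of the cycle, and time is scaled by that length to
  obtain period 1. The same operator, applied to the derivatives of the pieces, describes the
  velocity up to the factor \<open>length c\<close>.\<close>

definition chain :: "('b \<Rightarrow> real \<Rightarrow> 'a) \<Rightarrow> 'b list \<Rightarrow> real \<Rightarrow> 'a" where
  "chain A c t = glue (\<lambda>n. A (c ! nat (n mod int (length c)))) (real (length c) * t)"

lemma nat_mod_length:
  assumes "c \<noteq> []" shows "nat (n mod int (length c)) < length c"
    and "nat ((n + 1) mod int (length c)) = Suc (nat (n mod int (length c))) mod length c"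
proof -
  have L: "int (length c) > 0" using assms by simp
  show 1: "nat (n mod int (length c)) < length c"
    using pos_mod_bound[OF L, of n] pos_mod_sign[OF L, of n] by linarith
  have "int (Suc (nat (n mod int (length c))) mod length c) = (n mod int (length c) + 1) mod int (length c)"
    using pos_mod_sign[OF L, of n] by (simp add: zmod_int add.commute)
  also have "\<dots> = (n + 1) mod int (length c)" by (rule mod_add_left_eq)
  finally show "nat ((n + 1) mod int (length c)) = Suc (nat (n mod int (length c))) mod length c"
    by linarith
qed

lemma chain_has_vector_derivative:
  fixes A :: "'b \<Rightarrow> real \<Rightarrow> 'a::real_normed_vector"
  assumes c: "c \<noteq> []"
    and D: "\<And>i u. i \<in> set c \<Longrightarrow> (A i has_vector_derivative A' i u) (at u)"
    and "\<And>i. i < length c \<Longrightarrow> A (c ! i) 1 = A (c ! (Suc i mod length c)) 0"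
    and "\<And>i. i < length c \<Longrightarrow> A' (c ! i) 1 = A' (c ! (Suc i mod length c)) 0"
  shows "(chain A c has_vector_derivative real (length c) *\<^sub>R chain A' c t) (at t)"
proof -
  have "((\<lambda>t. real (length c) * t) has_vector_derivative real (length c)) (at t)"
    by (auto intro!: derivative_eq_intros)
  moreover have "(glue (\<lambda>n. A (c ! nat (n mod int (length c)))) has_vector_derivative
     glue (\<lambda>n. A' (c ! nat (n mod int (length c)))) (real (length c) * t)) (at (real (length c) * t))"
    by (rule glue_has_vector_derivative) (use assms nat_mod_length[OF c] in simp_all)
  ultimately show ?thesis unfolding chain_def
    using vector_diff_chain_at by (fastforce simp: comp_def)
qed

lemma continuous_on_chain:
  fixes A :: "'b \<Rightarrow> real \<Rightarrow> 'a::topological_space"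
  assumes c: "c \<noteq> []" and "\<And>i. i \<in> set c \<Longrightarrow> continuous_on UNIV (A i)"
    and "\<And>i. i < length c \<Longrightarrow> A (c ! i) 1 = A (c ! (Suc i mod length c)) 0"
  shows "continuous_on UNIV (chain A c)"
proof -
  have "continuous_on UNIV (glue (\<lambda>n. A (c ! nat (n mod int (length c)))))"
    by (rule continuous_glue) (use assms nat_mod_length[OF c] in simp_all)
  then show ?thesis unfolding chain_def
    by (rule continuous_on_compose2) (auto intro!: continuous_intros)
qed

lemma chain_periodic: "chain A c (t + 1) = chain A c t"
proof -
  have "real (length c) * (t + 1) = real (length c) * t + real_of_int (int (length c))"
    by (simp add: algebra_simps)
  then show ?thesis unfolding chain_def glue_def frac_def by (simp only: floor_add_int[symmetric]) simp
qed

lemma chain_eq: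
  assumes "0 \<le> t" "t < 1"
  shows "chain A c t = A (c ! nat \<lfloor>real (length c) * t\<rfloor>) (frac (real (length c) * t))"
proof (cases "c = []")
  case False
  then have "real (length c) * t < real (length c)" using assms by simp
  then have "\<lfloor>real (length c) * t\<rfloor> < int (length c)" by linarith
  moreover have "0 \<le> \<lfloor>real (length c) * t\<rfloor>" using assms by simp
  ultimately show ?thesis by (simp add: chain_def glue_def)
qed (simp add: chain_def glue_def)

lemma floor_length_less:
  assumes "0 \<le> t" "t < 1" "c \<noteq> []" shows "nat \<lfloor>real (length c) * t\<rfloor> < length c"
proof -
  have "real (length c) * t < real (length c)" using assms by simp
  then show ?thesis using assms by (simp add: nat_less_iff floor_less_iff)
qed

section \<open>The doodle diagram of a planar strand system\<close>

lemma dist_powers_of_4: "i \<noteq> j \<Longrightarrow> 3 \<le> \<bar>4 ^ i - 4 ^ j :: real\<bar>"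
proof (induction i j rule: linorder_wlog)
  case (le i j)
  then have "(4::real) ^ Suc i \<le> 4 ^ j" by (intro power_increasing) auto
  moreover have "(1::real) \<le> 4 ^ i" by simp
  ultimately have "3 \<le> (4::real) ^ j - 4 ^ i" unfolding power_Suc by linarith
  then show ?case by linarith
qed (simp add: abs_minus_commute)

text \<open>If the left end did not move to the right, the circle over \<open>a'\<close>,
  \<open>b'\<close> would contain that over \<open>a\<close>, \<open>b\<close> and be strictly
  higher above \<open>x\<close>, since both factors grow and the second one strictly.\<close>

lemma circles_interleave:
  fixes a b a' b' x :: real
  assumes "(x - a) * (b - x) = (x - a') * (b' - x)" "a < x" "x < b" "a' < x" "b < b'"
  shows "a < a'"
proof (rule ccontr)
  assume "\<not> a < a'"
  then have "(x - a) * (b - x) < (x - a') * (b' - x)"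
    using assms(2-5) by (intro mult_le_less_imp_less) auto
  then show False using assms(1) by simp
qed

text \<open>The left ends increase together with the right ends, and the first two circles meet at a point
  \<open>x \<le> 4/3 p2\<close>, which is to the left of \<open>p3\<close>.\<close>

lemma lacunary_circles_not_concurrent:
  fixes x :: real
  assumes eq: "(x - p1) * (q1 - x) = (x - p2) * (q2 - x)" "(x - p2) * (q2 - x) = (x - p3) * (q3 - x)"
    and x: "p1 < x" "p2 < x" "p3 < x" "x < q1" "x < q2" "x < q3"
    and pos: "p1 > 0" "p2 > 0" and q: "4 * q1 \<le> q2" "q2 < q3" and p: "p2 < p3 \<Longrightarrow> 4 * p2 \<le> p3"
  shows False
proof -
  have "p1 < p2" using circles_interleave[OF eq(1)] x q pos by auto
  have p3: "4 * p2 \<le> p3" using circles_interleave[OF eq(2)] x q p by auto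
  have "x * (q2 - q1) \<le> x * (q2 - q1 + (p2 - p1))"
    using \<open>p1 < p2\<close> x pos by (intro mult_left_mono) auto
  also have "\<dots> = p2 * q2 - p1 * q1" using eq(1) by (simp add: algebra_simps)
  also have "\<dots> \<le> p2 * q2" using pos x by simp
  finally have "x * (q2 - q1) \<le> p2 * q2" .
  moreover have "x * (3 / 4 * q2) \<le> x * (q2 - q1)"
    using q x pos by (intro mult_left_mono) auto
  ultimately have "(3 / 4 * x) * q2 \<le> p2 * q2" by simp
  then have "3 / 4 * x \<le> p2" using x pos by (auto dest: mult_right_le_imp_le)
  then show False using p3 x pos by linarith
qed

text \<open>The strand of a letter leads from its position to that of \<open>g i\<close>, above the
  axis for exponent 1 and below for -1, so \<open>g\<close> combines the outer and the inner
  matching. As \<open>g\<close> inverts letters, strands alternate between the two sides along a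
  cycle, and their vertical end velocities agree. The intervals spanned by the upper strands must
  not interleave; the lower ones are unrestricted.\<close>

locale arc_diagram =
  fixes h :: real and A :: "nat set" and lab :: "nat \<Rightarrow> 's letter" and g :: "nat \<Rightarrow> nat"
    and cs :: "nat list list"
  assumes g_bij: "bij_betw g A A"
    and lab_g: "\<And>i. i \<in> A \<Longrightarrow> lab (g i) = letter_inv (lab i)"
    and upper_disjoint: "\<And>i j. i \<in> A \<Longrightarrow> j \<in> A \<Longrightarrow> snd (lab i) \<Longrightarrow> snd (lab j) \<Longrightarrow>
      \<not> (min i (g i) < min j (g j) \<and> min j (g j) < max i (g i) \<and> max i (g i) < max j (g j))"
    and cs: "distinct (concat cs)" "set (concat cs) = A"
      "\<And>c. c \<in> set cs \<Longrightarrow> c \<noteq> []"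
      "\<And>c i. c \<in> set cs \<Longrightarrow> i < length c \<Longrightarrow> g (c ! i) = c ! (Suc i mod length c)"
begin

definition pos :: "nat \<Rightarrow> real" where "pos i = - (4 ^ i)"

text \<open>The loop of a noose passes the line from right to left, so the strand through a letter
  points upwards if the exponent is 1 and downwards if it is -1.\<close>

definition side :: "nat \<Rightarrow> real" where "side i = (if snd (lab i) then 1 else - 1)"

definition strand :: "nat \<Rightarrow> real \<Rightarrow> complex" where "strand i = hump (side i) (pos i) (pos (g i))"

definition dstrand :: "nat \<Rightarrow> real \<Rightarrow> complex" where "dstrand i = dhump (side i) (pos i) (pos (g i))"

definition D :: "'s diagram" where
  "D = map (\<lambda>c. (fst (lab (hd c)), \<lambda>t. chart h (chain strand c t))) cs"

text \<open>The planar counterpart of \<open>preim\<close>. The half-open parameter interval assigns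
  a position on the axis to the strand that starts there and not to the one that ends there.\<close>

definition strands :: "complex \<Rightarrow> (nat \<times> real) set" where
  "strands z = {(i, u). i \<in> A \<and> 0 \<le> u \<and> u < 1 \<and> strand i u = z}"

definition strand_of :: "nat \<times> real \<Rightarrow> nat \<times> real" where
  "strand_of = (\<lambda>(k, t). (cs ! k ! nat \<lfloor>real (length (cs ! k)) * t\<rfloor>, frac (real (length (cs ! k)) * t)))"

lemma side_sq [simp]: "(side i)\<^sup>2 = 1"
  by (simp add: side_def)

lemma finite_A: "finite A"
  using cs(2) by (metis finite_set)

lemma g_mem: "i \<in> A \<Longrightarrow> g i \<in> A"
  using g_bij by (auto simp: bij_betw_def)

lemma g_eq_iff: "i \<in> A \<Longrightarrow> j \<in> A \<Longrightarrow> g i = g j \<longleftrightarrow> i = j"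
  using g_bij by (auto simp: bij_betw_def inj_on_def)

lemma snd_lab_g: "i \<in> A \<Longrightarrow> snd (lab (g i)) \<longleftrightarrow> \<not> snd (lab i)"
  by (simp add: lab_g letter_inv_def)

lemma fst_lab_g: "i \<in> A \<Longrightarrow> fst (lab (g i)) = fst (lab i)"
  by (simp add: lab_g letter_inv_def)

lemma side_g: "i \<in> A \<Longrightarrow> side (g i) = - side i"
  by (simp add: side_def snd_lab_g)

lemma g_neq: "i \<in> A \<Longrightarrow> g i \<noteq> i"
  using snd_lab_g by metis

lemma pos_dist: "i \<noteq> j \<Longrightarrow> 2 \<le> \<bar>pos i - pos j\<bar>"
  using dist_powers_of_4[of i j] by (simp add: pos_def)

lemma pos_eq_iff [simp]: "pos i = pos j \<longleftrightarrow> i = j"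
  by (simp add: pos_def)

lemma arc_dist: "i \<in> A \<Longrightarrow> 2 \<le> \<bar>pos i - pos (g i)\<bar>"
  using pos_dist g_neq by metis

lemma arc_ends: "strand i 0 = of_real (pos i)" "strand i 1 = of_real (pos (g i))"
  by (simp_all add: strand_def)

lemma darc_ends:
  assumes "i \<in> A" shows "dstrand i 0 = Complex 0 (side i)" "dstrand i 1 = Complex 0 (side (g i))"
  using dhump_ends[of "pos i" "pos (g i)" "side i"] g_neq[OF assms] side_g[OF assms]
  by (auto simp: dstrand_def)

lemma Im_arc:
  assumes "i \<in> A" "0 < u" "u < 1"
  shows "Im (strand i u) > 0 \<longleftrightarrow> snd (lab i)" "Im (strand i u) < 0 \<longleftrightarrow> \<not> snd (lab i)"
  using Im_hump_pos[OF arc_dist[OF assms(1)] assms(2,3) side_sq, of i]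
  by (auto simp: strand_def side_def split: if_splits)

section \<open>Multiple points of the planar strands\<close>

lemma strands_real:
  assumes "(i, u) \<in> strands z" "Im z = 0" shows "u = 0 \<and> z = of_real (pos i)"
proof -
  have "\<not> 0 < u" using assms Im_arc[of i u] by (auto simp: strands_def)
  then have "u = 0" using assms by (auto simp: strands_def)
  then show ?thesis using assms by (auto simp: strands_def arc_ends)
qed

lemma strands_pos:
  assumes "i \<in> A" shows "strands (of_real (pos i)) = {(i, 0)}"
proof -
  have "(i, 0) \<in> strands (of_real (pos i))" using assms by (auto simp: strands_def arc_ends)
  moreover have "y = (i, 0)" if "y \<in> strands (of_real (pos i))" for y
    using strands_real[of "fst y" "snd y" "of_real (pos i)"] that by (cases y) auto
  ultimately show ?thesis by blast
qed

text \<open>The coordinate is negated here so that the ends of the circles become the positive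
  numbers \<open>4 ^ i\<close>, as the lacunarity estimate requires.\<close>

lemma strands_circle:
  assumes "(i, u) \<in> strands z" "Im z \<noteq> 0"
  shows "snd (lab i) \<longleftrightarrow> Im z > 0"
    and "(Im z)\<^sup>2 = (- Re z - 4 ^ min i (g i)) * (4 ^ max i (g i) - - Re z)"
    and "4 ^ min i (g i) < - Re z" "- Re z < 4 ^ max i (g i)"
proof -
  have i: "i \<in> A" "0 \<le> u" "u < 1" "strand i u = z" using assms by (auto simp: strands_def)
  then have "u \<noteq> 0" using assms(2) arc_ends by auto
  then show "snd (lab i) \<longleftrightarrow> Im z > 0" using Im_arc[of i u] i by auto
  have "(Im z)\<^sup>2 = (Re z - pos i) * (pos (g i) - Re z)"
    using hump_circle[of "side i" "pos i" "pos (g i)" u] i by (simp add: strand_def)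
  also have "\<dots> = (- Re z - 4 ^ min i (g i)) * (4 ^ max i (g i) - - Re z)"
    by (cases "i \<le> g i") (simp_all add: pos_def min_def max_def algebra_simps)
  finally show sq: "(Im z)\<^sup>2 = (- Re z - 4 ^ min i (g i)) * (4 ^ max i (g i) - - Re z)" .
  have le: "(4::real) ^ min i (g i) \<le> 4 ^ max i (g i)" by (intro power_increasing) auto
  have "(- Re z - 4 ^ min i (g i)) * (4 ^ max i (g i) - - Re z) > 0"
    using sq assms(2) by (metis zero_less_power2)
  then show "4 ^ min i (g i) < - Re z" "- Re z < 4 ^ max i (g i)"
    unfolding zero_less_mult_iff using le by linarith+
qed

text \<open>For letters of equal sign, \<open>i = g j\<close> is impossible since \<open>g\<close>
  reverses signs. So strands on the same side have four different endpoints.\<close>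

lemma ends_distinct:
  assumes "i \<in> A" "j \<in> A" "i \<noteq> j" "snd (lab i) \<longleftrightarrow> snd (lab j)"
  shows "max i (g i) \<noteq> max j (g j)" "min i (g i) \<noteq> min j (g j)"
proof -
  have "i \<noteq> g j" "j \<noteq> g i" "g i \<noteq> g j" using assms snd_lab_g g_eq_iff by auto
  then show "max i (g i) \<noteq> max j (g j)" "min i (g i) \<noteq> min j (g j)"
    using assms(3) by (auto simp: max_def min_def)
qed

text \<open>A common point off the axis forces the endpoints to interleave. Above the axis this
  contradicts the noncrossing matching; below the axis it orders the ends of concurrent strands and
  leads to the lacunarity estimate.\<close>

lemma strands_interleave:
  assumes "(i, u) \<in> strands z" "(j, v) \<in> strands z" "Im z \<noteq> 0" "max i (g i) < max j (g j)"
  shows "min i (g i) < min j (g j)" "min j (g j) < max i (g i)"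
proof -
  note i = strands_circle[OF assms(1,3)] and j = strands_circle[OF assms(2,3)]
  have "(4::real) ^ max i (g i) < 4 ^ max j (g j)" using assms(4) by simp
  then have "(4::real) ^ min i (g i) < 4 ^ min j (g j)"
    using circles_interleave[OF trans[OF i(2)[symmetric] j(2)] i(3,4) j(3)] by simp
  then show "min i (g i) < min j (g j)" by simp
  have "(4::real) ^ min j (g j) < 4 ^ max i (g i)" using i(4) j(3) by linarith
  then show "min j (g j) < max i (g i)" by simp
qed

lemma strands_unique:
  assumes "(i, u) \<in> strands z" "(i, v) \<in> strands z" shows "u = v"
  using assms arc_dist[of i] hump_inj[of "pos i" "pos (g i)" u v "side i"]
  by (auto simp: strands_def strand_def)

lemma strands_upper:
  assumes "(i, u) \<in> strands z" "(j, v) \<in> strands z" "Im z > 0" shows "i = j"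
proof (rule ccontr)
  assume "i \<noteq> j"
  have A: "i \<in> A" "j \<in> A" and z: "Im z \<noteq> 0" using assms by (auto simp: strands_def)
  have s: "snd (lab i)" "snd (lab j)" using strands_circle(1) assms z by blast+
  consider "max i (g i) < max j (g j)" | "max j (g j) < max i (g i)"
    using ends_distinct(1)[OF A \<open>i \<noteq> j\<close>] s by (metis linorder_neq_iff)
  then show False
  proof cases
    case 1
    then show False using strands_interleave[OF assms(1,2) z] upper_disjoint[OF A s] by blast
  next
    case 2
    then show False
      using strands_interleave[OF assms(2,1) z] upper_disjoint[OF A(2,1) s(2,1)] by blast
  qed
qed

lemma strands_lower:
  assumes "(i, u) \<in> strands z" "(j, v) \<in> strands z" "(k, w) \<in> strands z" "Im z < 0"
    "max i (g i) < max j (g j)" "max j (g j) < max k (g k)"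
  shows False
proof -
  have z: "Im z \<noteq> 0" using assms(4) by simp
  note i = strands_circle[OF assms(1) z] and j = strands_circle[OF assms(2) z]
    and k = strands_circle[OF assms(3) z]
  have 4: "4 * 4 ^ a \<le> (4::real) ^ b" if "a < b" for a b
    using that power_increasing[of "Suc a" b "4::real"] by simp
  have "min j (g j) < min k (g k)" using strands_interleave(1)[OF assms(2,3) z assms(6)] .
  then show False
    using lacunary_circles_not_concurrent[of "- Re z" "4 ^ min i (g i)" "4 ^ max i (g i)"
        "4 ^ min j (g j)" "4 ^ max j (g j)" "4 ^ min k (g k)" "4 ^ max k (g k)"]
      i j k 4[OF assms(5)] 4 assms(6) by (auto simp del: max_less_iff_conj min_less_iff_conj)
qed

lemma strands_fst_inj: "inj_on fst (strands z)"
  by (rule inj_onI) (metis prod.collapse strands_unique)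

lemma finite_strands: "finite (strands z)"
proof -
  have "fst ` strands z \<subseteq> A" by (auto simp: strands_def)
  then show ?thesis using finite_A strands_fst_inj by (metis finite_imageD finite_subset)
qed

lemma card_strands:
  shows "Im z \<ge> 0 \<Longrightarrow> card (strands z) \<le> 1" "card (strands z) \<le> 2"
proof -
  show 1: "card (strands z) \<le> 1" if "Im z \<ge> 0"
  proof -
    have "x = y" if "x \<in> strands z" "y \<in> strands z" for x y
    proof (cases "Im z = 0")
      case True
      then show ?thesis
        using strands_real[of "fst x" "snd x" z] strands_real[of "fst y" "snd y" z] that
        by (auto simp: prod_eq_iff)
    next
      case False
      then have "fst x = fst y"
        using strands_upper[of "fst x" "snd x" z "fst y" "snd y"] that \<open>Im z \<ge> 0\<close> by auto
      then show ?thesis using strands_fst_inj[of z] that by (auto simp: inj_on_def)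
    qed
    then show ?thesis using card_le_Suc0_iff_eq[OF finite_strands] by (simp add: One_nat_def)
  qed
  show "card (strands z) \<le> 2"
  proof (rule ccontr)
    assume "\<not> card (strands z) \<le> 2"
    then have c: "card (strands z) \<ge> 3" and im: "Im z < 0" using 1 by (force, linarith)
    \<comment> \<open>The larger exponent of the endpoints is injective on strands through a point
      below the axis, so three of them can be put in strict order as \<open>strands_lower\<close>
      requires.\<close>
    let ?m = "\<lambda>x. max (fst x) (g (fst x))"
    have inj: "inj_on ?m (strands z)"
    proof (rule inj_onI, rule ccontr)
      fix x y assume xy: "x \<in> strands z" "y \<in> strands z" "?m x = ?m y" "x \<noteq> y"
      then have "fst x \<noteq> fst y" using strands_fst_inj[of z] by (auto simp: inj_on_def)
      moreover have "fst x \<in> A" "fst y \<in> A" using xy by (auto simp: strands_def)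
      moreover have "\<not> snd (lab (fst x))" "\<not> snd (lab (fst y))"
        using strands_circle(1)[of "fst x" "snd x" z] strands_circle(1)[of "fst y" "snd y" z] xy im
        by auto
      ultimately show False using ends_distinct(1) xy(3) by blast
    qed
    obtain T where T: "T \<subseteq> ?m ` strands z" "card T = 3"
      using c card_image[OF inj] by (metis obtain_subset_with_card_n)
    then obtain a b d where abd: "{a, b, d} \<subseteq> ?m ` strands z" "a < b" "b < d"
    proof -
      obtain a b d where "T = {a, b, d}" "a \<noteq> b" "b \<noteq> d" "a \<noteq> d"
        using T(2) by (auto simp: card_3_iff)
      then show thesis
        using T(1) that[of a b d] that[of a d b] that[of b a d] that[of b d a] that[of d a b] that[of d b a]
        by (metis insert_commute linorder_neq_iff)
    qed
    then obtain x y w where "x \<in> strands z" "y \<in> strands z" "w \<in> strands z" "?m x < ?m y" "?m y < ?m w"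
      by blast
    then show False
      using strands_lower[of "fst x" "snd x" z "fst y" "snd y" "fst w" "snd w"] im by simp
  qed
qed

text \<open>Two strands can only meet below the axis. Interleaving orders their left ends in the
  same way as their right ends, so the sums of the endpoints, hence the centres, are
  different.\<close>

lemma strands_transverse:
  assumes "(i, u) \<in> strands z" "(j, v) \<in> strands z" "(i, u) \<noteq> (j, v)"
  shows "cdet (dstrand i u) (dstrand j v) \<noteq> 0"
proof -
  have ij: "i \<noteq> j" using assms strands_unique by blast
  have A: "i \<in> A" "j \<in> A" using assms by (auto simp: strands_def)
  have "\<not> card (strands z) \<le> 1"
    using assms card_le_Suc0_iff_eq[OF finite_strands] by (metis One_nat_def)
  then have im: "Im z < 0" using card_strands(1)[of z] by (meson not_le)
  then have z: "Im z \<noteq> 0" by simp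
  have s: "side i = side j"
    using strands_circle(1)[OF assms(1) z] strands_circle(1)[OF assms(2) z] by (simp add: side_def)
  have c: "pos i + pos (g i) \<noteq> pos j + pos (g j)"
  proof
    assume *: "pos i + pos (g i) = pos j + pos (g j)"
    have ends: "pos i + pos (g i) = - (4 ^ min i (g i) + 4 ^ max i (g i))" for i
      by (simp add: pos_def min_def max_def)
    have "max i (g i) \<noteq> max j (g j)"
      using ends_distinct(1)[OF A ij] s by (auto simp: side_def split: if_splits)
    then consider "max i (g i) < max j (g j)" | "max j (g j) < max i (g i)"
      by (metis linorder_neq_iff)
    then show False
    proof cases
      case 1
      with strands_interleave(1)[OF assms(1,2) z 1] have
        "(4::real) ^ min i (g i) < 4 ^ min j (g j)" "(4::real) ^ max i (g i) < 4 ^ max j (g j)" by simp_all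
      then show False using * unfolding ends by linarith
    next
      case 2
      with strands_interleave(1)[OF assms(2,1) z 2] have
        "(4::real) ^ min j (g j) < 4 ^ min i (g i)" "(4::real) ^ max j (g j) < 4 ^ max i (g i)" by simp_all
      then show False using * unfolding ends by linarith
    qed
  qed
  show ?thesis
    unfolding cdet_def dstrand_def s
    by (rule dhump_independent) (use assms A arc_dist c z s in \<open>auto simp: strands_def strand_def\<close>)
qed

end

section \<open>Transfer of the planar strands to the diagram on the sphere\<close>

context arc_diagram
begin

lemma arc_has_vector_derivative: "(strand i has_vector_derivative dstrand i u) (at u)"
  unfolding strand_def dstrand_def by (rule hump_has_vector_derivative)

lemma in_A: "c \<in> set cs \<Longrightarrow> i \<in> set c \<Longrightarrow> i \<in> A"
  using cs(2) by auto

lemma step_joins: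
  assumes "c \<in> set cs" "i < length c"
  shows "strand (c ! i) 1 = strand (c ! (Suc i mod length c)) 0"
    "dstrand (c ! i) 1 = dstrand (c ! (Suc i mod length c)) 0"
proof -
  have "c ! i \<in> A" using in_A[OF assms(1)] assms(2) by simp
  then show "strand (c ! i) 1 = strand (c ! (Suc i mod length c)) 0"
    "dstrand (c ! i) 1 = dstrand (c ! (Suc i mod length c)) 0"
    using cs(4)[OF assms] g_mem[of "c ! i"] by (auto simp: arc_ends darc_ends)
qed

lemma component_has_vector_derivative:
  assumes "c \<in> set cs"
  shows "((\<lambda>t. chart h (chain strand c t)) has_vector_derivative
      real (length c) *\<^sub>R dchart h (chain strand c t) (chain dstrand c t)) (at t)"
  unfolding dchart_scaleR[symmetric]
  by (intro chart_has_vector_derivative chain_has_vector_derivative cs(3)[OF assms]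
      arc_has_vector_derivative step_joins[OF assms])

lemma chain_strand_of:
  assumes "0 \<le> t" "t < 1"
  shows "chain F (cs ! k) t = (case strand_of (k, t) of (i, u) \<Rightarrow> F i u)"
  using assms by (simp add: chain_eq strand_of_def)

lemma strand_of_mem:
  assumes "k < length cs" "0 \<le> t" "t < 1" "strand_of (k, t) = (i, u)"
  shows "i \<in> set (cs ! k)" "i \<in> A" "0 \<le> u" "u < 1"
proof -
  have "cs ! k \<noteq> []" using cs(3) assms(1) by simp
  then show "i \<in> set (cs ! k)"
    using assms floor_length_less[of t "cs ! k"] by (auto simp: strand_of_def)
  then show "i \<in> A" using in_A[of "cs ! k" i] assms(1) by simp
  show "0 \<le> u" "u < 1" using assms(4) by (auto simp: strand_of_def frac_lt_1)
qed

lemma component_C1: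
  assumes "c \<in> set cs" shows "(\<lambda>t. chart h (chain strand c t)) C1_differentiable_on UNIV"
proof -
  have "continuous_on UNIV (chain dstrand c)"
    using step_joins[OF assms] cs(3)[OF assms]
    by (intro continuous_on_chain) (auto simp: dstrand_def intro: continuous_on_dhump)
  moreover have "continuous_on UNIV (chain strand c)"
    using step_joins[OF assms] cs(3)[OF assms]
    by (intro continuous_on_chain)
       (auto intro!: continuous_at_imp_continuous_on has_vector_derivative_continuous arc_has_vector_derivative)
  ultimately have "continuous_on UNIV
      (\<lambda>t. real (length c) *\<^sub>R dchart h (chain strand c t) (chain dstrand c t))"
    by (intro continuous_intros)
  then show ?thesis
    unfolding C1_differentiable_on_def using component_has_vector_derivative[OF assms]
    by (intro exI[of _ "\<lambda>t. real (length c) *\<^sub>R dchart h (chain strand c t) (chain dstrand c t)"]) simp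
qed

lemma darc_nonzero: "i \<in> A \<Longrightarrow> 0 \<le> u \<Longrightarrow> u \<le> 1 \<Longrightarrow> dstrand i u \<noteq> 0"
  unfolding dstrand_def by (rule dhump_nonzero) (auto simp: side_def intro: arc_dist)

lemma chain_darc_nonzero:
  assumes "c \<in> set cs" shows "chain dstrand c t \<noteq> 0"
proof -
  have "dstrand (c ! nat (n mod int (length c))) (frac x) \<noteq> 0" for n x
    using nat_mod_length(1)[OF cs(3)[OF assms]] in_A[OF assms]
    by (intro darc_nonzero) (auto simp: less_imp_le[OF frac_lt_1])
  then show ?thesis by (simp add: chain_def glue_def)
qed

lemma immersed_component:
  assumes "c \<in> set cs" shows "immersed_circle (\<lambda>t. chart h (chain strand c t))"
proof -
  have "vector_derivative (\<lambda>t. chart h (chain strand c t)) (at t) \<noteq> 0" for t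
    using vector_derivative_at[OF component_has_vector_derivative[OF assms, of t]] cs(3)[OF assms]
      dchart_nonzero[OF chain_darc_nonzero[OF assms]] by simp
  then show ?thesis
    by (simp add: immersed_circle_def chain_periodic component_C1[OF assms])
qed

lemma length_D [simp]: "length D = length cs"
  by (simp add: D_def)

lemma snd_D: "k < length cs \<Longrightarrow> snd (D ! k) = (\<lambda>t. chart h (chain strand (cs ! k) t))"
  by (simp add: D_def)

text \<open>\<open>g\<close> changes only the exponent of a letter, so the symbol of the first
  letter of a cycle is that of all its letters. This justifies reading the color in \<open>D\<close>
  off \<open>hd c\<close>.\<close>

lemma label_const:
  assumes "c \<in> set cs" "i \<in> set c" shows "fst (lab i) = fst (lab (hd c))"
proof -
  have "fst (lab (c ! n)) = fst (lab (hd c))" if "n < length c" for n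
    using that
  proof (induction n)
    case (Suc n)
    have "g (c ! n) = c ! Suc n" using cs(4)[OF assms(1), of n] Suc.prems by simp
    then show ?case using fst_lab_g[of "c ! n"] in_A[OF assms(1)] Suc by simp
  qed (simp add: hd_conv_nth)
  then show ?thesis using assms(2) by (metis in_set_conv_nth)
qed

lemma fst_D:
  assumes "k < length cs" "i \<in> set (cs ! k)" shows "fst (D ! k) = fst (lab i)"
  using assms label_const[of "cs ! k" i] by (simp add: D_def)

lemma tangent_D:
  assumes "k < length cs" "0 \<le> t" "t < 1" "strand_of (k, t) = (i, u)"
  shows "\<exists>r>0. tangent D k t = r *\<^sub>R dchart h (strand i u) (dstrand i u)"
proof -
  have c: "cs ! k \<in> set cs" using assms(1) by simp
  have "tangent D k t = real (length (cs ! k)) *\<^sub>R dchart h (strand i u) (dstrand i u)"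
    unfolding tangent_def snd_D[OF assms(1)]
    using vector_derivative_at[OF component_has_vector_derivative[OF c, of t]]
      chain_strand_of[OF assms(2,3), of strand k] chain_strand_of[OF assms(2,3), of dstrand k] assms(4)
    by simp
  then show ?thesis using cs(3)[OF c] by (intro exI[of _ "real (length (cs ! k))"]) simp
qed

lemma cs_nth_inj:
  assumes "k < length cs" "l < length cs" "a < length (cs ! k)" "b < length (cs ! l)"
    "cs ! k ! a = cs ! l ! b"
  shows "k = l \<and> a = b"
proof -
  have "removeAll [] cs = cs" using cs(3) by (metis removeAll_id)
  then have d: "distinct cs" using cs(1) by (metis distinct_concat_iff)
  have "cs ! k = cs ! l"
  proof (rule ccontr)
    assume "cs ! k \<noteq> cs ! l"
    then have "set (cs ! k) \<inter> set (cs ! l) = {}"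
      using cs(1) assms(1,2) unfolding distinct_concat_iff by (meson nth_mem)
    then show False using assms(3-5) by (metis disjoint_iff nth_mem)
  qed
  moreover have "distinct (cs ! k)" using cs(1) assms(1) unfolding distinct_concat_iff by simp
  ultimately show ?thesis using d assms nth_eq_iff_index_eq by metis
qed

lemma strand_of_bij:
  "bij_betw strand_of {(k, t). k < length cs \<and> 0 \<le> t \<and> t < 1} {(i, u). i \<in> A \<and> 0 \<le> u \<and> u < 1}"
proof (rule bij_betwI')
  fix x y :: "nat \<times> real" assume "x \<in> {(k, t). k < length cs \<and> 0 \<le> t \<and> t < 1}"
    "y \<in> {(k, t). k < length cs \<and> 0 \<le> t \<and> t < 1}"
  then obtain k t l s where xy: "x = (k, t)" "y = (l, s)" "k < length cs" "l < length cs"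
    "0 \<le> t" "t < 1" "0 \<le> s" "s < 1" by auto
  show "strand_of x = strand_of y \<longleftrightarrow> x = y"
  proof
    assume eq: "strand_of x = strand_of y"
    have ne: "cs ! k \<noteq> []" "cs ! l \<noteq> []" using cs(3) xy(3,4) by auto
    have 1: "k = l \<and> nat \<lfloor>real (length (cs ! k)) * t\<rfloor> = nat \<lfloor>real (length (cs ! l)) * s\<rfloor>"
      using eq xy ne by (intro cs_nth_inj) (auto simp: strand_of_def intro: floor_length_less)
    moreover have "0 \<le> \<lfloor>real (length (cs ! k)) * t\<rfloor>" "0 \<le> \<lfloor>real (length (cs ! l)) * s\<rfloor>"
      using xy by auto
    ultimately have "\<lfloor>real (length (cs ! k)) * t\<rfloor> = \<lfloor>real (length (cs ! k)) * s\<rfloor>"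
      by (metis eq_nat_nat_iff)
    moreover have "frac (real (length (cs ! k)) * t) = frac (real (length (cs ! k)) * s)"
      using eq 1 xy by (simp add: strand_of_def)
    ultimately have "real (length (cs ! k)) * t = real (length (cs ! k)) * s"
      by (simp add: frac_def)
    then show "x = y" using 1 xy ne by simp
  qed simp
next
  fix x :: "nat \<times> real" assume "x \<in> {(k, t). k < length cs \<and> 0 \<le> t \<and> t < 1}"
  then show "strand_of x \<in> {(i, u). i \<in> A \<and> 0 \<le> u \<and> u < 1}"
    using strand_of_mem(2-4)[of "fst x" "snd x" "fst (strand_of x)" "snd (strand_of x)"]
    by (auto simp: case_prod_beta mem_Times_iff)
next
  fix y :: "nat \<times> real" assume "y \<in> {(i, u). i \<in> A \<and> 0 \<le> u \<and> u < 1}"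
  then obtain i u where y: "y = (i, u)" "i \<in> A" "0 \<le> u" "u < 1" by auto
  obtain c where "c \<in> set cs" "i \<in> set c" using y(2) cs(2) by auto
  then obtain k a where k: "k < length cs" "a < length (cs ! k)" "cs ! k ! a = i"
    by (metis in_set_conv_nth)
  let ?t = "(real a + u) / real (length (cs ! k))"
  have L: "real (length (cs ! k)) > 0" using k(2) by (cases "cs ! k") auto
  have "real a + u < real (length (cs ! k))" using k(2) y(4) by linarith
  then have t: "0 \<le> ?t" "?t < 1" using L y(3) by simp_all
  have "real (length (cs ! k)) * ?t = real a + u" using L by simp
  moreover have "\<lfloor>real a + u\<rfloor> = int a" using y by linarith
  ultimately have "strand_of (k, ?t) = (i, u)"
    using k(3) by (simp add: strand_of_def frac_def)
  then show "\<exists>x\<in>{(k, t). k < length cs \<and> 0 \<le> t \<and> t < 1}. y = strand_of x"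
    using k(1) t y(1) by (intro bexI[of _ "(k, ?t)"]) auto
qed

text \<open>All counting of preimages on the sphere is reduced to \<open>strands\<close> by this
  bijection, which splits the time on a component into a strand and the time on that strand.\<close>

lemma preim_bij: "bij_betw strand_of (preim D (chart h z)) (strands z)"
proof (rule bij_betw_subset[OF strand_of_bij])
  have pre: "preim D (chart h z) =
      {(k, t). (k < length cs \<and> 0 \<le> t \<and> t < 1) \<and> strand_of (k, t) \<in> strands z}"
  proof -
    have "snd (D ! k) t = chart h z \<longleftrightarrow> strand_of (k, t) \<in> strands z"
      if "k < length cs" "0 \<le> t" "t < 1" for k t
      using strand_of_mem(2-4)[OF that, of "fst (strand_of (k, t))" "snd (strand_of (k, t))"]
        chain_strand_of[OF that(2,3), of strand k]
      by (auto simp: snd_D[OF that(1)] strands_def case_prod_beta)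
    then show ?thesis by (auto simp: preim_def)
  qed
  then show "preim D (chart h z) \<subseteq> {(k, t). k < length cs \<and> 0 \<le> t \<and> t < 1}" by auto
  show "strand_of ` preim D (chart h z) = strands z"
  proof
    show "strand_of ` preim D (chart h z) \<subseteq> strands z" unfolding pre by auto
    show "strands z \<subseteq> strand_of ` preim D (chart h z)"
    proof
      fix y assume y: "y \<in> strands z"
      then have "y \<in> {(i, u). i \<in> A \<and> 0 \<le> u \<and> u < 1}" by (auto simp: strands_def)
      then obtain x where "x \<in> {(k, t). k < length cs \<and> 0 \<le> t \<and> t < 1}" "y = strand_of x"
        using bij_betw_imp_surj_on[OF strand_of_bij] by (metis (no_types, lifting) imageE)
      then show "y \<in> strand_of ` preim D (chart h z)" using y unfolding pre by auto
    qed
  qed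
qed

lemma preim_outside:
  assumes "p \<notin> range (chart h)" shows "preim D p = {}"
  using assms by (auto simp: preim_def snd_D)

lemma card_preim: "card (preim D (chart h z)) = card (strands z)"
  using bij_betw_same_card[OF preim_bij] .

lemma chart_support_iff: "chart h z \<in> support D \<longleftrightarrow> strands z \<noteq> {}"
  using bij_betw_imp_surj_on[OF preim_bij[of z]] by (auto simp: support_def)

lemma preimD:
  assumes "(k, t) \<in> preim D (chart h z)"
  obtains i u r where "(i, u) \<in> strands z" "strand_of (k, t) = (i, u)" "fst (D ! k) = fst (lab i)"
    "r > 0" "tangent D k t = r *\<^sub>R dchart h z (dstrand i u)"
proof -
  obtain i u where s: "strand_of (k, t) = (i, u)" by fastforce
  have k: "k < length cs" "0 \<le> t" "t < 1" using assms by (auto simp: preim_def)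
  have iu: "(i, u) \<in> strands z" using bij_betwE[OF preim_bij[of z]] assms s by force
  then have "strand i u = z" by (simp add: strands_def)
  then obtain r where "r > 0" "tangent D k t = r *\<^sub>R dchart h z (dstrand i u)"
    using tangent_D[OF k s] by auto
  moreover have "fst (D ! k) = fst (lab i)" by (rule fst_D[OF k(1) strand_of_mem(1)[OF k s]])
  ultimately show thesis using that iu s by blast
qed

lemma doodle_D: "doodle D"
proof -
  have "immersed_circle (snd (D ! i))" if "i < length D" for i
    using immersed_component[of "cs ! i"] that by (simp add: snd_D)
  moreover have "finite (preim D p) \<and> card (preim D p) \<le> 2" for p
  proof (cases "p \<in> range (chart h)")
    case True
    then obtain z where "p = chart h z" by auto
    then show ?thesis
      using finite_strands[of z] bij_betw_finite[OF preim_bij[of z]] card_preim card_strands(2) by simp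
  qed (simp add: preim_outside)
  moreover have "cross3 (tangent D i t) (tangent D j u) \<noteq> 0"
    if *: "(i, t) \<in> preim D p" "(j, u) \<in> preim D p" "(i, t) \<noteq> (j, u)" for p i t j u
  proof -
    obtain z where p: "p = chart h z" using * preim_outside by auto
    obtain i' t' r where 1: "(i', t') \<in> strands z" "strand_of (i, t) = (i', t')" "r > 0"
        "tangent D i t = r *\<^sub>R dchart h z (dstrand i' t')"
      using preimD *(1) p by metis
    obtain j' u' s where 2: "(j', u') \<in> strands z" "strand_of (j, u) = (j', u')" "s > 0"
        "tangent D j u = s *\<^sub>R dchart h z (dstrand j' u')"
      using preimD *(2) p by metis
    have "(i', t') \<noteq> (j', u')"
      using inj_onD[OF bij_betw_imp_inj_on[OF preim_bij[of z]], of "(i, t)" "(j, u)"] * p 1(2) 2(2)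
      by metis
    then show ?thesis
      using cross3_dchart_nonzero[OF strands_transverse[OF 1(1) 2(1)]] 1(3) 2(3)
      by (simp add: 1(4) 2(4) cross_mult_left cross_mult_right)
  qed
  ultimately show ?thesis unfolding doodle_def by blast
qed

lemma colored_D:
  assumes "\<And>i. i \<in> A \<Longrightarrow> fst (lab i) \<in> S" shows "colored S D"
  unfolding colored_def
proof (intro allI impI)
  fix k assume "k < length D"
  then have "cs ! k \<in> set cs" by simp
  then have "hd (cs ! k) \<in> A" using in_A cs(3) by (meson hd_in_set)
  then show "fst (D ! k) \<in> S" using assms \<open>k < length D\<close> by (simp add: D_def)
qed

lemma crossingD:
  assumes "crossing D p"
  obtains z i u where "p = chart h z" "(i, u) \<in> strands z" "Im z < 0"
proof -
  have c: "card (preim D p) = 2" using assms by (simp add: crossing_def)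
  then have "preim D p \<noteq> {}" by auto
  then obtain z where p: "p = chart h z" using preim_outside by blast
  then have "card (strands z) = 2" using c card_preim by simp
  then have "Im z < 0" "strands z \<noteq> {}" using card_strands(1)[of z] by force+
  then show thesis using that p by fastforce
qed

lemma preim_pos:
  assumes "i \<in> A"
  obtains k t r where "preim D (chart h (of_real (pos i))) = {(k, t)}" "fst (D ! k) = fst (lab i)"
    "r > 0" "tangent D k t = r *\<^sub>R dchart h (of_real (pos i)) (Complex 0 (side i))"
proof -
  let ?z = "of_real (pos i) :: complex"
  have "card (preim D (chart h ?z)) = 1" by (simp add: card_preim strands_pos[OF assms])
  then obtain k t where kt: "preim D (chart h ?z) = {(k, t)}" by (auto simp: card_1_singleton_iff)
  then obtain i' u r where "(i', u) \<in> strands ?z" "fst (D ! k) = fst (lab i')"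
    "r > 0" "tangent D k t = r *\<^sub>R dchart h ?z (dstrand i' u)"
    using preimD[of k t ?z] by (metis insertI1)
  then show thesis using that kt strands_pos[OF assms] darc_ends(1)[OF assms] by auto
qed

end

section \<open>The shape of a noose\<close>

lemma path_derivI:
  assumes "(\<alpha> has_vector_derivative v) (at s within {0..1})" "s \<in> {0..1}"
  shows "path_deriv \<alpha> s = v"
  unfolding path_deriv_def using assms by (intro vector_derivative_within_closed_interval) auto

text \<open>Squaring smooths the corner of the positive part to class C1. This is why
  \<open>dip\<close> is a square: the boundary of the head has to be flat on one part, curved on the
  rest, and continuously differentiable where the two meet.\<close>

lemma DERIV_max_0_sq: "((\<lambda>u. (max 0 u)\<^sup>2) has_real_derivative 2 * max 0 u) (at u)"
proof (cases "u = 0")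
  case True
  have "((\<lambda>y. (max 0 y)\<^sup>2 / y) \<longlongrightarrow> 0) (at (0::real))"
  proof (rule Lim_null_comparison)
    show "\<forall>\<^sub>F y in at 0. norm ((max 0 y)\<^sup>2 / y) \<le> \<bar>y\<bar>"
      by (intro always_eventually allI) (auto simp: max_def power2_eq_square)
    show "((\<lambda>y::real. \<bar>y\<bar>) \<longlongrightarrow> 0) (at 0)" by (intro tendsto_eq_intros) auto
  qed
  then show ?thesis using True by (simp add: has_field_derivative_iff)
next
  case False
  let ?S = "if 0 < u then {0<..} else {..<0 :: real}"
  have "((\<lambda>y. if 0 < u then y\<^sup>2 else 0) has_real_derivative 2 * max 0 u) (at u)"
    using False by (cases "0 < u") (auto intro!: derivative_eq_intros simp: max_def)
  moreover have "open ?S" "u \<in> ?S" using False by auto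
  moreover have "(if 0 < u then y\<^sup>2 else 0) = (max 0 y)\<^sup>2" if "y \<in> ?S" for y
    using that by (auto split: if_splits)
  ultimately show ?thesis by (rule has_field_derivative_transform_within_open)
qed

definition dip :: "real \<Rightarrow> real \<Rightarrow> real" where
  "dip \<kappa> y = (max 0 (1 - y / \<kappa>))\<^sup>2"

text \<open>Applied to the second coordinate on the unit disc, this flattens the part \<open>y \<ge> \<kappa>\<close> of the
  boundary circle, on which the letters of a word will lie; the last summand, which vanishes on the
  circle, keeps the map injective inside.\<close>

definition head_height :: "real \<Rightarrow> real \<Rightarrow> real \<Rightarrow> real" where
  "head_height \<kappa> x y = - dip \<kappa> y - (1 - x\<^sup>2 - y\<^sup>2)"

lemma dip_antimono: "0 < \<kappa> \<Longrightarrow> y \<le> y' \<Longrightarrow> dip \<kappa> y' \<le> dip \<kappa> y"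
  unfolding dip_def by (intro power_mono max.mono diff_left_mono divide_right_mono) auto

lemma dip_eq_0: "0 < \<kappa> \<Longrightarrow> \<kappa> \<le> y \<Longrightarrow> dip \<kappa> y = 0"
  by (simp add: dip_def max_def field_simps)

lemma dip_neg: "0 < \<kappa> \<Longrightarrow> 0 \<le> y \<Longrightarrow> dip \<kappa> (- y) = (1 + y / \<kappa>)\<^sup>2"
  by (simp add: dip_def max_def)

lemma dip_nonneg [simp]: "0 \<le> dip \<kappa> y"
  by (simp add: dip_def)

text \<open>Only the term \<open>y\<^sup>2\<close> can work against monotonicity, and only when
  \<open>y + y'\<close> is not positive, so that \<open>y\<close> is negative. There
  \<open>dip\<close> compensates: its slope contains the factor \<open>1 / \<kappa>\<close>, which
  is at least 1.\<close>

lemma head_height_strict_mono: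
  assumes k: "0 < \<kappa>" "\<kappa> \<le> 1" and y: "y < y'"
  shows "head_height \<kappa> x y < head_height \<kappa> x y'"
proof (cases "y + y' > 0")
  case True
  then have "y\<^sup>2 < y'\<^sup>2" using y mult_pos_pos[of "y + y'" "y' - y"] by (simp add: power2_eq_square algebra_simps)
  then show ?thesis using dip_antimono[OF k(1), of y y'] y by (simp add: head_height_def)
next
  case False
  then have "y < 0" using y by linarith
  have "1 < 1 - y / \<kappa>" using \<open>y < 0\<close> k by (simp add: divide_neg_pos)
  then have d: "dip \<kappa> y = (1 - y / \<kappa>)\<^sup>2" by (simp add: dip_def max_def)
  show ?thesis
  proof (cases "y' < \<kappa>")
    case True
    then have d': "dip \<kappa> y' = (1 - y' / \<kappa>)\<^sup>2" using k by (simp add: dip_def max_def)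
    have "(y + y') * (1 - 1 / \<kappa>\<^sup>2) \<ge> 0"
      using False k power_le_one[of \<kappa> 2] by (intro mult_nonpos_nonpos) (auto simp: field_simps)
    then have "2 / \<kappa> + (y + y') * (1 - 1 / \<kappa>\<^sup>2) > 0" using k by (simp add: add_pos_nonneg)
    then have "(y' - y) * (2 / \<kappa> + (y + y') * (1 - 1 / \<kappa>\<^sup>2)) > 0" using y by simp
    moreover have "(y' - y) * (2 / \<kappa> + (y + y') * (1 - 1 / \<kappa>\<^sup>2)) =
        (1 - y / \<kappa>)\<^sup>2 - (1 - y' / \<kappa>)\<^sup>2 + y'\<^sup>2 - y\<^sup>2"
      using k by (simp add: field_simps power2_eq_square)
    ultimately show ?thesis by (simp add: head_height_def d d')
  next
    case False
    then have d': "dip \<kappa> y' = 0" using k by (simp add: dip_eq_0)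
    have "- y \<le> (- y) / \<kappa>" using k \<open>y < 0\<close> by (simp add: field_simps)
    then have "- y < 1 - y / \<kappa>" by simp
    then have "(- y)\<^sup>2 < (1 - y / \<kappa>)\<^sup>2" using \<open>y < 0\<close> by (intro power_strict_mono) auto
    then have "y\<^sup>2 < (1 - y / \<kappa>)\<^sup>2 + y'\<^sup>2" using zero_le_power2[of y'] unfolding power2_minus by linarith
    then show ?thesis by (simp add: head_height_def d d')
  qed
qed

section \<open>The planar model of a noose\<close>

locale noose_shape =
  fixes \<kappa> H :: real
  assumes \<kappa>: "0 < \<kappa>" "\<kappa> \<le> 1 / 2" and H: "0 < H"
begin

text \<open>The depth of the neck, namely \<open>H\<close> times the value of \<open>dip\<close> at
  -1. The root will lie at depth \<open>2 * M\<close> below the origin, which is also the offset of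
  the chart.\<close>

definition M :: real where "M = H * (1 + 1 / \<kappa>)\<^sup>2"

text \<open>On the disc, \<open>(Im z, - Re z)\<close> is a clockwise quarter turn. It brings the
  neck \<open>1\<close> to the bottom and keeps the orientation, so the loop still runs
  counterclockwise, starting at the neck. The rope is the straight segment between the neck and the
  root.\<close>

definition shape :: "real \<Rightarrow> real \<Rightarrow> complex \<Rightarrow> complex" where
  "shape c R z = (if norm z \<le> 1 then Complex (c + R * Im z) (H * head_height \<kappa> (Im z) (- Re z))
     else Complex ((2 - Re z) * c) (- 2 * M + (2 - Re z) * M))"

definition noose_map :: "real \<Rightarrow> real \<Rightarrow> complex \<Rightarrow> real^3" where
  "noose_map c R z = chart (2 * M) (shape c R z)"

lemma M_pos: "0 < M"
proof -
  have "1 + 1 / \<kappa> > 0" using \<kappa> by (simp add: add_pos_pos)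
  then show ?thesis using H by (simp add: M_def)
qed


lemma shape_1: "shape c R 1 = Complex c (- M)"
  using \<kappa> by (simp add: shape_def head_height_def dip_neg M_def)

lemma shape_rope:
  assumes "s \<in> {0..1}" shows "shape c R (of_real (2 - s)) = Complex (s * c) (- 2 * M + s * M)"
proof (cases "s = 1")
  case True
  then show ?thesis by (simp add: shape_1 complex_eq_iff)
next
  case False
  then have "norm (of_real (2 - s) :: complex) > 1" using assms by (simp only: norm_of_real) auto
  then show ?thesis by (simp add: shape_def)
qed

lemma noose_X_cases:
  assumes "z \<in> noose_X"
  obtains "norm z \<le> 1" | s where "0 \<le> s" "s < 1" "z = of_real (2 - s)"
proof (cases "norm z \<le> 1")
  case False
  then have "z \<in> closed_segment (1::complex) 2" using assms by (auto simp: noose_X_def)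
  then obtain u where u: "0 \<le> u" "u \<le> 1" "z = (1 - u) *\<^sub>R 1 + u *\<^sub>R 2"
    by (auto simp: closed_segment_def)
  then have "z = of_real (2 - (1 - u))" by (simp add: complex_eq_iff)
  moreover have "u \<noteq> 0" using False u by auto
  ultimately show thesis using that(2)[of "1 - u"] u by auto
qed (use that in blast)

text \<open>On each vertical slice the height increases from its value at -1, and that value exceeds
  the neck height by \<open>H\<close> times the square of the horizontal coordinate. So the neck is
  the unique lowest point of the head, and the rest of the rope lies strictly below the
  head.\<close>

lemma Im_shape_disc:
  assumes "norm z \<le> 1" shows "- M \<le> Im (shape c R z)" "Im (shape c R z) = - M \<Longrightarrow> z = 1"
    "Im (shape c R z) \<le> 0"
proof -
  have n: "(Re z)\<^sup>2 + (Im z)\<^sup>2 \<le> 1"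
    using assms by (metis cmod_power2 norm_ge_zero power_le_one)
  then have "(Re z)\<^sup>2 \<le> 1" using zero_le_power2[of "Im z"] by linarith
  then have r: "\<bar>Re z\<bar> \<le> 1" by (simp add: abs_square_le_1)
  have bot: "head_height \<kappa> (Im z) (- 1) = - (1 + 1 / \<kappa>)\<^sup>2 + (Im z)\<^sup>2"
    using \<kappa> by (simp add: head_height_def dip_neg)
  have "M + Im (shape c R z) = H * (head_height \<kappa> (Im z) (- Re z) + (1 + 1 / \<kappa>)\<^sup>2)"
    using assms by (simp add: shape_def M_def algebra_simps)
  also have "\<dots> = H * (head_height \<kappa> (Im z) (- Re z) - head_height \<kappa> (Im z) (- 1) + (Im z)\<^sup>2)"
    unfolding bot by simp
  finally have eq: "M + Im (shape c R z) =
      H * (head_height \<kappa> (Im z) (- Re z) - head_height \<kappa> (Im z) (- 1) + (Im z)\<^sup>2)" .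
  have s: "head_height \<kappa> (Im z) (- 1) < head_height \<kappa> (Im z) (- Re z)" if "Re z \<noteq> 1"
    using that r \<kappa> by (intro head_height_strict_mono) auto
  then have "head_height \<kappa> (Im z) (- 1) \<le> head_height \<kappa> (Im z) (- Re z)" by (cases "Re z = 1") auto
  then show "- M \<le> Im (shape c R z)" using eq H
    by (smt (verit) mult_nonneg_nonneg zero_le_power2)
  show "z = 1" if "Im (shape c R z) = - M"
  proof (rule ccontr)
    assume "z \<noteq> 1"
    then have "Re z \<noteq> 1" using n by (auto simp: complex_eq_iff)
    then have "head_height \<kappa> (Im z) (- Re z) - head_height \<kappa> (Im z) (- 1) + (Im z)\<^sup>2 > 0"
      using s by (simp add: add_pos_nonneg)
    then show False using eq that H by (auto simp: zero_less_mult_iff)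
  qed
  have "head_height \<kappa> (Im z) (- Re z) \<le> 0" using n dip_nonneg[of \<kappa> "- Re z"] unfolding head_height_def power2_minus by linarith
  then show "Im (shape c R z) \<le> 0" using H assms by (simp add: shape_def mult_nonneg_nonpos)
qed

lemma Re_shape_disc:
  assumes "norm z \<le> 1" "0 < R" shows "\<bar>Re (shape c R z) - c\<bar> \<le> R"
proof -
  have "\<bar>Im z\<bar> \<le> 1" using abs_Im_le_cmod[of z] assms(1) by linarith
  then show ?thesis using assms by (simp add: shape_def abs_mult mult_left_le)
qed

lemma inj_shape:
  assumes "0 < R" shows "inj_on (shape c R) noose_X"
proof (rule inj_onI)
  have disc: "z = w" if "norm z \<le> 1" "norm w \<le> 1" "shape c R z = shape c R w" for z w
  proof -
    have im: "Im z = Im w" using that assms by (simp add: shape_def)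
    have "head_height \<kappa> (Im z) (- Re z) = head_height \<kappa> (Im z) (- Re w)"
      using that H im by (simp add: shape_def)
    then have "Re z = Re w"
      using head_height_strict_mono[of \<kappa> "- Re z" "- Re w" "Im z"]
        head_height_strict_mono[of \<kappa> "- Re w" "- Re z" "Im z"] \<kappa>
      by (cases "Re z" "Re w" rule: linorder_cases) auto
    then show ?thesis using im by (simp add: complex_eq_iff)
  qed
  have mixed: "shape c R z \<noteq> shape c R (of_real (2 - s))" if "norm z \<le> 1" "0 \<le> s" "s < 1" for z s
  proof
    assume eq: "shape c R z = shape c R (of_real (2 - s))"
    have "Im (shape c R z) = - 2 * M + s * M" unfolding eq using that by (subst shape_rope) auto
    also have "\<dots> < - M" using that M_pos mult_strict_right_mono[of s 1 M] by simp
    finally show False using Im_shape_disc(1)[OF that(1), of c R] by simp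
  qed
  fix z w assume zw: "z \<in> noose_X" "w \<in> noose_X" "shape c R z = shape c R w"
  show "z = w"
    using zw(1)
  proof (cases rule: noose_X_cases)
    case 1
    show ?thesis using zw(2)
      by (cases rule: noose_X_cases) (use disc[OF 1] mixed[OF 1] zw(3) in auto)
  next
    case (2 s)
    show ?thesis using zw(2)
    proof (cases rule: noose_X_cases)
      case 1
      then show ?thesis using mixed[OF 1 2(1,2)] zw(3) 2(3) by auto
    next
      case (2 s')
      then show ?thesis using zw(3) \<open>z = _\<close> \<open>0 \<le> s\<close> \<open>s < 1\<close> M_pos
        shape_rope[of s c R] shape_rope[of s' c R] by simp
    qed
  qed
qed

lemma continuous_on_shape: "continuous_on noose_X (shape c R)"
proof -
  have "continuous_on (cball 0 1 \<union> closed_segment 1 2) (\<lambda>z. if norm z \<le> 1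
      then Complex (c + R * Im z) (H * head_height \<kappa> (Im z) (- Re z))
      else Complex ((2 - Re z) * c) (- 2 * M + (2 - Re z) * M))"
  proof (rule continuous_on_cases)
    show "continuous_on (cball 0 1) (\<lambda>z. Complex (c + R * Im z) (H * head_height \<kappa> (Im z) (- Re z)))"
      unfolding Complex_eq head_height_def dip_def by (intro continuous_intros) (use \<kappa> in auto)
    show "continuous_on (closed_segment 1 2) (\<lambda>z. Complex ((2 - Re z) * c) (- 2 * M + (2 - Re z) * M))"
      unfolding Complex_eq by (intro continuous_intros)
    have seg: "z = 1" if z: "z \<in> closed_segment 1 2" "norm z \<le> 1" for z :: complex
    proof -
      obtain u where u: "0 \<le> u" "u \<le> 1" "z = (1 - u) *\<^sub>R 1 + u *\<^sub>R 2"
        using z(1) unfolding in_segment by blast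
      then have "z = of_real (1 + u)" by (simp add: complex_eq_iff)
      then show ?thesis using z(2) u(1) by (simp only: norm_of_real) auto
    qed
    show "\<forall>z. z \<in> cball 0 1 \<and> \<not> norm z \<le> 1 \<or> z \<in> closed_segment 1 2 \<and> norm z \<le> 1 \<longrightarrow>
        Complex (c + R * Im z) (H * head_height \<kappa> (Im z) (- Re z)) =
        Complex ((2 - Re z) * c) (- 2 * M + (2 - Re z) * M)"
      (is "\<forall>z. ?P z \<longrightarrow> ?f z = ?g z")
    proof (intro allI impI)
      fix z :: complex assume "?P z"
      then have "z = 1" using seg by auto
      then show "?f z = ?g z" using \<kappa> by (simp add: head_height_def dip_neg M_def)
    qed
  qed auto
  then show ?thesis by (simp add: noose_X_def shape_def[abs_def])
qed

lemma shape_loop: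
  "shape c R (cis (2 * pi * t)) =
     Complex (c + R * sin (2 * pi * t)) (- H * dip \<kappa> (- cos (2 * pi * t)))"
proof -
  have "1 - (sin (2 * pi * t))\<^sup>2 - (- cos (2 * pi * t))\<^sup>2 = 0" by (simp add: sin_squared_eq)
  then show ?thesis unfolding shape_def head_height_def by simp
qed

definition dloop :: "real \<Rightarrow> real \<Rightarrow> complex" where
  "dloop R t = Complex (R * (cos (2 * pi * t) * (2 * pi)))
     (- H * (2 * max 0 (1 + cos (2 * pi * t) / \<kappa>) * (- sin (2 * pi * t) * (2 * pi) / \<kappa>)))"

lemma shape_loop_has_vector_derivative:
  "((\<lambda>t. shape c R (cis (2 * pi * t))) has_vector_derivative dloop R t) (at t)"
proof -
  have 1: "((\<lambda>t. sin (2 * pi * t)) has_real_derivative cos (2 * pi * t) * (2 * pi)) (at t)"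
    by (auto intro!: derivative_eq_intros)
  have 2: "((\<lambda>t. 1 + cos (2 * pi * t) / \<kappa>) has_real_derivative - sin (2 * pi * t) * (2 * pi) / \<kappa>) (at t)"
    using \<kappa> by (auto intro!: derivative_eq_intros)
  have 3: "((\<lambda>t. dip \<kappa> (- cos (2 * pi * t))) has_real_derivative
      2 * max 0 (1 + cos (2 * pi * t) / \<kappa>) * (- sin (2 * pi * t) * (2 * pi) / \<kappa>)) (at t)"
    using DERIV_chain2[OF DERIV_max_0_sq 2] by (simp add: dip_def)
  show ?thesis unfolding shape_loop dloop_def
    by (intro has_vector_derivative_Complex) (auto intro!: derivative_eq_intros 1 3)
qed

lemma dloop_nonzero: "0 < R \<Longrightarrow> dloop R t \<noteq> 0"
proof
  assume R: "0 < R" and "dloop R t = 0"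
  then have c: "cos (2 * pi * t) = 0" and "sin (2 * pi * t) = 0"
    using \<kappa> H by (auto simp: dloop_def complex_eq_iff)
  then show False using sin_cos_squared_add[of "2 * pi * t"] by simp
qed

lemma loop_has_vector_derivative:
  "(loop_param (noose_map c R) has_vector_derivative
      dchart (2 * M) (shape c R (cis (2 * pi * t))) (dloop R t)) (at t)"
  unfolding loop_param_def[abs_def] noose_map_def
  by (intro chart_has_vector_derivative shape_loop_has_vector_derivative)

lemma rope_in_eq: "s \<in> {0..1} \<Longrightarrow> rope_in (noose_map c R) s = chart (2 * M) (Complex (s * c) (- 2 * M + s * M))"
  by (simp only: rope_in_def noose_map_def shape_rope)

lemma rope_has_vector_derivative:
  assumes "s \<in> {0..1}"
  shows "(rope_in (noose_map c R) has_vector_derivative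
     dchart (2 * M) (Complex (s * c) (- 2 * M + s * M)) (Complex c M)) (at s within {0..1})"
proof (rule has_vector_derivative_transform[OF assms])
  show "((\<lambda>s. chart (2 * M) (Complex (s * c) (- 2 * M + s * M))) has_vector_derivative
     dchart (2 * M) (Complex (s * c) (- 2 * M + s * M)) (Complex c M)) (at s within {0..1})"
    by (intro chart_has_vector_derivative has_vector_derivative_Complex)
       (auto intro!: derivative_eq_intros)
qed (simp add: rope_in_eq)

lemma noose_noose_map:
  assumes R: "0 < R" shows "noose (noose_map c R)"
proof -
  have "continuous_on noose_X (noose_map c R)"
    unfolding noose_map_def by (intro continuous_intros continuous_on_shape)
  moreover have "inj_on (noose_map c R) noose_X"
    using inj_shape[OF R] by (auto simp: noose_map_def inj_on_def)
  moreover have "loop_param (noose_map c R) C1_differentiable_on UNIV"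
  proof -
    have "continuous_on UNIV (\<lambda>t. dchart (2 * M) (shape c R (cis (2 * pi * t))) (dloop R t))"
      unfolding shape_loop dloop_def dip_def Complex_eq
      by (intro continuous_intros) (use \<kappa> in auto)
    then show ?thesis unfolding C1_differentiable_on_def
      using loop_has_vector_derivative[of c R]
      by (intro exI[of _ "\<lambda>t. dchart (2 * M) (shape c R (cis (2 * pi * t))) (dloop R t)"]) simp
  qed
  moreover have "vector_derivative (loop_param (noose_map c R)) (at t) \<noteq> 0" for t
    using vector_derivative_at[OF loop_has_vector_derivative[of c R t]]
      dchart_nonzero[OF dloop_nonzero[OF R]] by simp
  moreover have "continuous_on {0..1} (\<lambda>s. dchart (2 * M) (Complex (s * c) (- 2 * M + s * M)) (Complex c M))"
    unfolding Complex_eq by (intro continuous_intros)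
  moreover have "dchart (2 * M) z (Complex c M) \<noteq> 0" for z
    using M_pos by (intro dchart_nonzero) (simp add: complex_eq_iff)
  ultimately show ?thesis
    unfolding noose_def using rope_has_vector_derivative[of _ c R]
    by (auto simp: noose_map_def[of c R] intro!: exI[of _ "\<lambda>s. dchart (2 * M) (Complex (s * c) (- 2 * M + s * M)) (Complex c M)"])
qed

lemma root_noose_map: "root (noose_map c R) = vector [0, 0, 1]"
  using rope_in_eq[of 0 c R] chart_root[of "2 * M"] by (simp add: root_def rope_in_def)

lemma neck_noose_map: "neck (noose_map c R) = chart (2 * M) (Complex c (- M))"
  by (simp add: neck_def noose_map_def shape_1)

lemma rope_dir_noose_map: "rope_dir (noose_map c R) = hor (Complex c M)"
proof -
  have "rope_dir (noose_map c R) = dchart (2 * M) (Complex 0 (- (2 * M))) (Complex c M)"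
    unfolding rope_dir_def using path_derivI[OF rope_has_vector_derivative[of 0 c R]] by simp
  then show ?thesis by (simp add: dchart_root)
qed

text \<open>By the intermediate value theorem a vertical slice of the disc covers the whole interval
  between the heights of its two boundary points.\<close>

lemma disc_image_memI:
  assumes R: "0 < R" and x: "\<bar>x\<bar> \<le> 1"
    and Y: "H * head_height \<kappa> x (- sqrt (1 - x\<^sup>2)) \<le> Y" "Y \<le> H * head_height \<kappa> x (sqrt (1 - x\<^sup>2))"
  shows "Complex (c + R * x) Y \<in> shape c R ` cball 0 1"
proof -
  have x2: "x\<^sup>2 \<le> 1" using x by (simp add: abs_square_le_1)
  have "continuous_on {- sqrt (1 - x\<^sup>2)..sqrt (1 - x\<^sup>2)} (\<lambda>y. H * head_height \<kappa> x y)"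
    unfolding head_height_def dip_def by (intro continuous_intros) (use \<kappa> in auto)
  moreover have "- sqrt (1 - x\<^sup>2) \<le> sqrt (1 - x\<^sup>2)" using x2 by simp
  ultimately obtain y where y: "- sqrt (1 - x\<^sup>2) \<le> y" "y \<le> sqrt (1 - x\<^sup>2)" "H * head_height \<kappa> x y = Y"
    using IVT'[of "\<lambda>y. H * head_height \<kappa> x y" "- sqrt (1 - x\<^sup>2)" Y "sqrt (1 - x\<^sup>2)"] Y by blast
  then have "\<bar>y\<bar> \<le> sqrt (1 - x\<^sup>2)" by auto
  then have "y\<^sup>2 \<le> 1 - x\<^sup>2" using x2 by (metis abs_ge_zero power2_abs power_mono real_sqrt_pow2 diff_ge_0_iff_ge)
  then have "norm (Complex (- y) x) \<le> 1" by (simp add: cmod_def)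
  then show ?thesis using y(3)
    by (intro image_eqI[of _ _ "Complex (- y) x"]) (auto simp: shape_def)
qed

text \<open>On a slice whose half-length \<open>w\<close> is at least \<open>\<kappa>\<close>, the
  upper boundary point lies on the flat part at height 0 and the lower one at height at most
  \<open>- H\<close>. So the head contains a box of depth \<open>H\<close> under its flat part, with
  room for the crossings.\<close>

lemma head_memI:
  assumes "0 < R" "\<kappa>\<^sup>2 \<le> 1 - ((X - c) / R)\<^sup>2" "- H \<le> Y" "Y \<le> 0"
  shows "chart (2 * M) (Complex X Y) \<in> head (noose_map c R)"
proof -
  define x where "x = (X - c) / R"
  have X: "X = c + R * x" using assms(1) by (simp add: x_def)
  have "x\<^sup>2 \<le> 1" using assms(2) zero_le_power2[of \<kappa>] unfolding x_def by linarith
  then have x: "\<bar>x\<bar> \<le> 1" "x\<^sup>2 \<le> 1" by (simp_all add: abs_square_le_1)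
  define w where "w = sqrt (1 - x\<^sup>2)"
  have w: "w\<^sup>2 = 1 - x\<^sup>2" using x unfolding w_def by simp
  have wk: "\<kappa> \<le> w" using assms(2) \<kappa> unfolding w_def x_def[symmetric] by (simp add: real_le_rsqrt)
  have "head_height \<kappa> x (- w) \<le> - 1"
    using w wk \<kappa> by (simp add: head_height_def dip_neg one_le_power)
  then have "H * head_height \<kappa> x (- w) \<le> - H" using H mult_left_mono[of _ "- 1" H] by fastforce
  moreover have "head_height \<kappa> x w = 0"
    using w wk \<kappa> by (simp add: head_height_def dip_eq_0)
  ultimately have "Complex X Y \<in> shape c R ` cball 0 1"
    unfolding X using assms x(1) w_def by (intro disc_image_memI) auto
  then show ?thesis by (auto simp: head_def noose_map_def)
qed

end

lemma Arg_less_if_cdet_pos: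
  assumes "0 \<le> Im z" "0 \<le> Im w" "cdet z w > 0" shows "Arg z < Arg w"
proof (rule ccontr)
  assume "\<not> Arg z < Arg w"
  have "z \<noteq> 0" "w \<noteq> 0" using assms(3) by (auto simp: cdet_def)
  have b: "0 \<le> Arg z" "Arg z \<le> pi" "0 \<le> Arg w" "Arg w \<le> pi"
    using assms(1,2) Arg_le_pi Arg_less_0 by (metis not_le)+
  have "Re z = cmod z * cos (Arg z)" "Im z = cmod z * sin (Arg z)"
      "Re w = cmod w * cos (Arg w)" "Im w = cmod w * sin (Arg w)"
    by (metis Re_rcis rcis_cmod_Arg, metis Im_rcis rcis_cmod_Arg)+
  then have "cdet z w = cmod z * cmod w * - sin (Arg z - Arg w)"
    unfolding cdet_def sin_diff by (simp add: algebra_simps)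
  moreover have "sin (Arg z - Arg w) \<ge> 0"
    using b \<open>\<not> Arg z < Arg w\<close> by (intro sin_ge_zero) auto
  then have "cmod z * cmod w * sin (Arg z - Arg w) \<ge> 0" by simp
  ultimately show False using assms(3) by simp
qed

section \<open>Order of the ropes, disjointness of the nooses, and the side of the head\<close>

context noose_shape
begin

text \<open>\<open>z c\<close> holds the coordinates of a rope direction in the frame of the first
  rope. As \<open>c \<le> c0\<close>, it lies in the closed upper half plane, where
  \<open>Arg\<close> is nonnegative and \<open>ccw_angle\<close> adds no full turn; the order is
  then the sign of a determinant.\<close>

lemma ccw_angle_less:
  assumes "c' < c" "c \<le> c0"
  shows "ccw_angle (vector [0, 0, 1]) (hor (Complex c0 M)) (hor (Complex c M))
    < ccw_angle (vector [0, 0, 1]) (hor (Complex c0 M)) (hor (Complex c' M))"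
proof -
  define n where "n = norm (hor (Complex c0 M))"
  have "hor (Complex c0 M) \<noteq> 0" using M_pos by (auto simp: vec_eq_iff forall_3)
  then have n: "n > 0" by (simp add: n_def)
  define z where "z c = Complex ((c * c0 + M * M) / n) (M * (c0 - c) / n)" for c
  have eq: "ccw_angle (vector [0, 0, 1]) (hor (Complex c0 M)) (hor (Complex c M)) = Arg (z c)"
    if "c \<le> c0" for c
  proof -
    have "hor (Complex c M) \<bullet> (hor (Complex c0 M) /\<^sub>R n) = Re (z c)"
      by (simp add: inner_vec_def sum_3 z_def add_divide_distrib field_simps)
    moreover have "hor (Complex c M) \<bullet> cross3 (vector [0, 0, 1]) (hor (Complex c0 M) /\<^sub>R n) = Im (z c)"
      using n by (simp add: inner_vec_def sum_3 cross3_def z_def field_simps)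
    moreover have "Im (z c) \<ge> 0" using that n M_pos by (simp add: z_def)
    then have "\<not> Arg (z c) < 0" using Arg_less_0[of "z c"] by linarith
    ultimately show ?thesis unfolding ccw_angle_def Let_def n_def[symmetric] by simp
  qed
  have "cdet (z c) (z c') = (M * (c - c') * (c0\<^sup>2 + M\<^sup>2)) / n\<^sup>2"
    using n by (simp add: cdet_def z_def field_simps power2_eq_square)
  moreover have "c0\<^sup>2 + M\<^sup>2 > 0" using M_pos by (simp add: add_nonneg_pos)
  ultimately have "cdet (z c) (z c') > 0" using assms M_pos n by simp
  then have "Arg (z c) < Arg (z c')"
    using assms M_pos n by (intro Arg_less_if_cdet_pos) (auto simp: z_def)
  then show ?thesis using eq[of c] eq[of c'] assms by simp
qed

text \<open>Heads occupy disjoint vertical strips, a head and a rope are separated by the depth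
  \<open>M\<close>, and two ropes are segments of different slope from the common root.\<close>

lemma shape_images_disjoint:
  assumes "0 < R" "0 < R'" "c + R < c' - R'" "z \<in> noose_X" "w \<in> noose_X"
    and eq: "shape c R z = shape c' R' w"
  shows "shape c R z = Complex 0 (- 2 * M)"
  using assms(4)
proof (cases rule: noose_X_cases)
  case 1
  note z = Re_shape_disc[OF 1 assms(1), of c] Im_shape_disc(1,2)[OF 1, of c R]
  show ?thesis using assms(5)
  proof (cases rule: noose_X_cases)
    case 1
    then show ?thesis using z(1) Re_shape_disc[OF 1 assms(2), of c'] eq assms(3) by (simp add: abs_le_iff)
  next
    case (2 s)
    then have "Im (shape c R z) = - 2 * M + s * M" using eq shape_rope[of s c' R'] by simp
    moreover have "s * M < M" using 2 M_pos by simp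
    ultimately show ?thesis using z(2) by linarith
  qed
next
  case (2 s)
  then have im: "shape c R z = Complex (s * c) (- 2 * M + s * M)" using shape_rope[of s c R] by simp
  have "s * M < M" using 2 M_pos by simp
  show ?thesis using assms(5)
  proof (cases rule: noose_X_cases)
    case 1
    have "Im (shape c' R' w) = - 2 * M + s * M" using im eq by simp
    then show ?thesis using Im_shape_disc(1)[OF 1, of c' R'] \<open>s * M < M\<close> by linarith
  next
    case (2 s')
    then have "shape c' R' w = Complex (s' * c') (- 2 * M + s' * M)" using shape_rope[of s' c' R'] by simp
    then have "s = s'" "s * c = s' * c'" using eq im M_pos by auto
    then have "s = 0" using assms(1-3) by auto
    then show ?thesis using im by simp
  qed
qed

lemma noose_map_images_Int:
  assumes "0 < R" "0 < R'" "c + R < c' - R'"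
  shows "noose_map c R ` noose_X \<inter> noose_map c' R' ` noose_X = {vector [0, 0, 1]}"
proof -
  have "2 \<in> noose_X" by (simp add: noose_X_def)
  then have "vector [0, 0, 1] \<in> noose_map c R ` noose_X" for c R
    using root_noose_map[of c R] unfolding root_def by (metis imageI)
  moreover have "p = vector [0, 0, 1]" if p: "p \<in> noose_map c R ` noose_X" "p \<in> noose_map c' R' ` noose_X" for p
  proof -
    obtain z where z: "z \<in> noose_X" "p = noose_map c R z" using p(1) by (rule imageE)
    obtain w where w: "w \<in> noose_X" "p = noose_map c' R' w" using p(2) by (rule imageE)
    have "shape c R z = shape c' R' w" using z(2) w(2) by (simp add: noose_map_def)
    then have "p = chart (2 * M) (Complex 0 (- 2 * M))"
      using shape_images_disjoint[OF assms z(1) w(1)] z(2) by (simp add: noose_map_def)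
    then show ?thesis using chart_root[of "2 * M"] by simp
  qed
  ultimately show ?thesis by blast
qed

text \<open>The vector \<open>(c * M, 1 + M\<^sup>2)\<close> is the direction in the chart of the
  great circle leaving the neck along the left normal. It is slanted unless \<open>c = 0\<close>, so
  the ray has to be compared with the lower boundary of the head: that boundary rises quadratically
  in \<nu>, with coefficient at most \<open>B\<close>, while the ray rises linearly.\<close>

lemma near_neck:
  assumes R: "0 < R"
  obtains d where "d > 0"
    "\<And>\<nu>. 0 < \<nu> \<Longrightarrow> \<nu> < d \<Longrightarrow> Complex (c + \<nu> * (c * M)) (- M + \<nu> * (1 + M\<^sup>2)) \<in> shape c R ` cball 0 1"
proof -
  define e where "e = c * M / R"
  define B where "B = H * (2 / \<kappa> + 2 / \<kappa>\<^sup>2) * e\<^sup>2"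
  have B: "B \<ge> 0" using H \<kappa> by (simp add: B_def)
  \<comment> \<open>The three bounds keep the ray above the lower boundary, below height 0, and
    within half the width of the head.\<close>
  define d where "d = Min {(1 + M\<^sup>2) / (B + 1), M / (1 + M\<^sup>2), 1 / (2 * (\<bar>e\<bar> + 1))}"
  have M2: "1 + M\<^sup>2 > 0" by (simp add: add_pos_nonneg)
  have "d > 0" using B M_pos M2 by (simp add: d_def add_nonneg_pos)
  moreover have "Complex (c + \<nu> * (c * M)) (- M + \<nu> * (1 + M\<^sup>2)) \<in> shape c R ` cball 0 1"
    if \<nu>: "0 < \<nu>" "\<nu> < d" for \<nu>
  proof -
    have lt: "\<nu> < (1 + M\<^sup>2) / (B + 1)" "\<nu> < M / (1 + M\<^sup>2)" "\<nu> < 1 / (2 * (\<bar>e\<bar> + 1))"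
      using \<nu>(2) by (auto simp: d_def)
    define x where "x = \<nu> * e"
    define w where "w = sqrt (1 - x\<^sup>2)"
    have "\<nu> * (\<bar>e\<bar> + 1) < 1 / 2" using lt(3) by (simp add: field_simps)
    then have x: "\<bar>x\<bar> < 1 / 2" using \<nu>(1) by (simp add: x_def abs_mult algebra_simps)
    then have "\<bar>x\<bar>\<^sup>2 \<le> (1 / 2)\<^sup>2" by (intro power_mono) auto
    then have x2: "x\<^sup>2 \<le> 1 / 4" by (simp add: power_divide)
    have w2: "w\<^sup>2 = 1 - x\<^sup>2" using x2 by (simp add: w_def)
    have "1 / 2 \<le> w" unfolding w_def using x2 by (intro real_le_rsqrt) (simp add: power_divide)
    have "w \<le> 1" unfolding w_def using x2 by simp
    have "w * w \<le> w" using \<open>w \<le> 1\<close> \<open>1 / 2 \<le> w\<close> by (simp add: mult_left_le)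
    then have w: "1 - w \<le> x\<^sup>2" using w2 by (simp add: power2_eq_square)
    have "(1 + 1 / \<kappa>)\<^sup>2 - (1 + w / \<kappa>)\<^sup>2 = (1 - w) * (2 / \<kappa> + (1 + w) / \<kappa>\<^sup>2)"
      using \<kappa> by (simp add: field_simps power2_eq_square)
    also have "\<dots> \<le> x\<^sup>2 * (2 / \<kappa> + 2 / \<kappa>\<^sup>2)"
      using w \<open>w \<le> 1\<close> \<open>1 / 2 \<le> w\<close> \<kappa> by (intro mult_mono add_left_mono divide_right_mono) auto
    finally have "H * ((1 + 1 / \<kappa>)\<^sup>2 - (1 + w / \<kappa>)\<^sup>2) \<le> H * (x\<^sup>2 * (2 / \<kappa> + 2 / \<kappa>\<^sup>2))"
      using H by simp
    also have "\<dots> = \<nu> * (\<nu> * B)" by (simp add: x_def B_def power_mult_distrib power2_eq_square mult_ac)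
    also have "\<nu> * B \<le> 1 + M\<^sup>2"
    proof -
      have "\<nu> * (B + 1) < 1 + M\<^sup>2" using lt(1) B by (simp add: pos_less_divide_eq)
      then show ?thesis using \<nu>(1) by (simp add: algebra_simps)
    qed
    finally have le: "H * ((1 + 1 / \<kappa>)\<^sup>2 - (1 + w / \<kappa>)\<^sup>2) \<le> \<nu> * (1 + M\<^sup>2)" using \<nu>(1) by simp
    have "H * head_height \<kappa> x (- w) = - H * (1 + w / \<kappa>)\<^sup>2"
      using w2 \<open>1 / 2 \<le> w\<close> \<kappa> by (simp add: head_height_def dip_neg)
    also have "\<dots> \<le> - M + \<nu> * (1 + M\<^sup>2)" using le by (simp add: M_def right_diff_distrib)
    finally have 1: "H * head_height \<kappa> x (- w) \<le> - M + \<nu> * (1 + M\<^sup>2)" .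
    have "\<nu> * (1 + M\<^sup>2) \<le> M" using lt(2) M2 by (simp add: pos_less_divide_eq)
    moreover have "head_height \<kappa> x w = 0"
      using w2 \<open>1 / 2 \<le> w\<close> \<kappa> by (simp add: head_height_def dip_eq_0)
    ultimately have "Complex (c + R * x) (- M + \<nu> * (1 + M\<^sup>2)) \<in> shape c R ` cball 0 1"
      using 1 x R by (intro disc_image_memI) (auto simp: w_def)
    then show ?thesis using R by (simp add: x_def e_def)
  qed
  ultimately show thesis using that by blast
qed

text \<open>At the neck the left normal is a positive multiple of \<open>vector [0, 1, - M]\<close>.
  The great circle in this direction is a straight line in the chart, and \<open>near_neck\<close>
  places its beginning inside the head. Hence \<open>loop_ccw\<close> does not reverse the
  loop.\<close>

lemma head_on_left_noose_map:
  assumes R: "0 < R" shows "head_on_left (noose_map c R)"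
proof -
  let ?q = "lift (2 * M) (Complex c (- M))"
  define n m where "n = norm ?q" and "m = sqrt (1 + M\<^sup>2)"
  have n: "n > 0" by (simp add: n_def)
  have m2: "m\<^sup>2 = 1 + M\<^sup>2" and m: "m > 0" by (auto simp: m_def add_pos_nonneg)
  have n2: "n\<^sup>2 = c\<^sup>2 + M\<^sup>2 + 1"
    by (simp add: n_def power2_norm_eq_inner inner_vec_def sum_3) (simp add: power2_eq_square)
  let ?p = "loop_param (noose_map c R) 0"
  let ?L = "cross3 ?p (vector_derivative (loop_param (noose_map c R)) (at 0))"
  have p: "?p = ?q /\<^sub>R n" using shape_1[of c R] by (simp add: loop_param_def noose_map_def chart_def n_def)
  have "vector_derivative (loop_param (noose_map c R)) (at 0) = dchart (2 * M) (Complex c (- M)) (Complex (2 * pi * R) 0)"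
    using vector_derivative_at[OF loop_has_vector_derivative[of c R 0]] shape_1[of c R]
    by (simp add: dloop_def mult_ac)
  moreover have "cross3 (q /\<^sub>R n) (a /\<^sub>R n - k *\<^sub>R q) = (1 / n\<^sup>2) *\<^sub>R cross3 q a" for q a :: "real^3" and k
    by (simp add: cross3_def vec_eq_iff forall_3 power2_eq_square divide_inverse algebra_simps)
  ultimately have "?L = (1 / n\<^sup>2) *\<^sub>R cross3 ?q (hor (Complex (2 * pi * R) 0))"
    unfolding p dchart_def n_def[symmetric] by simp
  also have "cross3 ?q (hor (Complex (2 * pi * R) 0)) = (2 * pi * R) *\<^sub>R vector [0, 1, - M]"
    by (simp add: cross3_def vec_eq_iff forall_3)
  finally have L: "?L = (2 * pi * R / n\<^sup>2) *\<^sub>R vector [0, 1, - M]" by simp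
  have "norm (vector [0, 1, - M] :: real^3) = m"
    by (simp add: norm_eq_sqrt_inner inner_vec_def sum_3 m_def power2_eq_square)
  then have nL: "?L /\<^sub>R norm ?L = vector [0, 1, - M] /\<^sub>R m"
    unfolding L using R n m by (simp add: inverse_eq_divide)
  define v :: "real \<Rightarrow> real^3" where "v \<epsilon> = cos \<epsilon> *\<^sub>R ?p + (sin \<epsilon> / norm ?L) *\<^sub>R ?L" for \<epsilon>
  have v: "v \<epsilon> = (cos \<epsilon> / n) *\<^sub>R ?q + (sin \<epsilon> / m) *\<^sub>R vector [0, 1, - M]" for \<epsilon>
  proof -
    have "(sin \<epsilon> / norm ?L) *\<^sub>R ?L = sin \<epsilon> *\<^sub>R (?L /\<^sub>R norm ?L)" by (simp add: divide_inverse)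
    then show ?thesis unfolding v_def nL unfolding p by (simp add: divide_inverse)
  qed
  have v_nth: "v \<epsilon> $ 1 = cos \<epsilon> / n * c" "v \<epsilon> $ 2 = cos \<epsilon> / n * M + sin \<epsilon> / m"
    "v \<epsilon> $ 3 = cos \<epsilon> / n - sin \<epsilon> / m * M" for \<epsilon> by (simp_all add: v)
  have norm_v: "norm (v \<epsilon>) = 1" for \<epsilon>
  proof -
    have "(norm (v \<epsilon>))\<^sup>2 = (cos \<epsilon> / n)\<^sup>2 * (c\<^sup>2 + M\<^sup>2 + 1) + (sin \<epsilon> / m)\<^sup>2 * (1 + M\<^sup>2)"
      unfolding power2_norm_eq_inner inner_vec_def sum_3 v_nth inner_real_def
      by (simp add: power2_eq_square algebra_simps add_divide_distrib)
    also have "\<dots> = 1" unfolding n2[symmetric] m2[symmetric] using n m by (simp add: power_divide)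
    finally show ?thesis using norm_ge_zero[of "v \<epsilon>"] by (simp add: power2_eq_1_iff)
  qed
  \<comment> \<open>The parameter along the planar ray that corresponds to the angle \<epsilon> on
    the great circle, obtained on dividing by the third coordinate.\<close>
  define \<nu> where "\<nu> \<epsilon> = (sin \<epsilon> / m) / (v \<epsilon> $ 3)" for \<epsilon>
  obtain d where d: "d > 0"
    "\<And>\<nu>. 0 < \<nu> \<Longrightarrow> \<nu> < d \<Longrightarrow> Complex (c + \<nu> * (c * M)) (- M + \<nu> * (1 + M\<^sup>2)) \<in> shape c R ` cball 0 1"
    using near_neck[OF R] by blast
  have "((\<lambda>\<epsilon>. v \<epsilon> $ 3) \<longlongrightarrow> 1 / n) (at_right 0)"
    unfolding v_nth by (intro tendsto_eq_intros) (use n m in auto)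
  then have pos: "\<forall>\<^sub>F \<epsilon> in at_right 0. v \<epsilon> $ 3 > 0" using n by (intro order_tendstoD(1)[of _ "1 / n"]) auto
  have "(\<nu> \<longlongrightarrow> 0) (at_right 0)"
    unfolding \<nu>_def v_nth by (intro tendsto_eq_intros) (use n m in auto)
  then have small: "\<forall>\<^sub>F \<epsilon> in at_right 0. \<nu> \<epsilon> < d" using d(1) by (intro order_tendstoD(2)[of _ 0]) auto
  have sin: "\<forall>\<^sub>F \<epsilon> in at_right (0::real). sin \<epsilon> > 0"
    unfolding eventually_at_right_field by (intro exI[of _ pi]) (auto intro: sin_gt_zero)
  have "\<forall>\<^sub>F \<epsilon> in at_right 0. v \<epsilon> \<in> head (noose_map c R)"
    using pos small sin
  proof eventually_elim
    case (elim \<epsilon>)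
    have "0 < \<nu> \<epsilon>" using elim m by (simp add: \<nu>_def)
    have "v \<epsilon> $ 1 / v \<epsilon> $ 3 = c + \<nu> \<epsilon> * (c * M)"
      using elim(1) by (simp add: \<nu>_def divide_eq_eq ring_distribs) (simp add: v_nth algebra_simps)
    moreover have "v \<epsilon> $ 2 / v \<epsilon> $ 3 - 2 * M = - M + \<nu> \<epsilon> * (1 + M\<^sup>2)"
    proof -
      have "v \<epsilon> $ 2 = M * v \<epsilon> $ 3 + sin \<epsilon> / m * (1 + M\<^sup>2)"
        by (simp add: v_nth algebra_simps power2_eq_square)
      then have "v \<epsilon> $ 2 / v \<epsilon> $ 3 = M + \<nu> \<epsilon> * (1 + M\<^sup>2)"
        using elim(1) by (simp add: \<nu>_def add_divide_distrib)
      then show ?thesis by simp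
    qed
    ultimately have "v \<epsilon> = chart (2 * M) (Complex (c + \<nu> \<epsilon> * (c * M)) (- M + \<nu> \<epsilon> * (1 + M\<^sup>2)))"
      using chart_eqI[OF norm_v elim(1), of "2 * M"] by simp
    then show ?case using d(2)[OF \<open>0 < \<nu> \<epsilon>\<close> elim(2)] by (auto simp: head_def noose_map_def)
  qed
  then show ?thesis
    unfolding head_on_left_def Let_def eventually_at_right_field v_def by auto
qed

lemma loop_ccw_noose_map: "0 < R \<Longrightarrow> loop_ccw (noose_map c R) = loop_param (noose_map c R)"
  by (simp add: loop_ccw_def[abs_def] head_on_left_noose_map)

end

section \<open>The intersection words of the noose system\<close>

lemma int_word_eqI:
  assumes "hit_params D \<alpha> = \<tau> ` {..<n}" "\<And>i j. i < j \<Longrightarrow> j < n \<Longrightarrow> \<tau> i < \<tau> j"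
    and "length w = n" "\<And>j. j < n \<Longrightarrow> int_letter D \<alpha> (\<tau> j) = w ! j"
  shows "int_word D \<alpha> = w"
proof -
  have "sorted_list_of_set (hit_params D \<alpha>) = map \<tau> [0..<n]"
  proof (rule sorted_list_of_set_unique[THEN iffD1])
    show "finite (hit_params D \<alpha>)" by (simp add: assms(1))
    have "sorted_wrt (<) (map \<tau> [0..<n])" by (auto simp: sorted_wrt_iff_nth_less assms(2))
    moreover have "set (map \<tau> [0..<n]) = hit_params D \<alpha>" by (simp add: assms(1) atLeast0LessThan)
    moreover have "card (hit_params D \<alpha>) = n"
      unfolding assms(1) by (subst card_image) (auto intro!: linorder_inj_onI simp: assms(2) order_less_imp_not_eq)
    ultimately show "sorted_wrt (<) (map \<tau> [0..<n]) \<and> set (map \<tau> [0..<n]) = hit_params D \<alpha> \<and>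
        length (map \<tau> [0..<n]) = card (hit_params D \<alpha>)" by simp
  qed
  then show ?thesis unfolding int_word_def
    by (intro nth_equalityI) (simp_all add: assms(3,4))
qed

text \<open>Word \<open>k\<close> receives the block of exponents from \<open>k * W\<close> to
  \<open>k * W + W - 1\<close>. The offset 1 and the surplus 2 in the bound on \<open>W\<close>
  leave the first and the last exponent of the block free for the ends of the head. \<open>H\<close>
  dominates the depth of all lower semicircles, and \<kappa> is so small that all letters fall on
  the flat part of their head.\<close>

locale noose_diagram = noose_shape \<kappa> H + arc_diagram "2 * noose_shape.M \<kappa> H" A lab g cs
  for \<kappa> H :: real and A lab g cs +
  fixes W :: nat and ws :: "'a letter list list"
  assumes A_eq: "A = {k * W + j + 1 | k j. k < length ws \<and> j < length (ws ! k)}"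
    and lab_eq: "\<And>k j. k < length ws \<Longrightarrow> j < length (ws ! k) \<Longrightarrow> lab (k * W + j + 1) = ws ! k ! j"
    and W: "\<And>k. k < length ws \<Longrightarrow> length (ws ! k) + 2 \<le> W"
    and g_head: "\<And>i. i \<in> A \<Longrightarrow> \<not> snd (lab i) \<Longrightarrow> g i div W = i div W"
    and H_ge: "4 ^ (length ws * W) \<le> H"
    and kappa_eq: "\<kappa> = 1 / 2 ^ W"
begin

section \<open>Placement of the heads\<close>

definition lo :: "nat \<Rightarrow> real" where "lo k = 4 ^ (k * W)"
definition hi :: "nat \<Rightarrow> real" where "hi k = 4 ^ (k * W + W - 1)"
definition ctr :: "nat \<Rightarrow> real" where "ctr k = - (lo k + hi k) / 2"
definition rad :: "nat \<Rightarrow> real" where "rad k = (hi k - lo k) / 2"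

definition N :: "(complex \<Rightarrow> real^3) list" where
  "N = map (\<lambda>k. noose_map (ctr k) (rad k)) [0..<length ws]"

lemma W2: "k < length ws \<Longrightarrow> 2 \<le> W"
  using W[of k] by simp

lemma lo_hi: assumes "k < length ws" shows "0 < lo k" "4 * lo k \<le> hi k"
proof -
  have "(4::real) ^ Suc (k * W) \<le> 4 ^ (k * W + W - 1)"
    using W2[OF assms] by (intro power_increasing) auto
  then show "0 < lo k" "4 * lo k \<le> hi k" by (simp_all add: lo_def hi_def)
qed

lemma rad_pos: "k < length ws \<Longrightarrow> 0 < rad k"
  using lo_hi[of k] by (simp add: rad_def)

lemma hi_lo: assumes "k < l" "l < length ws" shows "hi k < lo l"
proof -
  have "k * W + W - 1 < Suc k * W" using W2[of l] assms by simp
  also have "\<dots> \<le> l * W" using assms by (intro mult_le_mono1) simp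
  finally show ?thesis by (simp add: lo_def hi_def)
qed

lemma slotE:
  assumes "i \<in> A"
  obtains k j where "k < length ws" "j < length (ws ! k)" "i = k * W + j + 1" "i div W = k"
    "k * W < i" "Suc i < k * W + W"
proof -
  obtain k j where kj: "k < length ws" "j < length (ws ! k)" "i = k * W + j + 1"
    using assms by (auto simp: A_eq)
  have "j + 1 < W" using W[OF kj(1)] kj(2) by simp
  then have "i div W = k" using kj(3) by (intro div_nat_eqI) (auto simp: algebra_simps)
  then show thesis using that kj W[OF kj(1)] by simp
qed

lemma slot_between:
  assumes "i \<in> A" "k = i div W" shows "4 * lo k \<le> 4 ^ i" "4 * 4 ^ i \<le> hi k" "k < length ws"
proof -
  obtain j where j: "k < length ws" "k * W < i" "Suc i < k * W + W"
    using slotE[OF assms(1)] assms(2) by metis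
  have "(4::real) ^ Suc (k * W) \<le> 4 ^ i" using j by (intro power_increasing) auto
  then show "4 * lo k \<le> 4 ^ i" by (simp add: lo_def)
  have "(4::real) ^ Suc i \<le> 4 ^ (k * W + W - 1)" using j by (intro power_increasing) auto
  then show "4 * 4 ^ i \<le> hi k" by (simp add: hi_def)
  show "k < length ws" by (rule j)
qed

text \<open>The right-hand side equals \<open>(u - lo k) * (hi k - u)\<close> divided by the squared
  radius. Since \<open>\<kappa>\<^sup>2 * (4 * hi k) = lo k\<close>, the crude bounds
  \<open>u - lo k \<ge> lo k\<close> and \<open>hi k - u \<ge> hi k / 16\<close> suffice. So the
  points in question lie below or on the flat part of the head.\<close>

lemma kappa_le:
  assumes k: "k < length ws" and u: "4 * lo k \<le> u" "4 * u \<le> hi k"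
  shows "\<kappa>\<^sup>2 \<le> 1 - ((- u - ctr k) / rad k)\<^sup>2"
proof -
  note lh = lo_hi[OF k] and R = rad_pos[OF k]
  have "1 - ((- u - ctr k) / rad k)\<^sup>2 = ((rad k)\<^sup>2 - (- u - ctr k)\<^sup>2) / (rad k)\<^sup>2"
    using R by (simp add: field_simps)
  also have "(rad k)\<^sup>2 - (- u - ctr k)\<^sup>2 = (u - lo k) * (hi k - u)"
    by (simp add: rad_def ctr_def power2_eq_square field_simps)
  finally have eq: "1 - ((- u - ctr k) / rad k)\<^sup>2 = (u - lo k) * (hi k - u) / (rad k)\<^sup>2" .
  have "k * W + W = Suc (k * W + W - 1)" using W2[OF k] by simp
  then have W4: "4 ^ W * lo k = 4 * hi k" unfolding lo_def hi_def
    by (metis mult.commute power_Suc power_add)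
  have "\<kappa>\<^sup>2 = 1 / 4 ^ W" unfolding kappa_eq by (simp add: power_divide power2_eq_square flip: power_mult_distrib)
  then have "\<kappa>\<^sup>2 * (4 ^ W * lo k) = lo k" by simp
  then have kap: "\<kappa>\<^sup>2 * (4 * hi k) = lo k" unfolding W4 .
  have "(rad k)\<^sup>2 \<le> (hi k / 2)\<^sup>2" using lh by (intro power_mono) (auto simp: rad_def)
  then have "\<kappa>\<^sup>2 * (rad k)\<^sup>2 \<le> \<kappa>\<^sup>2 * (hi k / 2)\<^sup>2" by (intro mult_left_mono) auto
  also have "\<dots> = (\<kappa>\<^sup>2 * (4 * hi k)) * (hi k / 16)" by (simp add: power2_eq_square)
  also have "\<dots> = lo k * (hi k / 16)" by (simp add: kap)
  also have "\<dots> \<le> (u - lo k) * (hi k - u)"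
    using lh u by (intro mult_mono) auto
  finally show ?thesis unfolding eq using R by (simp add: pos_le_divide_eq)
qed

text \<open>A lower strand joins two letters of one word, so it stays between the extreme letters of
  that block, and its depth is bounded by its larger endpoint, hence by \<open>H\<close>.\<close>

lemma strands_lower_bounds:
  assumes "(i, u) \<in> strands z" "Im z < 0"
  obtains k where "k < length ws" "4 * lo k \<le> - Re z" "4 * (- Re z) \<le> hi k" "- H \<le> Im z"
proof -
  have z: "Im z \<noteq> 0" and i: "i \<in> A" using assms by (auto simp: strands_def)
  note c = strands_circle[OF assms(1) z]
  have "g i div W = i div W" using g_head[OF i] c(1) assms(2) by simp
  then obtain k where k: "k = i div W" "k = g i div W" by simp
  have a: "4 * lo k \<le> 4 ^ min i (g i)" "4 * 4 ^ max i (g i) \<le> hi k"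
    using slot_between[OF i k(1)] slot_between[OF g_mem[OF i] k(2)]
    by (auto simp: min_def max_def)
  have kl: "k < length ws" by (rule slot_between(3)[OF i k(1)])
  have "max i (g i) \<le> length ws * W"
  proof -
    have "i < Suc k * W" "g i < Suc k * W"
      using slotE[OF i] slotE[OF g_mem[OF i]] k by (metis Suc_lessD add.commute mult_Suc)+
    moreover have "Suc k * W \<le> length ws * W" using kl by (intro mult_le_mono1) simp
    ultimately show ?thesis by simp
  qed
  then have "(4::real) ^ max i (g i) \<le> 4 ^ (length ws * W)" by (intro power_increasing) auto
  then have top: "(4::real) ^ max i (g i) \<le> H" using H_ge by linarith
  have p: "(0::real) < 4 ^ min i (g i)" by simp
  have "(Im z)\<^sup>2 \<le> H\<^sup>2"
    unfolding c(2) power2_eq_square[of H] using c(3,4) top p by (intro mult_mono) linarith+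
  then have "\<bar>Im z\<bar> \<le> H" using H by (metis abs_le_square_iff abs_of_pos)
  then show thesis using that[OF kl] a c(3,4) by linarith
qed

lemma strands_bottom:
  assumes "strands z \<noteq> {}" shows "- H \<le> Im z"
proof (cases "Im z < 0")
  case True
  then show ?thesis using assms strands_lower_bounds by (metis all_not_in_conv surj_pair)
qed (use H in simp)

lemma H_less_M: "H < M"
proof -
  have "1 < (1 + 1 / \<kappa>)\<^sup>2" using \<kappa> by (intro one_less_power) auto
  then show ?thesis using H by (simp add: M_def)
qed

lemma not_support_if_low: "Im z \<le> - M \<Longrightarrow> chart (2 * M) z \<notin> support D"
  using strands_bottom[of z] H_less_M by (auto simp: chart_support_iff)

lemma same_head:
  assumes "i \<in> A" "k < length ws" "lo k \<le> 4 ^ i" "4 ^ i \<le> hi k" shows "i div W = k"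
proof -
  have "i div W < length ws" "lo (i div W) < 4 ^ i" "4 ^ i < hi (i div W)"
    using slot_between[OF assms(1) refl] lo_hi[of "i div W"] zero_less_power[of "4::real" i]
    by linarith+
  then show ?thesis using hi_lo[of k "i div W"] hi_lo[of "i div W" k] assms(2-4)
    by (cases k "i div W" rule: linorder_cases) auto
qed

section \<open>Where a loop meets the diagram\<close>

definition ratio :: "nat \<Rightarrow> nat \<Rightarrow> real" where "ratio k i = (pos i - ctr k) / rad k"

text \<open>The time at which the loop passes letter \<open>i\<close>: the solution of
  \<open>sin (2 * pi * t) = ratio k i\<close> on the upper half of the loop, where the cosine is
  negative and the angle is therefore \<pi> minus the arcsine.\<close>

definition hit :: "nat \<Rightarrow> nat \<Rightarrow> real" where "hit k i = 1 / 2 - arcsin (ratio k i) / (2 * pi)"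

lemma ratio_bound:
  assumes "i \<in> A" "i div W = k" shows "\<kappa>\<^sup>2 \<le> 1 - (ratio k i)\<^sup>2" "- 1 < ratio k i" "ratio k i < 1"
proof -
  show 1: "\<kappa>\<^sup>2 \<le> 1 - (ratio k i)\<^sup>2"
    using kappa_le[of k "4 ^ i"] slot_between[OF assms(1), of k] assms(2) by (simp add: ratio_def pos_def)
  have "0 < \<kappa>\<^sup>2" using \<kappa> by simp
  then have "(ratio k i)\<^sup>2 < 1" using 1 by linarith
  then show "- 1 < ratio k i" "ratio k i < 1" by (simp_all add: abs_square_less_1 abs_less_iff)
qed

lemma hit_angle: "2 * pi * hit k i = pi - arcsin (ratio k i)"
  by (simp add: hit_def field_simps)

lemma sin_hit: assumes "i \<in> A" "i div W = k" shows "sin (2 * pi * hit k i) = ratio k i"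
  using ratio_bound[OF assms] by (simp add: hit_angle)

lemma cos_hit: assumes "i \<in> A" "i div W = k" shows "cos (2 * pi * hit k i) \<le> - \<kappa>"
proof -
  have "\<kappa> \<le> sqrt (1 - (ratio k i)\<^sup>2)" using ratio_bound(1)[OF assms] \<kappa> by (simp add: real_le_rsqrt)
  then show ?thesis using ratio_bound[OF assms] by (simp add: hit_angle cos_arcsin)
qed

lemma shape_hit:
  assumes "i \<in> A" "i div W = k"
  shows "shape (ctr k) (rad k) (cis (2 * pi * hit k i)) = of_real (pos i)"
proof -
  have "rad k > 0" using rad_pos slot_between(3)[OF assms(1)] assms(2) by simp
  moreover have "dip \<kappa> (- cos (2 * pi * hit k i)) = 0"
    using cos_hit[OF assms] \<kappa> by (intro dip_eq_0) auto
  ultimately show ?thesis unfolding shape_loop sin_hit[OF assms]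
    by (simp add: ratio_def complex_eq_iff)
qed

lemma hit_range: assumes "i \<in> A" "i div W = k" shows "hit k i \<in> {0..1}"
proof -
  have "- (pi / 2) \<le> arcsin (ratio k i)" "arcsin (ratio k i) \<le> pi / 2"
    using ratio_bound[OF assms] arcsin_bounded[of "ratio k i"] by auto
  then have "- (1 / 4) \<le> arcsin (ratio k i) / (2 * pi)" "arcsin (ratio k i) / (2 * pi) \<le> 1 / 4"
    by (simp_all add: field_simps)
  then show ?thesis unfolding hit_def atLeastAtMost_iff by linarith
qed

text \<open>Larger exponents lie further left and the loop traverses its flat top leftwards, so the
  letters are met in the order of the word.\<close>

lemma hit_mono:
  assumes "i \<in> A" "i div W = k" "i' \<in> A" "i' div W = k" "i < i'" shows "hit k i < hit k i'"
proof -
  have "rad k > 0" using rad_pos slot_between(3)[OF assms(1)] assms(2) by simp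
  then have "ratio k i' < ratio k i"
    using assms(5) by (simp add: ratio_def pos_def divide_strict_right_mono)
  then have "arcsin (ratio k i') < arcsin (ratio k i)"
    using ratio_bound[OF assms(1,2)] ratio_bound[OF assms(3,4)] by (intro arcsin_less_arcsin) auto
  then show ?thesis by (simp add: hit_def divide_strict_right_mono)
qed

text \<open>A meeting point below the axis would lie in the box of its own head, so the cosine would
  have modulus at least \<kappa>. A cosine at most -\<kappa> belongs to the flat part, at height 0;
  a cosine at least \<kappa> gives \<open>dip\<close> at least 4 and thus a depth of at least
  \<open>4 * H\<close>, below all strands. So meetings occur only on the axis, at letters.\<close>

lemma loop_meets:
  assumes k: "k < length ws" and t: "t \<in> {0..1}"
    and ne: "strands (shape (ctr k) (rad k) (cis (2 * pi * t))) \<noteq> {}"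
  obtains i where "i \<in> A" "i div W = k" "t = hit k i"
proof -
  define z where "z = shape (ctr k) (rad k) (cis (2 * pi * t))"
  note R = rad_pos[OF k] and lh = lo_hi[OF k]
  have Re_z: "Re z = ctr k + rad k * sin (2 * pi * t)"
    and Im_z: "Im z = - (H * dip \<kappa> (- cos (2 * pi * t)))" unfolding z_def shape_loop by simp_all
  have "\<bar>Re z - ctr k\<bar> \<le> rad k" unfolding z_def using Re_shape_disc[OF _ R] by simp
  then have X: "lo k \<le> - Re z" "- Re z \<le> hi k" by (auto simp: ctr_def rad_def abs_le_iff field_simps)
  obtain i u where iu: "(i, u) \<in> strands z" using ne z_def by fastforce
  have i: "i \<in> A" using iu by (simp add: strands_def)
  have s: "sin (2 * pi * t) = (Re z - ctr k) / rad k" using Re_z R by simp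
  have Im0: "Im z = 0"
  proof (rule ccontr)
    assume "Im z \<noteq> 0"
    moreover have "Im z \<le> 0" using Im_z H by simp
    ultimately have neg: "Im z < 0" by simp
    obtain l where l: "l < length ws" "4 * lo l \<le> - Re z" "4 * (- Re z) \<le> hi l" "- H \<le> Im z"
      using strands_lower_bounds[OF iu neg] .
    have "l = k"
      using hi_lo[of k l] hi_lo[of l k] l X k lo_hi[OF l(1)] lh
      by (cases k l rule: linorder_cases) auto
    then have "\<kappa>\<^sup>2 \<le> 1 - (sin (2 * pi * t))\<^sup>2" unfolding s using kappa_le[OF k, of "- Re z"] l by simp
    then have "\<kappa>\<^sup>2 \<le> (cos (2 * pi * t))\<^sup>2" by (simp add: cos_squared_eq)
    then have "\<kappa> \<le> \<bar>cos (2 * pi * t)\<bar>" using \<kappa> by (metis abs_le_square_iff abs_of_pos)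
    moreover have "\<not> \<kappa> \<le> - cos (2 * pi * t)"
      using Im_z neg dip_eq_0[OF \<kappa>(1)] by fastforce
    ultimately have c: "\<kappa> \<le> cos (2 * pi * t)" by (simp add: abs_if split: if_splits)
    have "1 \<le> cos (2 * pi * t) / \<kappa>" using c \<kappa> by simp
    then have "2\<^sup>2 \<le> (1 + cos (2 * pi * t) / \<kappa>)\<^sup>2" by (intro power_mono) auto
    then have "4 \<le> dip \<kappa> (- cos (2 * pi * t))" using c \<kappa> dip_neg[of \<kappa> "cos (2 * pi * t)"] by simp
    then have "H * 4 \<le> H * dip \<kappa> (- cos (2 * pi * t))" using H by (intro mult_left_mono) auto
    then show False using l(4) Im_z H by simp
  qed
  then have z: "z = of_real (pos i)" using strands_real[OF iu] by simp
  then have ik: "i div W = k" using same_head[OF i k] X by (simp add: pos_def)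
  have sr: "sin (2 * pi * t) = ratio k i" using s z by (simp add: ratio_def)
  have "dip \<kappa> (- cos (2 * pi * t)) = 0" using Im0 Im_z H by simp
  then have "1 + cos (2 * pi * t) / \<kappa> \<le> 0" by (simp add: dip_def max_def split: if_splits)
  then have "cos (2 * pi * t) \<le> - \<kappa>" using \<kappa> by (simp add: field_simps)
  then have c: "cos (2 * pi * t) < 0" using \<kappa> by simp
  \<comment> \<open>The cosine is negative, which confines \<open>t\<close> to the middle half of
    the interval, where the arcsine inverts the sine of \<pi> minus the angle.\<close>
  have "\<not> t \<le> 1 / 4"
  proof
    assume "t \<le> 1 / 4"
    then have "cos (2 * pi * t) \<ge> 0" using t by (intro cos_ge_zero) (auto simp: field_simps intro: order_trans[of _ 0])
    then show False using c by simp
  qed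
  moreover have "\<not> 3 / 4 \<le> t"
  proof
    assume "3 / 4 \<le> t"
    then have "cos (2 * pi * (1 - t)) \<ge> 0" using t by (intro cos_ge_zero) (auto simp: field_simps intro: order_trans[of _ 0])
    moreover have "cos (2 * pi * (1 - t)) = cos (2 * pi * t)" by (simp add: right_diff_distrib cos_diff)
    ultimately show False using c by simp
  qed
  ultimately have "- (pi / 2) \<le> pi - 2 * pi * t" "pi - 2 * pi * t \<le> pi / 2" by (auto simp: field_simps)
  then have "arcsin (sin (pi - 2 * pi * t)) = pi - 2 * pi * t" by (intro arcsin_sin) auto
  then have "arcsin (ratio k i) = pi - 2 * pi * t" by (simp add: sr)
  then have "t = hit k i" by (simp add: hit_def field_simps)
  then show thesis using that i ik by blast
qed


section \<open>The noose system and its words\<close>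

lemma length_N [simp]: "length N = length ws"
  by (simp add: N_def)

lemma N_nth: "k < length ws \<Longrightarrow> N ! k = noose_map (ctr k) (rad k)"
  by (simp add: N_def)

lemma slots_of_head:
  assumes "k < length ws"
  shows "{i \<in> A. i div W = k} = (\<lambda>j. k * W + j + 1) ` {..<length (ws ! k)}"
proof -
  have "(k * W + j + 1) div W = k" if "j < length (ws ! k)" for j
    using W[OF assms] that by (intro div_nat_eqI) (auto simp: algebra_simps)
  moreover have "\<exists>j<length (ws ! k). i = k * W + j + 1" if "i \<in> A" "i div W = k" for i
    using slotE[OF that(1)] that(2) by metis
  ultimately show ?thesis using assms by (fastforce simp: A_eq)
qed

lemma hit_params_loop:
  assumes k: "k < length ws"
  shows "hit_params D (loop_param (noose_map (ctr k) (rad k))) =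
     (\<lambda>j. hit k (k * W + j + 1)) ` {..<length (ws ! k)}"
proof -
  have "hit_params D (loop_param (noose_map (ctr k) (rad k))) = hit k ` {i \<in> A. i div W = k}"
  proof (intro equalityI subsetI)
    fix t assume "t \<in> hit_params D (loop_param (noose_map (ctr k) (rad k)))"
    then have "t \<in> {0..1}" "strands (shape (ctr k) (rad k) (cis (2 * pi * t))) \<noteq> {}"
      by (auto simp: hit_params_def loop_param_def noose_map_def chart_support_iff)
    then show "t \<in> hit k ` {i \<in> A. i div W = k}" using loop_meets[OF k] by blast
  next
    fix t assume "t \<in> hit k ` {i \<in> A. i div W = k}"
    then obtain i where i: "i \<in> A" "i div W = k" "t = hit k i" by auto
    then show "t \<in> hit_params D (loop_param (noose_map (ctr k) (rad k)))"
      using hit_range[OF i(1,2)] shape_hit[OF i(1,2)] strands_pos[OF i(1)]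
      by (simp add: hit_params_def loop_param_def noose_map_def chart_support_iff)
  qed
  then show ?thesis by (simp add: slots_of_head[OF k] image_image)
qed

lemma loop_at_hit:
  assumes i: "i \<in> A" "i div W = k"
  shows "loop_param (noose_map (ctr k) (rad k)) (hit k i) = chart (2 * M) (of_real (pos i))"
    and "path_deriv (loop_param (noose_map (ctr k) (rad k))) (hit k i) =
      dchart (2 * M) (of_real (pos i)) (dloop (rad k) (hit k i))"
    and "Re (dloop (rad k) (hit k i)) < 0"
proof -
  show "loop_param (noose_map (ctr k) (rad k)) (hit k i) = chart (2 * M) (of_real (pos i))"
    by (simp add: loop_param_def noose_map_def shape_hit[OF i])
  show "path_deriv (loop_param (noose_map (ctr k) (rad k))) (hit k i) =
      dchart (2 * M) (of_real (pos i)) (dloop (rad k) (hit k i))"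
    using path_derivI[OF has_vector_derivative_at_within[OF loop_has_vector_derivative] hit_range[OF i],
        of "ctr k" "rad k"] shape_hit[OF i] by simp
  have "rad k > 0" using rad_pos slot_between(3)[OF i(1)] i(2) by simp
  moreover have "cos (2 * pi * hit k i) < 0" using cos_hit[OF i] \<kappa> by simp
  ultimately show "Re (dloop (rad k) (hit k i)) < 0"
    by (simp add: dloop_def mult_less_0_iff)
qed

text \<open>The loop moves to the left at the letter, while the strand points vertically up or down
  according to \<open>side i\<close>. Their determinant is thus positive exactly for exponent
  1.\<close>

lemma int_letter_hit:
  assumes i: "i \<in> A" "i div W = k"
  shows "int_letter D (loop_param (noose_map (ctr k) (rad k))) (hit k i) = lab i"
proof -
  let ?z = "of_real (pos i) :: complex" and ?v = "dloop (rad k) (hit k i)"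
  obtain l t r where p: "preim D (chart (2 * M) ?z) = {(l, t)}" "fst (D ! l) = fst (lab i)"
    "r > 0" "tangent D l t = r *\<^sub>R dchart (2 * M) ?z (Complex 0 (side i))"
    using preim_pos[OF i(1)] .
  have "(THE it. it \<in> preim D (chart (2 * M) ?z)) = (l, t)" unfolding p(1) by blast
  then have "int_letter D (loop_param (noose_map (ctr k) (rad k))) (hit k i) =
     (fst (lab i), 0 < r * (cdet (Complex 0 (side i)) ?v / norm (lift (2 * M) ?z) ^ 3))"
    unfolding int_letter_def loop_at_hit[OF i]
    by (simp add: p(2,4) cross_mult_right dchart_triple)
  moreover have "0 < r * (cdet (Complex 0 (side i)) ?v / norm (lift (2 * M) ?z) ^ 3) \<longleftrightarrow> snd (lab i)"
    using loop_at_hit(3)[OF i] p(3)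
    by (auto simp: cdet_def side_def zero_less_mult_iff zero_less_divide_iff mult_less_0_iff
        divide_less_0_iff)
  ultimately show ?thesis by simp
qed

lemma transverse_loop:
  assumes k: "k < length ws" shows "transverse_path D (loop_param (noose_map (ctr k) (rad k)))"
proof -
  have "finite (hit_params D (loop_param (noose_map (ctr k) (rad k))))"
    by (simp add: hit_params_loop[OF k])
  moreover have "\<not> crossing D (loop_param (noose_map (ctr k) (rad k)) s) \<and>
      loop_param (noose_map (ctr k) (rad k)) differentiable (at s within {0..1}) \<and>
      (\<forall>(i, t) \<in> preim D (loop_param (noose_map (ctr k) (rad k)) s).
          cross3 (path_deriv (loop_param (noose_map (ctr k) (rad k))) s) (tangent D i t) \<noteq> 0)"
    if s: "s \<in> hit_params D (loop_param (noose_map (ctr k) (rad k)))" for s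
  proof -
    have "s \<in> hit k ` {i \<in> A. i div W = k}"
      using s by (simp add: hit_params_loop[OF k] slots_of_head[OF k] image_image)
    then obtain i where i: "i \<in> A" "i div W = k" and s: "s = hit k i" by blast
    let ?z = "of_real (pos i) :: complex" and ?v = "dloop (rad k) (hit k i)"
    obtain l t r where p: "preim D (chart (2 * M) ?z) = {(l, t)}"
      "r > 0" "tangent D l t = r *\<^sub>R dchart (2 * M) ?z (Complex 0 (side i))"
      using preim_pos[OF i(1)] .
    have "cdet ?v (Complex 0 (side i)) \<noteq> 0"
      using loop_at_hit(3)[OF i] by (auto simp: cdet_def side_def)
    then have "cross3 (dchart (2 * M) ?z ?v) (tangent D l t) \<noteq> 0"
      using p(2,3) cross3_dchart_nonzero by (simp add: cross_mult_right)
    moreover have "loop_param (noose_map (ctr k) (rad k)) differentiable (at s within {0..1})"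
      by (rule differentiableI_vector[OF has_vector_derivative_at_within[OF loop_has_vector_derivative]])
    moreover have "card (preim D (chart (2 * M) ?z)) = 1" by (simp add: p(1))
    ultimately show ?thesis
      unfolding s loop_at_hit[OF i] by (simp add: crossing_def p(1))
  qed
  ultimately show ?thesis unfolding transverse_path_def by blast
qed

lemma rope_misses:
  assumes "s \<in> {0..1}" shows "rope_in (noose_map c R) s \<notin> support D"
proof -
  have "s * M \<le> 1 * M" using assms M_pos by (intro mult_right_mono) auto
  then show ?thesis unfolding rope_in_eq[OF assms] by (intro not_support_if_low) simp
qed

lemma hit_params_rope: "hit_params D (rope_in (noose_map c R)) = {}" "hit_params D (rope_out (noose_map c R)) = {}"
proof -
  have "rope_out (noose_map c R) s = rope_in (noose_map c R) (1 - s)" for s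
    by (simp add: rope_out_def rope_in_def)
  then show "hit_params D (rope_in (noose_map c R)) = {}" "hit_params D (rope_out (noose_map c R)) = {}"
    using rope_misses by (auto simp: hit_params_def)
qed

lemma noose_word_N:
  assumes k: "k < length ws" shows "noose_word D (noose_map (ctr k) (rad k)) = ws ! k"
proof -
  let ?\<tau> = "\<lambda>j. hit k (k * W + j + 1)"
  have slot: "k * W + j + 1 \<in> A" "(k * W + j + 1) div W = k" if "j < length (ws ! k)" for j
    using slots_of_head[OF k] that by auto
  have "int_word D (loop_param (noose_map (ctr k) (rad k))) = ws ! k"
  proof (rule int_word_eqI[OF hit_params_loop[OF k]])
    show "?\<tau> i < ?\<tau> j" if "i < j" "j < length (ws ! k)" for i j
      using that slot[of i] slot[of j] by (intro hit_mono) auto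
    show "int_letter D (loop_param (noose_map (ctr k) (rad k))) (?\<tau> j) = ws ! k ! j"
      if "j < length (ws ! k)" for j
      using int_letter_hit[OF slot[OF that]] lab_eq[OF k that] by simp
  qed simp
  then show ?thesis
    by (simp add: noose_word_def loop_ccw_noose_map[OF rad_pos[OF k]] int_word_def hit_params_rope)
qed

lemma noose_for_N:
  assumes k: "k < length ws" shows "noose_for D (noose_map (ctr k) (rad k))"
proof -
  have "root (noose_map (ctr k) (rad k)) \<notin> support D"
    using not_support_if_low[of "Complex 0 (- (2 * M))"] M_pos
    by (simp add: root_noose_map flip: chart_root[of "2 * M"])
  moreover have "neck (noose_map (ctr k) (rad k)) \<notin> support D"
    unfolding neck_noose_map by (intro not_support_if_low) simp
  ultimately show ?thesis
    using transverse_loop[OF k] noose_noose_map[OF rad_pos[OF k]]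
    by (simp add: noose_for_def loop_ccw_noose_map[OF rad_pos[OF k]] transverse_path_def[of D "rope_in _"]
        transverse_path_def[of D "rope_out _"] hit_params_rope)
qed

lemma ctr_rad: "ctr k + rad k = - lo k" "ctr k - rad k = - hi k"
  by (simp_all add: ctr_def rad_def field_simps)

lemma ctr_less: assumes "k < l" "l < length ws" shows "ctr l < ctr k"
  using hi_lo[OF assms] lo_hi[of k] lo_hi[of l] assms by (simp add: ctr_def)

lemma noose_system_N: "noose_system D N"
proof -
  let ?b = "vector [0, 0, 1] :: real^3"
  have "noose_for D (N ! k)" if "k < length N" for k
    using noose_for_N that by (simp add: N_nth)
  moreover have "root (N ! k) = ?b" if "k < length N" for k
    using that by (simp add: N_nth root_noose_map)
  moreover have "(N ! k) ` noose_X \<inter> (N ! l) ` noose_X = {?b}"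
    if kl: "k < length N" "l < length N" "k \<noteq> l" for k l
  proof -
    \<comment> \<open>Since heads proceed leftwards, the noose with the larger index is the left
      one.\<close>
    have *: "(N ! k) ` noose_X \<inter> (N ! l) ` noose_X = {?b}" if "k < l" "l < length ws" for k l
      using noose_map_images_Int[of "rad l" "rad k" "ctr l" "ctr k"] rad_pos[of k] rad_pos[of l] that hi_lo[OF that]
      by (simp add: N_nth ctr_rad Int_commute)
    show ?thesis using *[of k l] *[of l k] kl by (cases k l rule: linorder_cases) (auto simp: Int_commute)
  qed
  moreover have "ccw_angle ?b (rope_dir (N ! 0)) (rope_dir (N ! k))
      < ccw_angle ?b (rope_dir (N ! 0)) (rope_dir (N ! l))" if "k < l" "l < length N" for k l
  proof -
    have "ctr k \<le> ctr 0" using ctr_less[of 0 k] that by (cases "k = 0") auto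
    moreover have "N ! 0 = noose_map (ctr 0) (rad 0)" using that by (intro N_nth) auto
    ultimately show ?thesis
      using ccw_angle_less[OF ctr_less[of k l], of "ctr 0"] that by (simp add: N_nth rope_dir_noose_map)
  qed
  moreover have "\<exists>k<length N. p \<in> head (N ! k)" if cr: "crossing D p" for p
  proof -
    obtain z i u where z: "p = chart (2 * M) z" "(i, u) \<in> strands z" "Im z < 0"
      using crossingD[OF cr] .
    obtain k where k: "k < length ws" "4 * lo k \<le> - Re z" "4 * (- Re z) \<le> hi k" "- H \<le> Im z"
      using strands_lower_bounds[OF z(2,3)] .
    have "chart (2 * M) (Complex (Re z) (Im z)) \<in> head (noose_map (ctr k) (rad k))"
      using kappa_le[OF k(1-3)] k(4) z(3) by (intro head_memI rad_pos[OF k(1)]) auto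
    then show ?thesis using z(1) k(1) N_nth by auto
  qed
  ultimately show ?thesis unfolding noose_system_def by blast
qed

lemma map_noose_word_N: "map (noose_word D) N = ws"
  by (intro nth_equalityI) (simp_all add: N_nth noose_word_N)

end

section \<open>Realisation of commutator identities\<close>

definition slots :: "nat \<Rightarrow> 's letter list list \<Rightarrow> nat \<Rightarrow> (nat \<times> 's letter) list" where
  "slots W ws n = concat (map (\<lambda>k. map (\<lambda>j. (k * W + j + 1, ws ! k ! j)) [0..<length (ws ! k)]) [0..<n])"

lemma set_slots:
  "set (slots W ws n) = {(k * W + j + 1, ws ! k ! j) | k j. k < n \<and> j < length (ws ! k)}"
  unfolding slots_def by (auto simp del: One_nat_def) blast

lemma map_snd_slots: "map snd (slots W ws (length ws)) = concat ws"
proof -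
  have "map snd (slots W ws (length ws)) = concat (map (\<lambda>k. map ((!) (ws ! k)) [0..<length (ws ! k)]) [0..<length ws])"
    by (simp add: slots_def map_concat comp_def)
  also have "\<dots> = concat (map ((!) ws) [0..<length ws])" by (simp only: map_nth)
  finally show ?thesis by (simp only: map_nth)
qed

lemma sorted_slots:
  assumes "\<And>k. k < n \<Longrightarrow> length (ws ! k) + 2 \<le> W"
  shows "sorted_wrt (<) (map fst (slots W ws n))"
  using assms
proof (induction n)
  case (Suc n)
  have eq: "map fst (slots W ws (Suc n)) =
      map fst (slots W ws n) @ map (\<lambda>j. n * W + j + 1) [0..<length (ws ! n)]"
    by (simp add: slots_def comp_def)
  have "x < n * W" if x: "x \<in> set (map fst (slots W ws n))" for x
  proof -
    obtain k j where k: "x = k * W + j + 1" "k < n" "j < length (ws ! k)"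
      using x by (auto simp: set_slots)
    have "x < Suc k * W" using k Suc.prems[of k] by simp
    also have "\<dots> \<le> n * W" using k(2) by (intro mult_le_mono1) simp
    finally show ?thesis .
  qed
  moreover have "sorted_wrt (<) (map (\<lambda>j. n * W + j + 1) [0..<length (ws ! n)])"
    by (simp add: sorted_wrt_iff_nth_less)
  ultimately show ?case unfolding eq sorted_wrt_append using Suc by force
qed (simp add: slots_def)

theorem theorem3p3:
  fixes S :: "'s set" and ws :: "'s letter list list"
  assumes "S \<noteq> {}"
    and "commutator_identity S ws"
  shows "\<exists>(D :: 's diagram) (N :: (complex \<Rightarrow> real^3) list).
           doodle D \<and> colored S D \<and> noose_system D N \<and> map (noose_word D) N = ws"
proof -
  have S: "is_word S w" "in_commutator_subgroup S w" if "w \<in> set ws" for w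
    using assms(2) that by (auto simp: commutator_identity_def)
  \<comment> \<open>One block length for all words; the added 2 reserves the two ends of each block
    for the head.\<close>
  define W where "W = sum_list (map length ws) + 2"
  have W: "length (ws ! k) + 2 \<le> W" if "k < length ws" for k
    using that by (simp add: W_def member_le_sum_list)
  define zs where "zs = slots W ws (length ws)"
  define A where "A = fst ` set zs"
  define lab where "lab i = ws ! (i div W) ! (i mod W - 1)" for i
  have idx: "(k * W + j + 1) div W = k" "lab (k * W + j + 1) = ws ! k ! j"
    if "k < length ws" "j < length (ws ! k)" for k j
  proof -
    have "j + 1 < W" using W[OF that(1)] that(2) by simp
    then have "((j + 1) + k * W) div W = k" "((j + 1) + k * W) mod W = j + 1"
      by (simp_all only: div_mult_self1 mod_mult_self1 div_less mod_less W_def)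
    then show "(k * W + j + 1) div W = k" "lab (k * W + j + 1) = ws ! k ! j"
      by (simp_all add: lab_def ac_simps)
  qed
  have A_eq: "A = {k * W + j + 1 | k j. k < length ws \<and> j < length (ws ! k)}"
    by (force simp: A_def zs_def set_slots)
  have finA: "finite A" by (simp add: A_def)
  have zs_lab: "(i, x) \<in> set zs \<longleftrightarrow> i \<in> A \<and> x = lab i" for i x
    unfolding A_eq zs_def set_slots using idx(2) by (auto simp del: One_nat_def)
  have "dyck (map snd zs)"
    using assms(2) dyck_if_free_eq_Nil unfolding zs_def map_snd_slots commutator_identity_def by blast
  moreover have "sorted_wrt (<) (map fst zs)" unfolding zs_def using W by (rule sorted_slots)
  ultimately obtain \<sigma> where ncm: "noncrossing_matching A \<sigma>"
      and \<sigma>: "\<And>i x. (i, x) \<in> set zs \<Longrightarrow> (\<sigma> i, letter_inv x) \<in> set zs"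
    using dyck_noncrossing_matching unfolding A_def by blast
  note \<sigma>A = noncrossing_matchingD[OF ncm]
  have lab_\<sigma>: "lab (\<sigma> i) = letter_inv (lab i)" if "i \<in> A" for i
    using \<sigma>[of i "lab i"] that by (simp add: zs_lab)
  define P Q where "P = {i \<in> A. snd (lab i)}" and "Q = {i \<in> A. \<not> snd (lab i)}"
  have \<sigma>_bij: "bij_betw \<sigma> P Q"
    by (rule bij_betw_byWitness[where f' = \<sigma>])
       (auto simp: P_def Q_def \<sigma>A lab_\<sigma> letter_inv_def)
  \<comment> \<open>The inner matching: negative letters are paired with positive ones of the same
    word and the same symbol. It need not be noncrossing, since its crossings lie in the
    heads.\<close>
  have "\<exists>\<tau>. bij_betw \<tau> Q P \<and> (\<forall>i\<in>Q. (\<tau> i div W, fst (lab (\<tau> i))) = (i div W, fst (lab i)))"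
  proof (rule bij_betw_fibrewise)
    fix c :: "nat \<times> 's"
    obtain k a where c: "c = (k, a)" by fastforce
    have card: "card {i \<in> A. snd (lab i) = e \<and> (i div W, fst (lab i)) = c} =
        card {j. j < length (ws ! k) \<and> ws ! k ! j = (a, e)}" if k: "k < length ws" for e
    proof -
      have "{i \<in> A. snd (lab i) = e \<and> (i div W, fst (lab i)) = c} =
          (\<lambda>j. k * W + j + 1) ` {j. j < length (ws ! k) \<and> ws ! k ! j = (a, e)}"
        using idx k unfolding A_eq c by (auto simp: image_iff prod_eq_iff simp del: One_nat_def)
      then show ?thesis by (simp add: card_image inj_on_def)
    qed
    have "card {i \<in> A. snd (lab i) = False \<and> (i div W, fst (lab i)) = c} =
        card {i \<in> A. snd (lab i) = True \<and> (i div W, fst (lab i)) = c}"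
    proof (cases "k < length ws")
      case True
      then have "exponent_sum a (ws ! k) = 0"
        using exponent_sum_commutator_subgroup S(2) nth_mem by metis
      then show ?thesis unfolding card[OF True] exponent_sum_card by simp
    next
      case False
      then have "{i \<in> A. snd (lab i) = e \<and> (i div W, fst (lab i)) = c} = {}" for e
        using idx(1) unfolding A_eq c by (auto simp del: One_nat_def)
      then show ?thesis by (simp only:)
    qed
    then show "card {i \<in> Q. (i div W, fst (lab i)) = c} = card {i \<in> P. (i div W, fst (lab i)) = c}"
      unfolding P_def Q_def by (simp add: conj_ac)
  qed (use finA in \<open>simp_all add: P_def Q_def\<close>)
  then obtain \<tau> where \<tau>_bij: "bij_betw \<tau> Q P"
    and \<tau>: "\<And>i. i \<in> Q \<Longrightarrow> \<tau> i div W = i div W \<and> fst (lab (\<tau> i)) = fst (lab i)" by auto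
  \<comment> \<open>Upper strands follow the noncrossing matching of the whole product, lower
    strands the matching inside a word.\<close>
  define g where "g i = (if snd (lab i) then \<sigma> i else \<tau> i)" for i
  have "bij_betw g P Q" using \<sigma>_bij by (rule bij_betw_cong[THEN iffD1, rotated]) (simp add: g_def P_def)
  moreover have "bij_betw g Q P" using \<tau>_bij by (rule bij_betw_cong[THEN iffD1, rotated]) (simp add: g_def Q_def)
  ultimately have "bij_betw g (P \<union> Q) (Q \<union> P)" by (rule bij_betw_combine) (auto simp: P_def Q_def)
  moreover have "P \<union> Q = A" "Q \<union> P = A" by (auto simp: P_def Q_def)
  ultimately have g_bij: "bij_betw g A A" by simp
  have lab_g: "lab (g i) = letter_inv (lab i)" if "i \<in> A" for i
  proof (cases "snd (lab i)")
    case False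
    then have "i \<in> Q" using that by (simp add: Q_def)
    then show ?thesis using \<tau> bij_betwE[OF \<tau>_bij] False
      by (simp add: g_def letter_inv_def prod_eq_iff P_def)
  qed (use lab_\<sigma> that in \<open>simp add: g_def\<close>)
  have upper: "\<not> (min i (g i) < min j (g j) \<and> min j (g j) < max i (g i) \<and> max i (g i) < max j (g j))"
    if "i \<in> A" "j \<in> A" "snd (lab i)" "snd (lab j)" for i j
  proof -
    \<comment> \<open>As \<sigma> is an involution, it does not matter which of the two ends carries
      the positive letter.\<close>
    have m: "min i (g i) \<in> A \<and> \<sigma> (min i (g i)) = max i (g i)" if "i \<in> A" "snd (lab i)" for i
      using \<sigma>A(1,2)[OF that(1)] that by (auto simp: g_def min_def max_def)
    then show ?thesis
      using \<sigma>A(3)[of "min i (g i)" "min j (g j)"] m[OF that(1,3)] m[OF that(2,4)] by fastforce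
  qed
  obtain cs where cs: "distinct (concat cs)" "set (concat cs) = A"
    "\<forall>c\<in>set cs. c \<noteq> [] \<and> (\<forall>i<length c. g (c ! i) = c ! (Suc i mod length c))"
    using permutation_cycles[OF finA g_bij] by blast
  \<comment> \<open>This yields the bound \<open>1 / 2 ^ W \<le> 1 / 2\<close> demanded by
    \<open>noose_shape\<close>.\<close>
  have "(2::real) ^ 1 \<le> 2 ^ W" by (rule power_increasing) (simp_all add: W_def)
  then interpret noose_diagram "1 / 2 ^ W" "4 ^ (length ws * W)" A lab g cs W ws
    using g_bij lab_g upper cs A_eq idx W \<tau>
    by unfold_locales (auto simp: g_def Q_def divide_simps)
  have "colored S D"
  proof (rule colored_D)
    fix i assume "i \<in> A"
    then obtain k j where "k < length ws" "j < length (ws ! k)" "lab i = ws ! k ! j"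
      using idx(2) unfolding A_eq by auto
    then show "fst (lab i) \<in> S" using S(1)[of "ws ! k"] by (simp add: is_word_def)
  qed
  then show ?thesis using doodle_D noose_system_N map_noose_word_N by blast
qed

end
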